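(* Let $\mathcal M$ and $\tilde{\mathcal M}$ be Hilbert modules over $\mathcal A(\Omega)$ in $\mathrm B_r(\Omega)$, both containing $\mathbb C[z_1,\dots,z_m]$, let $k\ge1$, and let $\mathcal M_q$, $\tilde{\mathcal M}_q$ be their quotient modules by the submodules of functions vanishing to order at least $k$ along $\mathcal Z=\{z\in\Omega:z_1=\cdots=z_d=0\}$. Let $E$, $\tilde E$ be the hermitian holomorphic vector bundles over $\Omega^*$ associated to $\mathcal M$, $\tilde{\mathcal M}$, let $\mathbf s$, $\tilde{\mathbf s}$ be holomorphic frames of $E$, $\tilde E$ on a neighbourhood $U$ of $0$ normalized at the origin along $\mathcal Z$, and let $H$, $\tilde H$ be their Gramian matrices. Then $\mathcal M_q$ and $\tilde{\mathcal M}_q$ are unitarily equivalent as modules over $\mathcal A(\Omega)$ if and only if there exists a constant unitary matrix $D$ such that $$\partial^\alpha\bar\partial^\beta H=D\,(\partial^\alpha\bar\partial^\beta\tilde H)\,D^*\quad\text{on }\mathcal Z^*\cap U$$ for all $\alpha,\beta\in A=\{\alpha\in(\mathbb N\cup\{0\})^d:|\alpha|<k\}$.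
   Context: $\Omega\subset\mathbb C^m$ is a bounded domain containing $0$, $1\le d\le m$, and $\mathcal Z$ is connected. For a set $V$, $V^*=\{\bar z:z\in V\}$; so $\mathcal Z^*=\{w\in\Omega^*:w_1=\dots=w_d=0\}$. Points are written $(z',z'')$ with $z'=(z_1,\dots,z_d)$, $z''=(z_{d+1},\dots,z_m)$. For $\alpha\in(\mathbb N\cup\{0\})^d$, $\partial^\alpha=\partial_1^{\alpha_1}\cdots\partial_d^{\alpha_d}$ and $\bar\partial^\alpha=\bar\partial_1^{\alpha_1}\cdots\bar\partial_d^{\alpha_d}$ (first $d$ variables only). $\mathcal A(\Omega)$ is the closure, in the supremum norm on $\overline\Omega$, of the functions holomorphic near $\overline\Omega$. The Hilbert modules considered ($\mathcal M$, and likewise $\tilde{\mathcal M}$) are Hilbert spaces of holomorphic functions $\Omega\to\mathbb C^r$ with norm-continuous action of $\mathcal A(\Omega)$ by pointwise multiplication, with all evaluations $ev_z:\mathcal M\to\mathbb C^r$ bounded and surjective, containing all $\mathbb C^r$-valued polynomials, and with the Gleason property ($h(z)=0$ iff $h(w)=\sum_i(w_i-z_i)h^{(i)}(w)$ with $h^{(i)}\in\mathcal M$). Membership in $\mathrm B_r(\Omega)$ means that $(M_{z_1}^*,\dots,M_{z_m}^* )$ is in the Cowen–Douglas class $\mathrm B_r(\Omega^* )$: $\dim\bigcap_i\ker(M_{z_i}^*-w_i)=r$ and the range of $h\mapsto((M_{z_i}^*-w_i)h)_{i}$ is closed for each $w\in\Omega^*$, and these joint kernels span a dense subspace. $\mathcal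 M_0=\{h\in\mathcal M:\partial^\alpha h_j|_{\mathcal Z}=0,\ \alpha\in A,\ 1\le j\le r\}$; $\mathcal M_q=\mathcal M\ominus\mathcal M_0$ with action $f\cdot P(h)=P(fh)$, $P$ the orthogonal projection onto $\mathcal M_q$. Unitarily equivalent as modules means there is a unitary intertwining the module actions. Let $K$ be the reproducing kernel of $\mathcal M$. The bundle $E\to\Omega^*$ has fibre $E_w=\bigcap_i\ker(M_{z_i}^*-w_i)=\{K(\cdot,\bar w)\zeta:\zeta\in\mathbb C^r\}\subset\mathcal M$ with hermitian metric induced from $\mathcal M$ and global holomorphic frame $K(\cdot,\bar w)\sigma_1,\dots,K(\cdot,\bar w)\sigma_r$ ($\sigma_j$ the standard basis of $\mathbb C^r$); sections of $E$ are regarded as $\mathcal M$-valued functions. The Gramian of a frame $\mathbf s=\{s_1,\dots,s_r\}$ is $H=(\langle s_i,s_j\rangle)_{i,j}$. Similarly for $\tilde{\mathcal M}$. A holomorphic frame $\mathbf s$ of $E$ on an open neighbourhood $U\subset\Omega^*$ of $0$ (with $U$ and $U\cap\mathcal Z^*$ connected) is normalized at the origin along $\mathcal Z$ if $\langle s_i(0,z''),s_j(0,0)\rangle=\delta_{ij}$ and $\langle\partial^\alpha s_i(0,z''),s_j(0,0)\rangle=0$ for all $(0,z'')\in U\cap\mathcal Z^*$, all $i,j$ and all nonzero $\alpha\in(\mathbb N\cup\{0\})^d$. *)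

theory Defs
  imports "HOL-Analysis.Analysis" "HOL-Library.Function_Algebras"
begin

text \<open>
  Points of \<open>\<complex>\<^sup>m\<close> have type \<^typ>\<open>complex^'m\<close>, where the finite index type \<open>'m\<close> is linearly
  ordered so that ``the first \<open>d\<close> coordinates'' makes sense.  A function \<open>\<Omega> \<rightarrow> \<complex>\<^sup>r\<close> is
  represented by the total function on \<open>\<complex>\<^sup>m\<close> that extends it by \<open>0\<close>; equality,
  addition (pointwise, from \<^theory>\<open>HOL-Library.Function_Algebras\<close>) and scaling are then
  those of functions on \<open>\<Omega>\<close>.
\<close>

section \<open>Several complex variables\<close>

text \<open>
  Same type as \<^typ>\<open>complex^'m\<close>; the \<open>^\<close> syntax would add the sort \<open>finite\<close> at each occurrence
  of \<open>'m\<close>, which clashes with the sort of ordered index types.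
\<close>

type_synonym 'n cvec = "(complex, 'n) vec"

definition vcnj :: "complex^'m \<Rightarrow> complex^'m" where
  "vcnj z = (\<chi> i. cnj (z $ i))"

definition cinner :: "complex^'r \<Rightarrow> complex^'r \<Rightarrow> complex" where
  "cinner x y = (\<Sum>i\<in>UNIV. x $ i * cnj (y $ i))"

definition first_coords :: "nat \<Rightarrow> 'm::{finite,linorder} set" where
  "first_coords d = {i. card {j. j < i} < d}"

text \<open>\<open>\<Z>\<close>; applied to \<open>vcnj ` \<Omega>\<close> it gives \<open>\<Z>\<^sup>*\<close>.\<close>

definition zero_locus :: "(complex^'m) set \<Rightarrow> 'm set \<Rightarrow> (complex^'m) set" where
  "zero_locus \<Omega> J = {z \<in> \<Omega>. \<forall>i\<in>J. z $ i = 0}"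

text \<open>Complex Frechet differentiability at every point; used for open sets \<open>S\<close>.\<close>

definition sv_holomorphic_on :: "(complex^'m \<Rightarrow> complex) \<Rightarrow> (complex^'m) set \<Rightarrow> bool" where
  "sv_holomorphic_on f S \<longleftrightarrow>
     (\<forall>z\<in>S. \<exists>f'. (f has_derivative f') (at z) \<and> (\<forall>c v. f' (c *s v) = c * f' v))"

text \<open>
  The algebra \<open>\<A>(\<Omega>)\<close>.  Only the values on \<open>closure \<Omega>\<close> are constrained (and later
  only those values are used).
\<close>

definition alg :: "(complex^'m) set \<Rightarrow> (complex^'m \<Rightarrow> complex) set" where
  "alg \<Omega> = {f. \<exists>g. (\<forall>n::nat. \<exists>W. open W \<and> closure \<Omega> \<subseteq> W \<and> sv_holomorphic_on (g n) W) \<and>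
                  uniform_limit (closure \<Omega>) g f sequentially}"

text \<open>Multi-indices in \<open>(\<nat> \<union> {0})\<^sup>d\<close> are functions on all of \<open>'m\<close> that vanish off the first \<open>d\<close> indices.\<close>

definition multi_indices :: "'m set \<Rightarrow> ('m \<Rightarrow> nat) set" where
  "multi_indices J = {\<alpha>. \<forall>i. i \<notin> J \<longrightarrow> \<alpha> i = 0}"

definition multi_indices_below :: "'m::finite set \<Rightarrow> nat \<Rightarrow> ('m \<Rightarrow> nat) set" where
  "multi_indices_below J k = {\<alpha> \<in> multi_indices J. (\<Sum>i\<in>J. \<alpha> i) < k}"

text \<open>\<open>D\<^sub>1\<^sup>\<alpha>\<^sup>1 \<dots> D\<^sub>m\<^sup>\<alpha>\<^sup>m\<close> for a family of partial derivative operators \<open>D\<close>, in this order of composition.\<close>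

definition multi_deriv ::
  "('m::{finite,linorder} \<Rightarrow> 'f \<Rightarrow> 'f) \<Rightarrow> ('m \<Rightarrow> nat) \<Rightarrow> 'f \<Rightarrow> 'f" where
  "multi_deriv D \<alpha> = foldr (\<lambda>i. D i ^^ \<alpha> i) (sorted_list_of_set UNIV)"

text \<open>Complex partial derivative, for holomorphic scalar functions.\<close>

definition partial :: "'m \<Rightarrow> (complex^'m \<Rightarrow> complex) \<Rightarrow> complex^'m \<Rightarrow> complex" where
  "partial i f z = deriv (\<lambda>t. f (z + t *s axis i 1)) 0"

text \<open>Wirtinger derivatives, for smooth scalar functions.\<close>

definition partial_x :: "'m \<Rightarrow> (complex^'m \<Rightarrow> complex) \<Rightarrow> complex^'m \<Rightarrow> complex" where
  "partial_x i f z = vector_derivative (\<lambda>t::real. f (z + of_real t *s axis i 1)) (at 0)"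

definition partial_y :: "'m \<Rightarrow> (complex^'m \<Rightarrow> complex) \<Rightarrow> complex^'m \<Rightarrow> complex" where
  "partial_y i f z = vector_derivative (\<lambda>t::real. f (z + (\<i> * of_real t) *s axis i 1)) (at 0)"

definition wirtinger :: "'m \<Rightarrow> (complex^'m \<Rightarrow> complex) \<Rightarrow> complex^'m \<Rightarrow> complex" where
  "wirtinger i f z = (partial_x i f z - \<i> * partial_y i f z) / 2"

definition wirtinger_bar :: "'m \<Rightarrow> (complex^'m \<Rightarrow> complex) \<Rightarrow> complex^'m \<Rightarrow> complex" where
  "wirtinger_bar i f z = (partial_x i f z + \<i> * partial_y i f z) / 2"

definition adj_matrix :: "complex^'r^'r \<Rightarrow> complex^'r^'r" where
  "adj_matrix D = (\<chi> i j. cnj (D $ j $ i))"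

definition unitary_matrix :: "complex^'r^'r \<Rightarrow> bool" where
  "unitary_matrix D \<longleftrightarrow> D ** adj_matrix D = mat 1 \<and> adj_matrix D ** D = mat 1"

text \<open>Polynomials with coefficients in \<open>\<complex>\<^sup>r\<close>, restricted to \<open>\<Omega>\<close>.\<close>

definition vec_polynomials :: "(complex^'m) set \<Rightarrow> (complex^'m \<Rightarrow> complex^'r) set" where
  "vec_polynomials \<Omega> =
     {p. \<exists>(B :: ('m \<Rightarrow> nat) set) c. finite B \<and>
       p = (\<lambda>z. if z \<in> \<Omega> then \<Sum>\<beta>\<in>B. (\<Prod>i\<in>UNIV. z $ i ^ \<beta> i) *s c \<beta> else 0)}"


section \<open>Hilbert spaces of vector-valued functions\<close>

definition fscale :: "complex \<Rightarrow> ('a \<Rightarrow> complex^'r) \<Rightarrow> 'a \<Rightarrow> complex^'r" where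
  "fscale c h = (\<lambda>z. c *s h z)"

interpretation cfun: vector_space "fscale :: complex \<Rightarrow> ('a \<Rightarrow> complex^'r) \<Rightarrow> _"
  by unfold_locales
    (auto simp: fscale_def fun_eq_iff vector_add_ldistrib vector_sadd_rdistrib vector_smult_assoc)

text \<open>The inner product is linear in its first and conjugate linear in its second argument.\<close>

record 'v hspace =
  hcar :: "'v set"
  hip :: "'v \<Rightarrow> 'v \<Rightarrow> complex"

definition hnorm :: "'v hspace \<Rightarrow> 'v \<Rightarrow> real" where
  "hnorm M h = sqrt (Re (hip M h h))"

definition hilbert_space :: "('a \<Rightarrow> complex^'r) hspace \<Rightarrow> bool" where
  "hilbert_space M \<longleftrightarrow>
     cfun.subspace (hcar M) \<and>
     (\<forall>f\<in>hcar M. \<forall>g\<in>hcar M. \<forall>h\<in>hcar M. hip M (f + g) h = hip M f h + hip M g h) \<and>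
     (\<forall>f\<in>hcar M. \<forall>h\<in>hcar M. \<forall>c. hip M (fscale c f) h = c * hip M f h) \<and>
     (\<forall>f\<in>hcar M. \<forall>h\<in>hcar M. hip M h f = cnj (hip M f h)) \<and>
     (\<forall>f\<in>hcar M. f \<noteq> 0 \<longrightarrow> Re (hip M f f) > 0) \<and>
     (\<forall>X. (\<forall>n::nat. X n \<in> hcar M) \<and>
          (\<forall>e>0. \<exists>N. \<forall>m\<ge>N. \<forall>n\<ge>N. hnorm M (X m - X n) < e) \<longrightarrow>
          (\<exists>h\<in>hcar M. (\<lambda>n. hnorm M (X n - h)) \<longlonglongrightarrow> 0))"

definition hadjoint :: "'v hspace \<Rightarrow> ('v \<Rightarrow> 'v) \<Rightarrow> 'v \<Rightarrow> 'v" where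
  "hadjoint M T g = (THE g'. g' \<in> hcar M \<and> (\<forall>h\<in>hcar M. hip M (T h) g = hip M h g'))"

definition hproj :: "('a \<Rightarrow> complex^'r) hspace \<Rightarrow> ('a \<Rightarrow> complex^'r) set \<Rightarrow>
    ('a \<Rightarrow> complex^'r) \<Rightarrow> ('a \<Rightarrow> complex^'r)" where
  "hproj M N h = (THE g. g \<in> N \<and> (\<forall>n\<in>N. hip M (h - g) n = 0))"

text \<open>The module action of a scalar function by pointwise multiplication.\<close>

definition fmult :: "('a \<Rightarrow> complex) \<Rightarrow> ('a \<Rightarrow> complex^'r) \<Rightarrow> 'a \<Rightarrow> complex^'r" where
  "fmult f h = (\<lambda>z. f z *s h z)"


section \<open>Hilbert modules\<close>

text \<open>
  In the continuity clause, \<open>\<forall>z\<in>closure \<Omega>. cmod (f z - f\<^sub>0 z) \<le> \<delta>\<close> says that the distance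
  of \<open>f\<close> and \<open>f\<^sub>0\<close> in the supremum norm of \<open>alg \<Omega>\<close> is at most \<open>\<delta>\<close>.
\<close>

definition hilbert_module ::
  "(complex^'m) set \<Rightarrow> (complex^'m \<Rightarrow> complex^'r) hspace \<Rightarrow> bool" where
  "hilbert_module \<Omega> M \<longleftrightarrow>
     hilbert_space M \<and>
     (\<forall>h\<in>hcar M. (\<forall>j. sv_holomorphic_on (\<lambda>z. h z $ j) \<Omega>) \<and> (\<forall>z. z \<notin> \<Omega> \<longrightarrow> h z = 0)) \<and>
     (\<forall>f\<in>alg \<Omega>. \<forall>h\<in>hcar M. fmult f h \<in> hcar M) \<and>
     (\<forall>f\<^sub>0\<in>alg \<Omega>. \<forall>h\<^sub>0\<in>hcar M. \<forall>e>0. \<exists>\<delta>>0. \<forall>f\<in>alg \<Omega>. \<forall>h\<in>hcar M.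
        (\<forall>z\<in>closure \<Omega>. cmod (f z - f\<^sub>0 z) \<le> \<delta>) \<and> hnorm M (h - h\<^sub>0) \<le> \<delta> \<longrightarrow>
        hnorm M (fmult f h - fmult f\<^sub>0 h\<^sub>0) < e) \<and>
     (\<forall>z\<in>\<Omega>. \<exists>C. \<forall>h\<in>hcar M. norm (h z) \<le> C * hnorm M h) \<and>
     (\<forall>z\<in>\<Omega>. (\<lambda>h. h z) ` hcar M = UNIV) \<and>
     vec_polynomials \<Omega> \<subseteq> hcar M \<and>
     (\<forall>z\<in>\<Omega>. \<forall>h\<in>hcar M. h z = 0 \<longleftrightarrow>
        (\<exists>g. (\<forall>i. g i \<in> hcar M) \<and> (\<forall>w\<in>\<Omega>. h w = (\<Sum>i\<in>UNIV. (w $ i - z $ i) *s g i w))))"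

definition mult_adjoint ::
  "(complex^'m \<Rightarrow> complex^'r) hspace \<Rightarrow> 'm \<Rightarrow> (complex^'m \<Rightarrow> complex^'r) \<Rightarrow> complex^'m \<Rightarrow> complex^'r" where
  "mult_adjoint M i = hadjoint M (fmult (\<lambda>z. z $ i))"

text \<open>The joint eigenspace, which is the fibre \<open>E\<^sub>w\<close> of the bundle.\<close>

definition fibre ::
  "(complex^'m \<Rightarrow> complex^'r) hspace \<Rightarrow> complex^'m \<Rightarrow> (complex^'m \<Rightarrow> complex^'r) set" where
  "fibre M w = {h \<in> hcar M. \<forall>i. mult_adjoint M i h = fscale (w $ i) h}"

text \<open>
  Membership in \<open>B\<^sub>r(\<Omega>)\<close>, \<open>r = CARD('r)\<close>.  The second conjunct is closedness of the range of
  \<open>h \<mapsto> ((M\<^sub>i\<^sup>* - w\<^sub>i) h)\<^sub>i\<close> in the \<open>m\<close>-fold orthogonal sum of \<open>M\<close>, where convergence is componentwise.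
\<close>

definition cowen_douglas ::
  "(complex^'m) set \<Rightarrow> (complex^'m \<Rightarrow> complex^'r) hspace \<Rightarrow> bool" where
  "cowen_douglas \<Omega> M \<longleftrightarrow>
     (\<forall>w\<in>vcnj ` \<Omega>. cfun.dim (fibre M w) = CARD('r)) \<and>
     (\<forall>w\<in>vcnj ` \<Omega>. \<forall>X g. (\<forall>n::nat. X n \<in> hcar M) \<and> (\<forall>i. g i \<in> hcar M) \<and>
        (\<forall>i. (\<lambda>n. hnorm M (mult_adjoint M i (X n) - fscale (w $ i) (X n) - g i)) \<longlonglongrightarrow> 0) \<longrightarrow>
        (\<exists>h\<in>hcar M. \<forall>i. mult_adjoint M i h - fscale (w $ i) h = g i)) \<and>
     (\<forall>h\<in>hcar M. \<forall>e>0. \<exists>g\<in>cfun.span (\<Union>w\<in>vcnj ` \<Omega>. fibre M w). hnorm M (h - g) < e)"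


section \<open>The quotient module\<close>

definition vanishing_submodule :: "'m::{finite,linorder} cvec set \<Rightarrow> 'm set \<Rightarrow> nat \<Rightarrow>
    ('m cvec \<Rightarrow> complex^'r) hspace \<Rightarrow> ('m cvec \<Rightarrow> complex^'r) set" where
  "vanishing_submodule \<Omega> J k M =
     {h \<in> hcar M. \<forall>\<alpha>\<in>multi_indices_below J k. \<forall>j. \<forall>z\<in>zero_locus \<Omega> J.
        multi_deriv partial \<alpha> (\<lambda>z. h z $ j) z = 0}"

definition quotient_space :: "'m::{finite,linorder} cvec set \<Rightarrow> 'm set \<Rightarrow> nat \<Rightarrow>
    ('m cvec \<Rightarrow> complex^'r) hspace \<Rightarrow> ('m cvec \<Rightarrow> complex^'r) hspace" where
  "quotient_space \<Omega> J k M =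
     M\<lparr>hcar := {h \<in> hcar M. \<forall>g\<in>vanishing_submodule \<Omega> J k M. hip M h g = 0}\<rparr>"

definition quotient_action :: "'m::{finite,linorder} cvec set \<Rightarrow> 'm set \<Rightarrow> nat \<Rightarrow>
    ('m cvec \<Rightarrow> complex^'r) hspace \<Rightarrow>
    ('m cvec \<Rightarrow> complex) \<Rightarrow> ('m cvec \<Rightarrow> complex^'r) \<Rightarrow> 'm cvec \<Rightarrow> complex^'r" where
  "quotient_action \<Omega> J k M f h = hproj M (hcar (quotient_space \<Omega> J k M)) (fmult f h)"

definition unitarily_equivalent :: "'f set \<Rightarrow>
    ('a \<Rightarrow> complex^'r) hspace \<Rightarrow> ('f \<Rightarrow> ('a \<Rightarrow> complex^'r) \<Rightarrow> ('a \<Rightarrow> complex^'r)) \<Rightarrow>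
    ('a \<Rightarrow> complex^'r) hspace \<Rightarrow> ('f \<Rightarrow> ('a \<Rightarrow> complex^'r) \<Rightarrow> ('a \<Rightarrow> complex^'r)) \<Rightarrow> bool" where
  "unitarily_equivalent A N act N' act' \<longleftrightarrow>
     (\<exists>T. bij_betw T (hcar N) (hcar N') \<and>
        (\<forall>g\<in>hcar N. \<forall>h\<in>hcar N. T (g + h) = T g + T h) \<and>
        (\<forall>c. \<forall>h\<in>hcar N. T (fscale c h) = fscale c (T h)) \<and>
        (\<forall>g\<in>hcar N. \<forall>h\<in>hcar N. hip N' (T g) (T h) = hip N g h) \<and>
        (\<forall>f\<in>A. \<forall>h\<in>hcar N. T (act f h) = act' f (T h)))"


section \<open>The bundle and normalized frames\<close>

text \<open>
  \<open>kernel_vec M w \<zeta>\<close> is \<open>K(\<cdot>, w)\<zeta>\<close> for the reproducing kernel \<open>K\<close> of \<open>M\<close>, i.e.\ the element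
  of \<open>M\<close> with \<open>\<langle>h, K(\<cdot>, w)\<zeta>\<rangle> = \<langle>h(w), \<zeta>\<rangle>\<close> for all \<open>h\<close> in \<open>M\<close>.
\<close>

definition kernel_vec :: "(complex^'m \<Rightarrow> complex^'r) hspace \<Rightarrow>
    complex^'m \<Rightarrow> complex^'r \<Rightarrow> complex^'m \<Rightarrow> complex^'r" where
  "kernel_vec M w \<zeta> = (THE g. g \<in> hcar M \<and> (\<forall>h\<in>hcar M. hip M h g = cinner (h w) \<zeta>))"

text \<open>
  The holomorphic structure of the bundle is the one for which \<open>w \<mapsto> K(\<cdot>, vcnj w) \<sigma>\<^sub>j\<close> is a
  global holomorphic frame.
\<close>

definition holomorphic_section :: "(complex^'m \<Rightarrow> complex^'r) hspace \<Rightarrow> (complex^'m) set \<Rightarrow>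
    (complex^'m \<Rightarrow> (complex^'m \<Rightarrow> complex^'r)) \<Rightarrow> bool" where
  "holomorphic_section M U s \<longleftrightarrow>
     (\<exists>a. (\<forall>j. sv_holomorphic_on (a j) U) \<and>
          (\<forall>w\<in>U. s w = (\<Sum>j\<in>UNIV. fscale (a j w) (kernel_vec M (vcnj w) (axis j 1)))))"

definition holomorphic_frame :: "(complex^'m \<Rightarrow> complex^'r) hspace \<Rightarrow> (complex^'m) set \<Rightarrow>
    ('r \<Rightarrow> complex^'m \<Rightarrow> (complex^'m \<Rightarrow> complex^'r)) \<Rightarrow> bool" where
  "holomorphic_frame M U s \<longleftrightarrow>
     (\<forall>i. holomorphic_section M U (s i)) \<and>
     (\<forall>w\<in>U. inj (\<lambda>i. s i w) \<and> cfun.independent (range (\<lambda>i. s i w)) \<and>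
        cfun.span (range (\<lambda>i. s i w)) = fibre M w)"

text \<open>Partial derivative of an \<open>M\<close>-valued function, as a limit in the norm of \<open>M\<close>.\<close>

definition hpartial :: "('a \<Rightarrow> complex^'r) hspace \<Rightarrow> 'm \<Rightarrow>
    (complex^'m \<Rightarrow> ('a \<Rightarrow> complex^'r)) \<Rightarrow> complex^'m \<Rightarrow> ('a \<Rightarrow> complex^'r)" where
  "hpartial M i s w = (THE g. g \<in> hcar M \<and>
     ((\<lambda>t. hnorm M (fscale (1 / t) (s (w + t *s axis i 1) - s w) - g)) \<longlongrightarrow> 0) (at 0))"

definition normalized_frame :: "'m::{finite,linorder} cvec set \<Rightarrow> 'm set \<Rightarrow>
    ('m cvec \<Rightarrow> complex^'r) hspace \<Rightarrow> 'm cvec set \<Rightarrow>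
    ('r \<Rightarrow> 'm cvec \<Rightarrow> ('m cvec \<Rightarrow> complex^'r)) \<Rightarrow> bool" where
  "normalized_frame \<Omega> J M U s \<longleftrightarrow>
     holomorphic_frame M U s \<and>
     (\<forall>w\<in>U \<inter> zero_locus (vcnj ` \<Omega>) J. \<forall>i j.
        hip M (s i w) (s j 0) = (if i = j then 1 else 0) \<and>
        (\<forall>\<alpha>\<in>multi_indices J. \<alpha> \<noteq> (\<lambda>_. 0) \<longrightarrow>
           hip M (multi_deriv (hpartial M) \<alpha> (s i) w) (s j 0) = 0))"

definition gramian :: "(complex^'m \<Rightarrow> complex^'r) hspace \<Rightarrow>
    ('r \<Rightarrow> complex^'m \<Rightarrow> (complex^'m \<Rightarrow> complex^'r)) \<Rightarrow> complex^'m \<Rightarrow> complex^'r^'r" where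
  "gramian M s w = (\<chi> i j. hip M (s i w) (s j w))"

definition gramian_deriv :: "('m::{finite,linorder} \<Rightarrow> nat) \<Rightarrow> ('m \<Rightarrow> nat) \<Rightarrow>
    ('m cvec \<Rightarrow> complex^'r^'r) \<Rightarrow> 'm cvec \<Rightarrow> complex^'r^'r" where
  "gramian_deriv \<alpha> \<beta> H w =
     (\<chi> i j. multi_deriv wirtinger \<alpha> (multi_deriv wirtinger_bar \<beta> (\<lambda>w. H w $ i $ j)) w)"

end

theory Submission
  imports Defs "HOL-Complex_Analysis.Conformal_Mappings"
begin

text \<open>
  Write \<open>\<Z>\<^sup>*\<close> for the conjugate of the zero locus.  The proof describes a quotient module by the
  jets \<open>\<partial>\<^sup>\<alpha>s\<^sub>i(w)\<close> with \<open>|\<alpha>| < k\<close> and \<open>w \<in> \<Z>\<^sup>* \<inter> U\<close>.  By the reproducing property, the pairing of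
  \<open>h\<close> with the jets at \<open>w\<close> is an invertible triangular transform of the derivatives of \<open>h\<close> of order
  below \<open>k\<close> at \<open>cnj w\<close>.  So jets at points of \<open>\<Z>\<^sup>*\<close> are orthogonal to the submodule, and, by the
  identity theorem on the connected set \<open>\<Z>\<close>, those near the origin already span a dense subspace
  of the quotient (\<open>vanishing_if_orthogonal\<close>, \<open>total_in_Mq\<close>).  Three facts then carry the theorem:
  the entries of \<open>\<partial>\<^sup>\<alpha>\<partial>\<^sup>\<beta>H\<close> (the second derivative being conjugated) are the inner products of two
  jets at the same point (\<open>gramian_deriv_jets\<close>); the adjoint of the multiplication by \<open>f\<close> acts on
  jets through a Leibniz rule whose coefficients depend on \<open>f\<close> alone (\<open>hip_jet_fmult\<close>); and for a
  coordinate function that rule says that \<open>M\<^sub>l\<^sup>* - w\<^sub>l\<close>, with \<open>M\<^sub>l\<close> the multiplication by \<open>z\<^sub>l\<close>,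
  lowers the order of a jet by one (\<open>hip_jet_coord\<close>).

  If \<open>D\<close> is given, the inner products of jets of the two modules correspond on the diagonal, hence
  for any two points near the origin by \<open>polarization\<close>, so
  \<open>\<partial>\<^sup>\<alpha>s\<^sub>i(w) \<mapsto> \<Sum>\<^sub>j D\<^sub>i\<^sub>j \<partial>\<^sup>\<alpha>s'\<^sub>j(w)\<close> extends to a unitary (\<open>gram_equal_unitary\<close>).  It intertwines the
  actions because the Leibniz coefficients are the same on both sides.

  If a unitary module map \<open>T\<close> is given, it takes the joint eigenspace at \<open>w \<in> \<Z>\<^sup>*\<close> to the one of
  the other module, so \<open>T s\<^sub>i(w) = \<Sum>\<^sub>j \<phi>\<^sub>i\<^sub>j(w) s'\<^sub>j(w)\<close>, and normalization of both frames gives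
  \<open>\<phi>(w) \<phi>(0)\<^sup>* = 1\<close>; thus \<open>\<phi>\<close> is a constant unitary matrix \<open>D\<close>.  By induction on \<open>|\<alpha>|\<close> the
  vector \<open>T \<partial>\<^sup>\<alpha>s\<^sub>i(w) - \<Sum>\<^sub>j D\<^sub>i\<^sub>j \<partial>\<^sup>\<alpha>s'\<^sub>j(w)\<close> is again a joint eigenvector, because \<open>M\<^sub>l\<^sup>* - w\<^sub>l\<close> lowers
  the order; its coordinates in the frame are its inner products with the \<open>s'\<^sub>j(0)\<close>, and these vanish
  for \<open>\<alpha> \<noteq> 0\<close> since both frames are normalized (\<open>jets_intertwined\<close>).

  Two analytic inputs make the jets available.  In several variables everything is done with
  continuous functions that are holomorphic on every complex line, a class closed under partial
  derivatives by Cauchy's estimates.  For sections, the uniform boundedness principle turns weak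
  holomorphy into differentiability in norm, so that derivatives of all orders exist in \<open>M\<close>.
\<close>

section \<open>Functions holomorphic along complex lines\<close>

lemma norm_smult_vec: "norm (c *s v) = cmod c * norm v" for v :: "complex^'n"
  by (simp add: norm_vec_def L2_set_right_distrib norm_mult)

lemma continuous_smult_line [continuous_intros]:
  "continuous_on A f \<Longrightarrow> continuous_on A (\<lambda>t. f t *s (v :: complex^'n))"
  unfolding vector_scalar_mult_def by (intro continuous_intros) auto

lemma open_line_preimage:
  fixes z v :: "complex^'n"
  assumes "open S"
  shows "open {t. z + t *s v \<in> S}"
proof -
  have "open ((\<lambda>t. z + t *s v) -` S)"
    by (intro open_vimage assms continuous_intros)
  then show ?thesis by (simp add: vimage_def)
qed

lemma convex_line_preimage:
  fixes z v :: "complex^'n"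
  assumes "convex S"
  shows "convex {t. z + t *s v \<in> S}"
proof (rule convexI)
  fix x y :: complex and a b :: real
  assume xy: "x \<in> {t. z + t *s v \<in> S}" "y \<in> {t. z + t *s v \<in> S}"
    and ab: "0 \<le> a" "0 \<le> b" "a + b = 1"
  have "z + (a *\<^sub>R x + b *\<^sub>R y) *s v = a *\<^sub>R (z + x *s v) + b *\<^sub>R (z + y *s v)"
  proof -
    have b: "b = 1 - a" using ab by simp
    show ?thesis
      unfolding b by (simp add: vec_eq_iff algebra_simps scaleR_conv_of_real[where 'a = complex])
  qed
  then show "a *\<^sub>R x + b *\<^sub>R y \<in> {t. z + t *s v \<in> S}"
    using convexD[OF assms _ _ ab, of "z + x *s v" "z + y *s v"] xy by simp
qed

text \<open>
  On open sets this is joint holomorphy, by Osgood's lemma.  In this form, closure under partial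
  derivatives and uniform limits reduces to one complex variable, and the identity theorem and
  polarization use nothing but lines.
\<close>

definition line_holomorphic_on :: "(complex^'n \<Rightarrow> complex) \<Rightarrow> (complex^'n) set \<Rightarrow> bool" where
  "line_holomorphic_on f S \<longleftrightarrow>
     continuous_on S f \<and> (\<forall>z\<in>S. \<forall>v. (\<lambda>t. f (z + t *s v)) field_differentiable at 0)"

lemma field_differentiable_sum':
  "(\<And>i. i \<in> I \<Longrightarrow> f i field_differentiable F) \<Longrightarrow> (\<lambda>t. \<Sum>i\<in>I. f i t) field_differentiable F"
  by (induction I rule: infinite_finite_induct) (auto intro!: field_differentiable_add)
lemma line_holomorphic_imp_holomorphic:
  assumes "line_holomorphic_on f S"
  shows "(\<lambda>t. f (z + t *s v)) holomorphic_on {t. z + t *s v \<in> S}"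
  unfolding holomorphic_on_def
proof
  fix t0 assume t0: "t0 \<in> {t. z + t *s v \<in> S}"
  have "(\<lambda>t. f ((z + t0 *s v) + t *s v)) field_differentiable at (t0 - t0)"
    using assms t0 unfolding line_holomorphic_on_def by simp
  then have "((\<lambda>t. f ((z + t0 *s v) + t *s v)) \<circ> (\<lambda>t. t - t0)) field_differentiable at t0"
    by (intro field_differentiable_compose derivative_intros)
  moreover have "((\<lambda>t. f ((z + t0 *s v) + t *s v)) \<circ> (\<lambda>t. t - t0)) = (\<lambda>t. f (z + t *s v))"
    by (auto simp: fun_eq_iff vec_eq_iff algebra_simps intro!: arg_cong[where f=f])
  ultimately show "(\<lambda>t. f (z + t *s v)) field_differentiable at t0 within {t. z + t *s v \<in> S}"
    by (simp add: field_differentiable_at_within)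
qed

lemma line_holomorphic_onI:
  assumes "continuous_on S f"
    and "\<And>z v. z \<in> S \<Longrightarrow> \<exists>T. open T \<and> 0 \<in> T \<and> (\<lambda>t. f (z + t *s v)) holomorphic_on T"
  shows "line_holomorphic_on f S"
  using assms unfolding line_holomorphic_on_def
  by (meson holomorphic_on_imp_differentiable_at)

lemma sv_holomorphic_imp_line:
  assumes "sv_holomorphic_on f S"
  shows "line_holomorphic_on f S"
  unfolding line_holomorphic_on_def
proof (intro conjI ballI allI)
  show "continuous_on S f"
    using assms unfolding sv_holomorphic_on_def
    by (meson continuous_at_imp_continuous_on has_derivative_continuous)
next
  fix z v assume "z \<in> S"
  then obtain f' where f': "(f has_derivative f') (at z)" "\<And>c v. f' (c *s v) = c * f' v"
    using assms unfolding sv_holomorphic_on_def by blast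
  have 1: "((\<lambda>t. z + t *s v) has_derivative (\<lambda>t. t *s v)) (at 0)"
  proof -
    have "bounded_linear (\<lambda>t. t *s v)"
      by (intro bounded_linear_intro[where K="norm v"])
        (auto simp: vec_eq_iff algebra_simps scaleR_conv_of_real[where 'a = complex] norm_smult_vec)
    then show ?thesis
      using has_derivative_add[OF has_derivative_const bounded_linear.has_derivative[OF _ has_derivative_ident]]
      by fastforce
  qed
  have "((\<lambda>t. f (z + t *s v)) has_derivative (\<lambda>t. f' (t *s v))) (at 0)"
    using has_derivative_compose[OF 1, of f f'] f'(1) by simp
  then have "((\<lambda>t. f (z + t *s v)) has_derivative (\<lambda>t. f' v * t)) (at 0)"
    by (simp add: f'(2) mult.commute)
  then show "(\<lambda>t. f (z + t *s v)) field_differentiable at 0"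
    unfolding field_differentiable_def has_field_derivative_def by auto
qed

lemma line_holomorphic_cong:
  assumes "open S" "\<And>z. z \<in> S \<Longrightarrow> f z = g z" "line_holomorphic_on f S"
  shows "line_holomorphic_on g S"
proof (rule line_holomorphic_onI)
  show "continuous_on S g"
    using assms unfolding line_holomorphic_on_def by (metis continuous_on_cong)
  fix z v :: "complex^'a" assume z: "z \<in> S"
  have "(\<lambda>t. g (z + t *s v)) holomorphic_on {t. z + t *s v \<in> S}"
    by (rule holomorphic_transform[OF line_holomorphic_imp_holomorphic[OF assms(3)]]) (simp add: assms(2))
  then show "\<exists>T. open T \<and> 0 \<in> T \<and> (\<lambda>t. g (z + t *s v)) holomorphic_on T"
    using open_line_preimage[OF assms(1)] z by (intro exI[of _ "{t. z + t *s v \<in> S}"]) simp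
qed

lemma line_holomorphic_subset:
  "line_holomorphic_on f S \<Longrightarrow> T \<subseteq> S \<Longrightarrow> line_holomorphic_on f T"
  unfolding line_holomorphic_on_def by (meson continuous_on_subset in_mono)

lemma line_holomorphic_local:
  assumes "\<And>z. z \<in> S \<Longrightarrow> \<exists>W. open W \<and> z \<in> W \<and> line_holomorphic_on f W"
  shows "line_holomorphic_on f S"
  unfolding line_holomorphic_on_def
proof (intro conjI ballI)
  show "continuous_on S f"
    by (metis assms continuous_at_imp_continuous_on continuous_on_eq_continuous_at line_holomorphic_on_def)
qed (metis assms line_holomorphic_on_def)

lemma line_holomorphic_const [simp]: "line_holomorphic_on (\<lambda>_. c) S"
  unfolding line_holomorphic_on_def by simp

lemma line_holomorphic_add:
  "line_holomorphic_on f S \<Longrightarrow> line_holomorphic_on g S \<Longrightarrow> line_holomorphic_on (\<lambda>z. f z + g z) S"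
  unfolding line_holomorphic_on_def
  by (auto intro!: continuous_intros field_differentiable_add)

lemma line_holomorphic_diff:
  "line_holomorphic_on f S \<Longrightarrow> line_holomorphic_on g S \<Longrightarrow> line_holomorphic_on (\<lambda>z. f z - g z) S"
  unfolding line_holomorphic_on_def
  by (auto intro!: continuous_intros field_differentiable_diff)

lemma line_holomorphic_mult:
  "line_holomorphic_on f S \<Longrightarrow> line_holomorphic_on g S \<Longrightarrow> line_holomorphic_on (\<lambda>z. f z * g z) S"
  unfolding line_holomorphic_on_def
  by (auto intro!: continuous_intros field_differentiable_mult)

lemma line_holomorphic_sum:
  "(\<And>i. i \<in> I \<Longrightarrow> line_holomorphic_on (f i) S) \<Longrightarrow> line_holomorphic_on (\<lambda>z. \<Sum>i\<in>I. f i z) S"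
  by (induction I rule: infinite_finite_induct) (auto intro!: line_holomorphic_add)

lemma line_holomorphic_coord: "line_holomorphic_on (\<lambda>z. z $ i) S"
  unfolding line_holomorphic_on_def
  by (auto intro!: continuous_intros derivative_intros)

lemma vcnj_vcnj [simp]: "vcnj (vcnj z) = z"
  by (simp add: vcnj_def vec_eq_iff)

lemma vcnj_line: "vcnj (z + t *s v) = vcnj z + cnj t *s vcnj v"
  by (simp add: vcnj_def vec_eq_iff)

lemma continuous_on_vcnj [continuous_intros]:
  "continuous_on A f \<Longrightarrow> continuous_on A (\<lambda>x. vcnj (f x :: complex^'n))"
  unfolding vcnj_def by (intro continuous_intros) auto

lemma norm_vcnj [simp]: "norm (vcnj z) = norm z"
  by (simp add: vcnj_def norm_vec_def)

lemma vcnj_image_iff: "w \<in> vcnj ` S \<longleftrightarrow> vcnj w \<in> S"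
  by (metis imageE image_eqI vcnj_vcnj)

lemma open_vcnj_image: "open S \<Longrightarrow> open (vcnj ` S)" for S :: "(complex^'n) set"
proof -
  assume "open S"
  then have "open (vcnj -` S)" by (intro open_vimage continuous_intros)
  moreover have "vcnj -` S = vcnj ` S" using vcnj_image_iff[of _ S] by auto
  ultimately show ?thesis by simp
qed

lemma has_field_derivative_cnj_cnj':
  assumes "(f has_field_derivative D) (at (0::complex))"
  shows "((\<lambda>t. cnj (f (cnj t))) has_field_derivative cnj D) (at 0)"
  using has_field_derivative_cnj_cnj[of f D 0] assms by (simp add: o_def)

lemma line_holomorphic_cnj:
  assumes "line_holomorphic_on f S"
  shows "line_holomorphic_on (\<lambda>w. cnj (f (vcnj w))) (vcnj ` S)"
  unfolding line_holomorphic_on_def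
proof (intro conjI ballI allI)
  have "continuous_on (vcnj ` S) (f \<circ> vcnj)"
    using assms unfolding line_holomorphic_on_def
    by (intro continuous_on_compose continuous_intros) (simp add: image_image)
  then show "continuous_on (vcnj ` S) (\<lambda>w. cnj (f (vcnj w)))"
    by (intro continuous_intros) (simp add: o_def)
next
  fix z v assume "z \<in> vcnj ` S"
  then obtain D where "((\<lambda>t. f (vcnj z + t *s vcnj v)) has_field_derivative D) (at 0)"
    using assms unfolding line_holomorphic_on_def field_differentiable_def vcnj_image_iff by blast
  from has_field_derivative_cnj_cnj'[OF this]
  show "(\<lambda>t. cnj (f (vcnj (z + t *s v)))) field_differentiable at 0"
    unfolding field_differentiable_def by (auto simp: vcnj_line)
qed

text \<open>
  Weierstrass's theorem on each line.
\<close>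

lemma line_holomorphic_uniform_limit:
  assumes "open S" "\<And>n. line_holomorphic_on (f n) S" "uniform_limit S f g sequentially"
  shows "line_holomorphic_on g S"
proof (rule line_holomorphic_onI)
  show "continuous_on S g"
    by (rule uniform_limit_theorem[OF _ assms(3)]) (use assms(2) in \<open>auto simp: line_holomorphic_on_def\<close>)
  fix z v :: "complex^'a" assume z: "z \<in> S"
  let ?T = "{t. z + t *s v \<in> S}"
  have "(\<lambda>t. g (z + t *s v)) holomorphic_on ?T"
  proof (rule holomorphic_uniform_sequence[where f = "\<lambda>n t. f n (z + t *s v)"])
    show "open ?T" by (rule open_line_preimage[OF assms(1)])
    show "(\<lambda>t. f n (z + t *s v)) holomorphic_on ?T" for n
      by (rule line_holomorphic_imp_holomorphic[OF assms(2)])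
    fix x assume "x \<in> ?T"
    then obtain d where d: "d > 0" "cball x d \<subseteq> ?T"
      using open_line_preimage[OF assms(1)] open_contains_cball by metis
    have "uniform_limit (cball x d) (\<lambda>n t. f n (z + t *s v)) (\<lambda>t. g (z + t *s v)) sequentially"
      by (rule uniform_limit_compose'[OF assms(3)]) (use d in auto)
    then show "\<exists>d>0. cball x d \<subseteq> ?T \<and>
        uniform_limit (cball x d) (\<lambda>n t. f n (z + t *s v)) (\<lambda>t. g (z + t *s v)) sequentially"
      using d by blast
  qed
  then show "\<exists>T. open T \<and> 0 \<in> T \<and> (\<lambda>t. g (z + t *s v)) holomorphic_on T"
    using open_line_preimage[OF assms(1)] z by (intro exI[of _ ?T]) simp
qed

text \<open>
  Taylor's formula with the second derivative bounded by Cauchy's estimate.  What matters is that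
  \<open>u\<close> enters the bound only through \<open>C\<close>: this makes the convergence of difference quotients uniform
  in the base point for scalar functions, and uniform in norm for vector-valued ones.
\<close>

lemma difference_quotient_estimate:
  assumes "u holomorphic_on ball 0 R" "0 < R" "\<And>t. t \<in> ball 0 R \<Longrightarrow> cmod (u t) \<le> C"
    and "0 < cmod t" "cmod t \<le> R/2"
  shows "cmod ((u t - u 0) / t - deriv u 0) \<le> 32 * (C + 1) / R^2 * cmod t"
proof -
  have hd: "(deriv ^^ n) u holomorphic_on ball 0 R" for n
    by (rule holomorphic_higher_deriv[OF assms(1)]) simp
  have C: "0 \<le> C" using order_trans[OF norm_ge_zero assms(3)[of 0]] assms(2) by simp
  \<comment> \<open>Cauchy's estimate on discs of radius \<open>R/4\<close>; it wants the values of \<open>u\<close> in an open disc, hence \<open>C + 1\<close>.\<close>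
  have bd: "cmod ((deriv ^^ 2) u x) \<le> 32 * (C + 1) / R^2" if x: "x \<in> cball 0 (R/2)" for x
  proof -
    have sub: "cball x (R/4) \<subseteq> ball 0 R"
    proof
      fix y assume "y \<in> cball x (R/4)"
      then have "norm (y - x) \<le> R/4" by (simp add: dist_norm norm_minus_commute)
      moreover have "norm y \<le> norm x + norm (y - x)" by (metis norm_triangle_sub)
      ultimately show "y \<in> ball 0 R" using x \<open>0 < R\<close> by simp
    qed
    have "cmod ((deriv ^^ 2) u x) \<le> fact 2 * (C + 1) / (R/4)^2"
    proof (rule Cauchy_higher_deriv_bound[where y = 0])
      show "u holomorphic_on ball x (R/4)"
        using assms(1) sub ball_subset_cball holomorphic_on_subset by blast
      show "continuous_on (cball x (R/4)) u"
        using assms(1) sub holomorphic_on_imp_continuous_on continuous_on_subset by blast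
      show "\<And>w. w \<in> ball x (R/4) \<Longrightarrow> u w \<in> ball 0 (C + 1)"
        using assms(3) sub ball_subset_cball[of x "R/4"] C
        by (smt (verit) add_less_cancel_left dist_0_norm in_mono mem_ball)
    qed (use assms(2) in auto)
    then show ?thesis by (simp add: power2_eq_square)
  qed
  have "cmod ((deriv ^^ 0) u t - (\<Sum>i\<le>1. (deriv ^^ i) u 0 * (t - 0) ^ i / fact i))
      \<le> 32 * (C + 1) / R^2 * cmod (t - 0) ^ (Suc 1) / fact 1"
  proof (rule complex_Taylor[where S = "cball 0 (R/2)"])
    fix i x assume x: "x \<in> cball (0::complex) (R/2)"
    then have xb: "x \<in> ball 0 R" using \<open>0 < R\<close> by simp
    have "((deriv ^^ i) u has_field_derivative deriv ((deriv ^^ i) u) x) (at x)"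
      by (rule holomorphic_derivI[OF hd _ xb]) simp
    then show "((deriv ^^ i) u has_field_derivative (deriv ^^ Suc i) u x) (at x within cball 0 (R/2))"
      by (simp add: has_field_derivative_at_within)
  qed (use assms bd less_imp_le[OF assms(2)] in \<open>auto simp: numeral_2_eq_2\<close>)
  then have *: "cmod (u t - u 0 - deriv u 0 * t) \<le> 32 * (C + 1) / R^2 * cmod t ^ 2"
    by (simp add: numeral_2_eq_2 diff_diff_eq)
  have "(u t - u 0) / t - deriv u 0 = (u t - u 0 - deriv u 0 * t) / t"
    using assms(4) by (simp add: field_simps)
  then have "cmod ((u t - u 0) / t - deriv u 0) = cmod (u t - u 0 - deriv u 0 * t) / cmod t"
    by (simp add: norm_divide)
  also have "\<dots> \<le> 32 * (C + 1) / R^2 * cmod t ^ 2 / cmod t"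
    by (intro divide_right_mono *) simp
  finally show ?thesis using assms(4) by (simp add: power2_eq_square)
qed

lemma has_field_derivative_partial:
  assumes "line_holomorphic_on f S" "z \<in> S"
  shows "((\<lambda>t. f (z + t *s axis i 1)) has_field_derivative partial i f z) (at 0)"
  using assms unfolding line_holomorphic_on_def partial_def
  by (simp add: field_differentiable_derivI)

lemma partial_eqI:
  "((\<lambda>t. f (z + t *s axis i 1)) has_field_derivative D) (at 0) \<Longrightarrow> partial i f z = D"
  unfolding partial_def by (rule DERIV_imp_deriv)

text \<open>
  Near each point the difference quotients in direction \<open>i\<close> converge uniformly, since
  \<open>difference_quotient_estimate\<close> applies with one bound \<open>C\<close> for all base points.
\<close>

lemma line_holomorphic_partial:
  fixes f :: "complex^'n \<Rightarrow> complex"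
  assumes "open S" "line_holomorphic_on f S"
  shows "line_holomorphic_on (partial i f) S"
proof (rule line_holomorphic_local)
  fix z0 assume "z0 \<in> S"
  then obtain \<rho>0 where "\<rho>0 > 0" "cball z0 \<rho>0 \<subseteq> S" using assms(1) open_contains_cball by blast
  then obtain \<rho> where \<rho>: "\<rho> > 0" "cball z0 (2 * \<rho>) \<subseteq> S"
    by (intro that[of "\<rho>0/2"]) auto
  have cont: "continuous_on (cball z0 (2*\<rho>)) f"
    using assms(2) \<rho>(2) unfolding line_holomorphic_on_def by (meson continuous_on_subset)
  then have "bounded (f ` cball z0 (2*\<rho>))"
    by (intro compact_imp_bounded compact_continuous_image) auto
  then obtain C where "\<forall>x\<in>f ` cball z0 (2*\<rho>). cmod x \<le> C"
    unfolding bounded_iff by blast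
  then have C: "\<And>y. y \<in> cball z0 (2*\<rho>) \<Longrightarrow> cmod (f y) \<le> C" by blast
  have near: "y + t *s axis i 1 \<in> ball z0 (2*\<rho>)" if "y \<in> ball z0 \<rho>" "cmod t < \<rho>" for y t
  proof -
    have "norm (y + t *s axis i 1 - z0) \<le> norm (y - z0) + norm (t *s axis i (1::complex))"
      by (metis add_diff_eq diff_add_eq norm_triangle_ineq)
    then show ?thesis using that by (simp add: dist_norm norm_minus_commute norm_smult_vec)
  qed
  have nearS: "y + t *s axis i 1 \<in> S" if "y \<in> ball z0 \<rho>" "cmod t < \<rho>" for y t
    using near[OF that] \<rho>(2) ball_subset_cball by blast
  define \<tau> where "\<tau> n = complex_of_real (\<rho> / 2 / Suc n)" for n
  have \<tau>: "0 < cmod (\<tau> n)" "cmod (\<tau> n) \<le> \<rho>/2" for n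
    using \<rho>(1) unfolding \<tau>_def norm_of_real by (auto simp: field_simps)
  have \<tau>lim: "(\<lambda>n. cmod (\<tau> n)) \<longlonglongrightarrow> 0"
  proof -
    have "(\<lambda>n. (\<rho>/2) * inverse (real (Suc n))) \<longlonglongrightarrow> (\<rho>/2) * 0"
      by (intro tendsto_intros LIMSEQ_inverse_real_of_nat)
    then show ?thesis using \<rho>(1) by (simp add: \<tau>_def norm_of_real field_simps del: of_nat_Suc of_real_divide)
  qed
  define q where "q n y = (f (y + \<tau> n *s axis i 1) - f y) / \<tau> n" for n y
  define K where "K = 32 * (C + 1) / \<rho>^2"
  \<comment> \<open>The bound \<open>C\<close> on the larger ball serves every base point \<open>y\<close> of the smaller one.\<close>
  have est: "cmod (q n y - partial i f y) \<le> K * cmod (\<tau> n)" if y: "y \<in> ball z0 \<rho>" for n y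
  proof -
    have sub: "ball 0 \<rho> \<subseteq> {t. y + t *s axis i 1 \<in> S}"
      using nearS[OF y] by (simp add: subset_eq)
    have "cmod ((f (y + \<tau> n *s axis i 1) - f (y + 0 *s axis i 1)) / \<tau> n - deriv (\<lambda>t. f (y + t *s axis i 1)) 0)
        \<le> 32 * (C + 1) / \<rho>^2 * cmod (\<tau> n)"
    proof (rule difference_quotient_estimate)
      show "(\<lambda>t. f (y + t *s axis i 1)) holomorphic_on ball 0 \<rho>"
        by (rule holomorphic_on_subset[OF line_holomorphic_imp_holomorphic[OF assms(2)] sub])
      show "cmod (f (y + t *s axis i 1)) \<le> C" if "t \<in> ball 0 \<rho>" for t
        using near[OF y, of t] that ball_subset_cball by (intro C) (simp add: less_imp_le)
    qed (use \<rho> \<tau> in auto)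
    then show ?thesis by (simp add: q_def partial_def K_def)
  qed
  have "line_holomorphic_on (partial i f) (ball z0 \<rho>)"
  proof (rule line_holomorphic_uniform_limit[where f = q])
    fix n
    have 1: "line_holomorphic_on (\<lambda>y. f (y + \<tau> n *s axis i 1)) (ball z0 \<rho>)"
      unfolding line_holomorphic_on_def
    proof (intro conjI ballI allI)
      have "(\<lambda>y. y + \<tau> n *s axis i 1) ` ball z0 \<rho> \<subseteq> cball z0 (2*\<rho>)"
      proof (clarify)
        fix y assume "y \<in> ball z0 \<rho>"
        then show "y + \<tau> n *s axis i 1 \<in> cball z0 (2*\<rho>)"
          using near[of y "\<tau> n"] \<tau>(2)[of n] \<rho>(1) by (simp add: less_imp_le)
      qed
      then show "continuous_on (ball z0 \<rho>) (\<lambda>y. f (y + \<tau> n *s axis i 1))"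
        by (intro continuous_on_compose2[OF cont] continuous_intros)
      fix z v assume "z \<in> ball z0 \<rho>"
      then have "z + \<tau> n *s axis i 1 \<in> S"
        using nearS[of z "\<tau> n"] \<tau>(2)[of n] \<rho>(1) by simp
      then have "(\<lambda>t. f ((z + \<tau> n *s axis i 1) + t *s v)) field_differentiable at 0"
        using assms(2) unfolding line_holomorphic_on_def by blast
      then show "(\<lambda>t. f (z + t *s v + \<tau> n *s axis i 1)) field_differentiable at 0"
        by (simp add: algebra_simps)
    qed
    have 2: "line_holomorphic_on f (ball z0 \<rho>)"
      by (rule line_holomorphic_subset[OF assms(2)]) (rule order_trans[OF _ \<rho>(2)], use \<rho>(1) in \<open>simp add: subset_eq\<close>)
    have "line_holomorphic_on (\<lambda>y. inverse (\<tau> n) * (f (y + \<tau> n *s axis i 1) + (-1) * f y)) (ball z0 \<rho>)"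
      by (intro line_holomorphic_mult line_holomorphic_add line_holomorphic_const 1 2)
    moreover have "q n = (\<lambda>y. inverse (\<tau> n) * (f (y + \<tau> n *s axis i 1) + (-1) * f y))"
      by (simp add: q_def fun_eq_iff field_simps)
    ultimately show "line_holomorphic_on (q n) (ball z0 \<rho>)" by simp
  next
    show "uniform_limit (ball z0 \<rho>) q (partial i f) sequentially"
    proof (rule uniform_limitI)
      fix e :: real assume e: "e > 0"
      have "(\<lambda>n. K * cmod (\<tau> n)) \<longlonglongrightarrow> 0"
        using tendsto_mult_left[OF \<tau>lim, of K] by simp
      then have "\<forall>\<^sub>F n in sequentially. K * cmod (\<tau> n) < e"
        using e by (rule order_tendstoD)
      then show "\<forall>\<^sub>F n in sequentially. \<forall>x\<in>ball z0 \<rho>. dist (q n x) (partial i f x) < e"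
        by (rule eventually_mono) (use est in \<open>fastforce simp: dist_norm[of "q _ _"] intro: le_less_trans\<close>)
    qed
  qed simp
  then show "\<exists>W. open W \<and> z0 \<in> W \<and> line_holomorphic_on (partial i f) W"
    using \<rho>(1) by (intro exI[of _ "ball z0 \<rho>"]) simp
qed

section \<open>Iterated partial derivatives\<close>

lemma foldr_funpow_zero:
  "(\<And>i. i \<in> set xs \<Longrightarrow> \<alpha> i = 0) \<Longrightarrow> foldr (\<lambda>i. D i ^^ \<alpha> i) xs = id"
  by (induction xs) auto

lemma multi_deriv_zero: "multi_deriv D (\<lambda>_. 0) x = x"
  unfolding multi_deriv_def by (subst foldr_funpow_zero) auto

text \<open>
  The derivatives with small index are applied last, so raising the smallest index in the support
  of \<open>\<alpha>\<close> puts one more operator in front.  All inductions on multi-indices build \<open>\<alpha>\<close> in this order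
  (\<open>multi_index_induct\<close>), so that partial derivatives never have to be commuted.
\<close>

lemma multi_deriv_step:
  fixes \<alpha> :: "'m::{finite,linorder} \<Rightarrow> nat"
  assumes "\<forall>i<l. \<alpha> i = 0"
  shows "multi_deriv D (\<alpha>(l := Suc (\<alpha> l))) x = D l (multi_deriv D \<alpha> x)"
proof -
  let ?L = "sorted_list_of_set (UNIV :: 'm set)"
  let ?\<beta> = "\<alpha>(l := Suc (\<alpha> l))"
  have "l \<in> set ?L" by simp
  then obtain xs ys where L: "?L = xs @ l # ys" by (meson split_list)
  have "sorted_wrt (<) ?L" by (rule strict_sorted_list_of_set)
  then have sx: "i < l" if "i \<in> set xs" for i using that unfolding L by (simp add: sorted_wrt_append)
  have sy: "i \<noteq> l" if "i \<in> set ys" for i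
    using that \<open>sorted_wrt (<) ?L\<close> unfolding L by (auto simp: sorted_wrt_append)
  have "foldr (\<lambda>i. D i ^^ ?\<beta> i) ys = foldr (\<lambda>i. D i ^^ \<alpha> i) ys"
    using sy by (intro ext foldr_cong) auto
  moreover have "foldr (\<lambda>i. D i ^^ ?\<beta> i) xs = id" "foldr (\<lambda>i. D i ^^ \<alpha> i) xs = id"
    by (rule foldr_funpow_zero, use sx assms in force)+
  ultimately show ?thesis
    unfolding multi_deriv_def L by simp
qed

lemma multi_deriv_partial_step:
  assumes "\<forall>i<l. \<alpha> i = 0"
  shows "multi_deriv partial (\<alpha>(l := Suc (\<alpha> l))) f z = partial l (multi_deriv partial \<alpha> f) z"
  by (simp add: multi_deriv_step[OF assms])

lemma multi_index_induct [case_names zero step]: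
  fixes P :: "('m::{finite,linorder} \<Rightarrow> nat) \<Rightarrow> bool"
  assumes "P (\<lambda>_. 0)"
    and "\<And>\<alpha> l. \<forall>i<l. \<alpha> i = 0 \<Longrightarrow> P \<alpha> \<Longrightarrow> P (\<alpha>(l := Suc (\<alpha> l)))"
  shows "P \<alpha>"
proof (induction "\<Sum>i\<in>UNIV. \<alpha> i" arbitrary: \<alpha>)
  case 0
  then have "\<alpha> = (\<lambda>_. 0)" by auto
  then show ?case using assms(1) by simp
next
  case (Suc n)
  define l where "l = Min {i. \<alpha> i \<noteq> 0}"
  have ne: "{i. \<alpha> i \<noteq> 0} \<noteq> {}" using Suc(2) by (metis (mono_tags) Collect_empty_eq nat.simps(3) sum.neutral)
  have l: "\<alpha> l \<noteq> 0" using Min_in[OF _ ne] unfolding l_def by simp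
  have min: "\<alpha> i = 0" if "i < l" for i
    using Min_le[of "{i. \<alpha> i \<noteq> 0}" i] that unfolding l_def by (meson finite leD mem_Collect_eq)
  define \<beta> where "\<beta> = \<alpha>(l := \<alpha> l - 1)"
  have \<alpha>: "\<alpha> = \<beta>(l := Suc (\<beta> l))" using l by (auto simp: \<beta>_def)
  have "(\<Sum>i\<in>UNIV. \<alpha> i) = \<alpha> l + (\<Sum>i\<in>UNIV - {l}. \<alpha> i)" "(\<Sum>i\<in>UNIV. \<beta> i) = \<beta> l + (\<Sum>i\<in>UNIV - {l}. \<beta> i)"
    by (simp_all add: sum.remove)
  moreover have "(\<Sum>i\<in>UNIV - {l}. \<beta> i) = (\<Sum>i\<in>UNIV - {l}. \<alpha> i)"
    by (rule sum.cong) (auto simp: \<beta>_def)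
  ultimately have "n = (\<Sum>i\<in>UNIV. \<beta> i)" using Suc(2) l by (simp add: \<beta>_def)
  then have "P \<beta>" by (rule Suc(1))
  moreover have "\<forall>i<l. \<beta> i = 0" using min by (simp add: \<beta>_def)
  ultimately show ?case using assms(2) \<alpha> by metis
qed

lemma partial_cong:
  assumes "open S" "\<And>z. z \<in> S \<Longrightarrow> f z = g z" "z \<in> S"
  shows "partial i f z = partial i g z"
  unfolding partial_def
proof (rule deriv_cong_ev)
  have "open {t. z + t *s axis i 1 \<in> S}" by (rule open_line_preimage[OF assms(1)])
  then have "\<forall>\<^sub>F t in nhds 0. t \<in> {t. z + t *s axis i 1 \<in> S}"
    by (rule eventually_nhds_in_open) (simp add: assms(3))
  then show "\<forall>\<^sub>F t in nhds 0. f (z + t *s axis i 1) = g (z + t *s axis i 1)"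
    by (rule eventually_mono) (simp add: assms(2))
qed simp

lemma partial_add:
  assumes "line_holomorphic_on f S" "line_holomorphic_on g S" "z \<in> S"
  shows "partial i (\<lambda>w. f w + g w) z = partial i f z + partial i g z"
  using DERIV_add[OF has_field_derivative_partial[OF assms(1,3)] has_field_derivative_partial[OF assms(2,3)]]
  by (rule partial_eqI)

lemma partial_mult:
  assumes "line_holomorphic_on f S" "line_holomorphic_on g S" "z \<in> S"
  shows "partial i (\<lambda>w. f w * g w) z = partial i f z * g z + f z * partial i g z"
proof (rule partial_eqI)
  have "((\<lambda>t. f (z + t *s axis i 1) * g (z + t *s axis i 1)) has_field_derivative
      partial i f z * g (z + 0 *s axis i 1) + partial i g z * f (z + 0 *s axis i 1)) (at 0)"
    by (rule DERIV_mult[OF has_field_derivative_partial[OF assms(1,3)] has_field_derivative_partial[OF assms(2,3)]])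
  then show "((\<lambda>t. f (z + t *s axis i 1) * g (z + t *s axis i 1)) has_field_derivative
      partial i f z * g z + f z * partial i g z) (at 0)" by (simp add: mult.commute)
qed

lemma partial_const [simp]: "partial i (\<lambda>_. c) = (\<lambda>_. 0)"
  unfolding partial_def by simp

lemma partial_coord: "partial i (\<lambda>w. w $ l) z = (if i = l then 1 else 0)"
proof (rule partial_eqI)
  show "((\<lambda>t. (z + t *s axis i 1) $ l) has_field_derivative (if i = l then 1 else 0)) (at 0)"
    by (auto simp: axis_def intro!: derivative_eq_intros)
qed

lemma partial_cnj:
  assumes "line_holomorphic_on f S" "w \<in> vcnj ` S"
  shows "partial i (\<lambda>w. cnj (f (vcnj w))) w = cnj (partial i f (vcnj w))"
proof (rule partial_eqI)
  have ax: "vcnj (axis i 1) = axis i 1" by (simp add: vcnj_def axis_def vec_eq_iff)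
  have "((\<lambda>t. f (vcnj w + t *s axis i 1)) has_field_derivative partial i f (vcnj w)) (at 0)"
    by (rule has_field_derivative_partial[OF assms(1)]) (use assms(2) vcnj_image_iff in blast)
  from has_field_derivative_cnj_cnj'[OF this]
  show "((\<lambda>t. cnj (f (vcnj (w + t *s axis i 1)))) has_field_derivative cnj (partial i f (vcnj w))) (at 0)"
    by (simp add: vcnj_line ax)
qed

context
  fixes S :: "'m::{finite,linorder} cvec set"
  assumes S: "open S"
begin

lemma line_holomorphic_multi_deriv:
  "line_holomorphic_on f S \<Longrightarrow> line_holomorphic_on (multi_deriv partial \<alpha> f) S"
  by (induction \<alpha> rule: multi_index_induct)
    (simp_all add: multi_deriv_zero multi_deriv_step line_holomorphic_partial[OF S])

lemma multi_deriv_cong: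
  assumes "\<And>z. z \<in> S \<Longrightarrow> f z = g z" "z \<in> S"
  shows "multi_deriv partial \<alpha> f z = multi_deriv partial \<alpha> g z"
proof -
  have "\<forall>z\<in>S. multi_deriv partial \<alpha> f z = multi_deriv partial \<alpha> g z"
    by (induction \<alpha> rule: multi_index_induct)
      (auto simp: multi_deriv_zero multi_deriv_partial_step assms(1) simp del: fun_upd_apply intro: partial_cong[OF S])
  then show ?thesis using assms(2) by blast
qed

lemma multi_deriv_add:
  assumes "line_holomorphic_on f S" "line_holomorphic_on g S" "z \<in> S"
  shows "multi_deriv partial \<alpha> (\<lambda>w. f w + g w) z = multi_deriv partial \<alpha> f z + multi_deriv partial \<alpha> g z"
proof -
  have "\<forall>z\<in>S. multi_deriv partial \<alpha> (\<lambda>w. f w + g w) z = multi_deriv partial \<alpha> f z + multi_deriv partial \<alpha> g z"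
  proof (induction \<alpha> rule: multi_index_induct)
    case (step \<alpha> l)
    then show ?case
      using partial_cong[OF S, of "multi_deriv partial \<alpha> (\<lambda>w. f w + g w)", OF step(2)[rule_format]] assms(1,2)
      by (simp add: multi_deriv_partial_step partial_add[where S = S] line_holomorphic_multi_deriv del: fun_upd_apply)
  qed (simp add: multi_deriv_zero)
  then show ?thesis using assms(3) by blast
qed

lemma multi_deriv_diff:
  assumes "line_holomorphic_on f S" "line_holomorphic_on g S" "z \<in> S"
  shows "multi_deriv partial \<alpha> (\<lambda>w. f w - g w) z = multi_deriv partial \<alpha> f z - multi_deriv partial \<alpha> g z"
  using multi_deriv_add[OF line_holomorphic_diff[OF assms(1,2)] assms(2,3), of \<alpha>]
  by simp

lemma multi_deriv_cmult:
  assumes "line_holomorphic_on f S" "z \<in> S"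
  shows "multi_deriv partial \<alpha> (\<lambda>w. c * f w) z = c * multi_deriv partial \<alpha> f z"
proof -
  have "\<forall>z\<in>S. multi_deriv partial \<alpha> (\<lambda>w. c * f w) z = c * multi_deriv partial \<alpha> f z"
  proof (induction \<alpha> rule: multi_index_induct)
    case (step \<alpha> l)
    then show ?case
      using partial_cong[OF S, of "multi_deriv partial \<alpha> (\<lambda>w. c * f w)", OF step(2)[rule_format]] assms(1)
      by (simp add: multi_deriv_partial_step partial_mult[where S = S] line_holomorphic_multi_deriv del: fun_upd_apply)
  qed (simp add: multi_deriv_zero)
  then show ?thesis using assms(2) by blast
qed

lemma multi_deriv_const_0: "z \<in> S \<Longrightarrow> multi_deriv partial \<alpha> (\<lambda>_. 0) z = 0"
  using multi_deriv_cmult[of "\<lambda>_. 0" z \<alpha> 0] by simp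

lemma multi_deriv_sum:
  assumes "\<And>i. i \<in> I \<Longrightarrow> line_holomorphic_on (f i) S" "z \<in> S"
  shows "multi_deriv partial \<alpha> (\<lambda>w. \<Sum>i\<in>I. f i w) z = (\<Sum>i\<in>I. multi_deriv partial \<alpha> (f i) z)"
  using assms
proof (induction I rule: infinite_finite_induct)
  case (insert x F)
  then have "multi_deriv partial \<alpha> (\<lambda>w. f x w + (\<Sum>i\<in>F. f i w)) z
      = multi_deriv partial \<alpha> (f x) z + multi_deriv partial \<alpha> (\<lambda>w. \<Sum>i\<in>F. f i w) z"
    by (intro multi_deriv_add line_holomorphic_sum) auto
  then show ?case using insert by simp
qed (simp_all add: multi_deriv_const_0)

lemma multi_deriv_cnj:
  assumes "line_holomorphic_on f S" "w \<in> vcnj ` S"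
  shows "multi_deriv partial \<alpha> (\<lambda>w. cnj (f (vcnj w))) w = cnj (multi_deriv partial \<alpha> f (vcnj w))"
proof -
  have "\<forall>w\<in>vcnj ` S. multi_deriv partial \<alpha> (\<lambda>w. cnj (f (vcnj w))) w = cnj (multi_deriv partial \<alpha> f (vcnj w))"
  proof (induction \<alpha> rule: multi_index_induct)
    case (step \<alpha> l)
    show ?case
    proof
      fix w assume w: "w \<in> vcnj ` S"
      have "partial l (multi_deriv partial \<alpha> (\<lambda>w. cnj (f (vcnj w)))) w =
          partial l (\<lambda>w. cnj (multi_deriv partial \<alpha> f (vcnj w))) w"
        by (rule partial_cong[OF open_vcnj_image[OF S] _ w]) (use step(2) in blast)
      also have "\<dots> = cnj (partial l (multi_deriv partial \<alpha> f) (vcnj w))"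
        by (rule partial_cnj[OF line_holomorphic_multi_deriv[OF assms(1)] w])
      finally show "multi_deriv partial (\<alpha>(l := Suc (\<alpha> l))) (\<lambda>w. cnj (f (vcnj w))) w =
          cnj (multi_deriv partial (\<alpha>(l := Suc (\<alpha> l))) f (vcnj w))"
        using step(1) by (simp add: multi_deriv_partial_step)
    qed
  qed (simp add: multi_deriv_zero)
  then show ?thesis using assms(2) by blast
qed

text \<open>
  The remainder in Leibniz's rule, as a list of coefficients and multi-indices: differentiating it
  once more replaces each entry by two, without any reindexing of sums.
\<close>

definition lower_terms ::
    "(('m cvec \<Rightarrow> complex) \<times> ('m \<Rightarrow> nat)) list \<Rightarrow> ('m cvec \<Rightarrow> complex) \<Rightarrow> 'm cvec \<Rightarrow> complex" where
  "lower_terms xs g w = (\<Sum>(b, \<beta>)\<leftarrow>xs. b w * multi_deriv partial \<beta> g w)"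

definition lower_order :: "('m \<Rightarrow> nat) \<Rightarrow> (('m cvec \<Rightarrow> complex) \<times> ('m \<Rightarrow> nat)) list \<Rightarrow> bool" where
  "lower_order \<alpha> xs \<longleftrightarrow> (\<forall>(b, \<beta>)\<in>set xs. line_holomorphic_on b S \<and> \<beta> \<le> \<alpha> \<and> \<beta> \<noteq> \<alpha>)"

lemma line_holomorphic_lower_terms:
  assumes "lower_order \<alpha> xs" "line_holomorphic_on g S"
  shows "line_holomorphic_on (lower_terms xs g) S"
  using assms(1) unfolding lower_terms_def lower_order_def
  by (induction xs)
    (auto intro!: line_holomorphic_add line_holomorphic_mult line_holomorphic_multi_deriv assms(2))

lemma partial_lower_terms:
  assumes "lower_order \<alpha> xs" and l: "\<forall>i<l. \<alpha> i = 0"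
  shows "\<exists>ys. lower_order (\<alpha>(l := Suc (\<alpha> l))) ys \<and>
    (\<forall>g. line_holomorphic_on g S \<longrightarrow> (\<forall>w\<in>S. partial l (lower_terms xs g) w = lower_terms ys g w))"
  using assms(1)
proof (induction xs)
  case Nil
  have "lower_terms [] g = (\<lambda>_. 0)" for g by (simp add: lower_terms_def fun_eq_iff)
  then show ?case by (intro exI[of _ "[]"]) (simp add: lower_order_def)
next
  case (Cons x xs)
  obtain b \<beta> where x: "x = (b, \<beta>)" by fastforce
  have xs: "lower_order \<alpha> xs" and b: "line_holomorphic_on b S" and \<beta>: "\<beta> \<le> \<alpha>" "\<beta> \<noteq> \<alpha>"
    using Cons.prems unfolding lower_order_def x by auto
  obtain ys where ys: "lower_order (\<alpha>(l := Suc (\<alpha> l))) ys"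
    "\<And>g w. line_holomorphic_on g S \<Longrightarrow> w \<in> S \<Longrightarrow> partial l (lower_terms xs g) w = lower_terms ys g w"
    using Cons.IH[OF xs] by blast
  let ?zs = "(partial l b, \<beta>) # (b, \<beta>(l := Suc (\<beta> l))) # ys"
  have \<beta>0: "\<forall>i<l. \<beta> i = 0" using l \<beta>(1) by (metis le_funD le_zero_eq)
  have "\<beta> \<noteq> \<alpha>(l := Suc (\<alpha> l))" using \<beta>(1) by (metis Suc_n_not_le_n fun_upd_same le_funD)
  moreover have "\<beta>(l := Suc (\<beta> l)) \<noteq> \<alpha>(l := Suc (\<alpha> l))"
    using \<beta>(2) by (metis Suc_inject ext fun_upd_other fun_upd_same)
  moreover have "\<beta> \<le> \<alpha>(l := Suc (\<alpha> l))" "\<beta>(l := Suc (\<beta> l)) \<le> \<alpha>(l := Suc (\<alpha> l))"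
    using \<beta>(1) by (auto simp: le_fun_def le_SucI)
  ultimately have "lower_order (\<alpha>(l := Suc (\<alpha> l))) ?zs"
    using ys(1) b by (auto simp: lower_order_def line_holomorphic_partial[OF S])
  moreover have "partial l (lower_terms (x # xs) g) w = lower_terms ?zs g w"
    if g: "line_holomorphic_on g S" and w: "w \<in> S" for g w
  proof -
    have "lower_terms (x # xs) g = (\<lambda>w. b w * multi_deriv partial \<beta> g w + lower_terms xs g w)"
      by (simp add: lower_terms_def x fun_eq_iff)
    then have "partial l (lower_terms (x # xs) g) w =
        partial l b w * multi_deriv partial \<beta> g w + b w * partial l (multi_deriv partial \<beta> g) w
        + partial l (lower_terms xs g) w"
      using partial_add[OF line_holomorphic_mult[OF b line_holomorphic_multi_deriv[OF g]]
          line_holomorphic_lower_terms[OF xs g] w]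
        partial_mult[OF b line_holomorphic_multi_deriv[OF g] w] by simp
    also have "\<dots> = lower_terms ?zs g w"
      using ys(2)[OF g w] multi_deriv_partial_step[OF \<beta>0] by (simp add: lower_terms_def)
    finally show ?thesis .
  qed
  ultimately show ?case by blast
qed

text \<open>
  Differentiating \<open>a \<partial>\<^sup>\<alpha>g\<close> once more gives the next leading term and a term of lower order.  Of the remainder
  only its order is recorded, and that its coefficients are the same for all \<open>g\<close>.
\<close>

lemma leibniz:
  assumes a: "line_holomorphic_on a S"
  shows "\<exists>xs. lower_order \<alpha> xs \<and> (\<forall>g. line_holomorphic_on g S \<longrightarrow> (\<forall>w\<in>S.
    multi_deriv partial \<alpha> (\<lambda>w. a w * g w) w = a w * multi_deriv partial \<alpha> g w + lower_terms xs g w))"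
proof (induction \<alpha> rule: multi_index_induct)
  case zero
  show ?case by (intro exI[of _ "[]"]) (simp add: lower_order_def lower_terms_def multi_deriv_zero)
next
  case (step \<alpha> l)
  then obtain xs where xs: "lower_order \<alpha> xs"
    "\<And>g w. line_holomorphic_on g S \<Longrightarrow> w \<in> S \<Longrightarrow>
      multi_deriv partial \<alpha> (\<lambda>w. a w * g w) w = a w * multi_deriv partial \<alpha> g w + lower_terms xs g w"
    by blast
  from partial_lower_terms[OF xs(1) step(1)] obtain ys where ys: "lower_order (\<alpha>(l := Suc (\<alpha> l))) ys"
    "\<And>g w. line_holomorphic_on g S \<Longrightarrow> w \<in> S \<Longrightarrow> partial l (lower_terms xs g) w = lower_terms ys g w"
    by blast
  let ?zs = "(partial l a, \<alpha>) # ys"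
  have "\<alpha> \<noteq> \<alpha>(l := Suc (\<alpha> l))" by (metis fun_upd_same n_not_Suc_n)
  then have "lower_order (\<alpha>(l := Suc (\<alpha> l))) ?zs"
    using ys(1) a by (auto simp: lower_order_def le_fun_def line_holomorphic_partial[OF S])
  moreover have "multi_deriv partial (\<alpha>(l := Suc (\<alpha> l))) (\<lambda>w. a w * g w) w =
      a w * multi_deriv partial (\<alpha>(l := Suc (\<alpha> l))) g w + lower_terms ?zs g w"
    if g: "line_holomorphic_on g S" and w: "w \<in> S" for g w
  proof -
    have "partial l (multi_deriv partial \<alpha> (\<lambda>w. a w * g w)) w =
        partial l (\<lambda>w. a w * multi_deriv partial \<alpha> g w + lower_terms xs g w) w"
      by (rule partial_cong[OF S xs(2)[OF g] w])
    also have "\<dots> = partial l a w * multi_deriv partial \<alpha> g w + a w * partial l (multi_deriv partial \<alpha> g) w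
        + lower_terms ys g w"
      using partial_add[OF line_holomorphic_mult[OF a line_holomorphic_multi_deriv[OF g]]
          line_holomorphic_lower_terms[OF xs(1) g] w]
        partial_mult[OF a line_holomorphic_multi_deriv[OF g] w] ys(2)[OF g w] by simp
    finally show ?thesis using multi_deriv_partial_step[OF step(1)] by (simp add: lower_terms_def)
  qed
  ultimately show ?case by blast
qed

text \<open>
  The triangular form of Leibniz's rule at a point: it shows both that multiplication preserves
  vanishing to a given order and that an invertible matrix of functions can be cancelled.
\<close>

lemma leibniz_leading:
  assumes "line_holomorphic_on a S" "line_holomorphic_on g S" "w \<in> S"
    and "\<And>\<beta>. \<beta> \<le> \<alpha> \<Longrightarrow> \<beta> \<noteq> \<alpha> \<Longrightarrow> multi_deriv partial \<beta> g w = 0"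
  shows "multi_deriv partial \<alpha> (\<lambda>w. a w * g w) w = a w * multi_deriv partial \<alpha> g w"
proof -
  obtain xs where xs: "lower_order \<alpha> xs" "multi_deriv partial \<alpha> (\<lambda>w. a w * g w) w =
      a w * multi_deriv partial \<alpha> g w + lower_terms xs g w"
    using leibniz[OF assms(1), of \<alpha>] assms(2,3) by blast
  have "lower_terms xs g w = 0"
    using xs(1) unfolding lower_order_def lower_terms_def by (induction xs) (auto simp: assms(4))
  then show ?thesis using xs(2) by simp
qed

text \<open>
  The commutator of \<open>\<partial>\<^sup>\<alpha>\<close> with a coordinate lowers the order by one; for jets this becomes the
  eigenvalue relation \<open>hip_jet_coord\<close>.  If \<open>\<alpha> l = 0\<close>, the truncated index \<open>\<alpha> l - 1\<close> is harmless
  because its factor is zero.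
\<close>

lemma multi_deriv_coord_mult:
  assumes "line_holomorphic_on g S" "w \<in> S"
  shows "multi_deriv partial \<alpha> (\<lambda>w. w $ l * g w) w =
    w $ l * multi_deriv partial \<alpha> g w + of_nat (\<alpha> l) * multi_deriv partial (\<alpha>(l := \<alpha> l - 1)) g w"
proof -
  have "\<forall>w\<in>S. multi_deriv partial \<alpha> (\<lambda>w. w $ l * g w) w =
    w $ l * multi_deriv partial \<alpha> g w + of_nat (\<alpha> l) * multi_deriv partial (\<alpha>(l := \<alpha> l - 1)) g w"
  proof (induction \<alpha> rule: multi_index_induct)
    case (step \<alpha> k)
    let ?\<gamma> = "\<alpha>(l := \<alpha> l - 1)"
    have k: "\<forall>i<k. ?\<gamma> i = 0" using step(1) by simp
    note hol = line_holomorphic_multi_deriv[OF assms(1)]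
    show ?case
    proof
      fix w assume w: "w \<in> S"
      have "partial k (multi_deriv partial \<alpha> (\<lambda>w. w $ l * g w)) w =
          partial k (\<lambda>w. w $ l * multi_deriv partial \<alpha> g w + of_nat (\<alpha> l) * multi_deriv partial ?\<gamma> g w) w"
        by (rule partial_cong[OF S _ w]) (use step(2) in blast)
      also have "\<dots> = (if k = l then 1 else 0) * multi_deriv partial \<alpha> g w
          + w $ l * partial k (multi_deriv partial \<alpha> g) w
          + of_nat (\<alpha> l) * partial k (multi_deriv partial ?\<gamma> g) w"
        using partial_add[OF line_holomorphic_mult[OF line_holomorphic_coord hol]
            line_holomorphic_mult[OF line_holomorphic_const hol] w]
          partial_mult[OF line_holomorphic_coord hol w] partial_mult[OF line_holomorphic_const hol w]
        by (simp add: partial_coord)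
      also have "\<dots> = (if k = l then 1 else 0) * multi_deriv partial \<alpha> g w
          + w $ l * multi_deriv partial (\<alpha>(k := Suc (\<alpha> k))) g w
          + of_nat (\<alpha> l) * multi_deriv partial (?\<gamma>(k := Suc (?\<gamma> k))) g w"
        by (simp only: multi_deriv_partial_step[OF step(1)] multi_deriv_partial_step[OF k])
      also have "\<dots> = w $ l * multi_deriv partial (\<alpha>(k := Suc (\<alpha> k))) g w
          + of_nat ((\<alpha>(k := Suc (\<alpha> k))) l)
            * multi_deriv partial ((\<alpha>(k := Suc (\<alpha> k)))(l := (\<alpha>(k := Suc (\<alpha> k))) l - 1)) g w"
      proof (cases "k = l")
        case True
        then show ?thesis by (cases "\<alpha> l") (simp_all add: algebra_simps fun_upd_idem)
      next
        case False
        then show ?thesis by (simp add: fun_upd_twist)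
      qed
      finally show "multi_deriv partial (\<alpha>(k := Suc (\<alpha> k))) (\<lambda>w. w $ l * g w) w =
         w $ l * multi_deriv partial (\<alpha>(k := Suc (\<alpha> k))) g w
          + of_nat ((\<alpha>(k := Suc (\<alpha> k))) l)
            * multi_deriv partial ((\<alpha>(k := Suc (\<alpha> k)))(l := (\<alpha>(k := Suc (\<alpha> k))) l - 1)) g w"
        using multi_deriv_partial_step[OF step(1)] by simp
    qed
  qed (simp add: multi_deriv_zero)
  then show ?thesis using assms(2) by blast
qed

end

lemma multi_indices_below_mono:
  assumes "\<alpha> \<in> multi_indices_below J k" "\<beta> \<le> \<alpha>"
  shows "\<beta> \<in> multi_indices_below J k"
proof -
  have "(\<Sum>i\<in>J. \<beta> i) \<le> (\<Sum>i\<in>J. \<alpha> i)" using assms(2) by (intro sum_mono) (simp add: le_fun_def)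
  moreover have "\<beta> i = 0" if "\<alpha> i = 0" for i using assms(2) that by (metis le_funD le_zero_eq)
  ultimately show ?thesis using assms(1) unfolding multi_indices_below_def multi_indices_def by auto
qed

section \<open>Identity theorem and polarization\<close>

lemma line_identity:
  assumes "open B" "convex B" "line_holomorphic_on F B" "x \<in> B" "y \<in> B"
    and "e > 0" "\<And>t. cmod t < e \<Longrightarrow> F (x + t *s (y - x)) = 0"
  shows "F y = 0"
proof -
  let ?T = "{t. x + t *s (y - x) \<in> B}"
  have o: "open ?T" by (rule open_line_preimage[OF assms(1)])
  have c: "connected ?T" by (rule convex_connected[OF convex_line_preimage[OF assms(2)]])
  have "F (x + 1 *s (y - x)) = (\<lambda>_. 0) (1::complex)"
  proof (rule analytic_continuation_open[where s = "?T \<inter> ball 0 e" and s' = ?T and f = "\<lambda>t. F (x + t *s (y - x))"])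
    show "?T \<inter> ball 0 e \<noteq> {}" using assms(4,6) by (metis (mono_tags, lifting) Int_iff add.right_neutral centre_in_ball empty_iff mem_Collect_eq vector_smult_lzero)
    show "(\<lambda>t. F (x + t *s (y - x))) holomorphic_on ?T"
      by (rule line_holomorphic_imp_holomorphic[OF assms(3)])
    show "\<And>z. z \<in> ?T \<inter> ball 0 e \<Longrightarrow> F (x + z *s (y - x)) = 0" using assms(7) by simp
  qed (use o c assms(5) in auto)
  then show ?thesis by simp
qed

text \<open>
  Vanishing near a point of \<open>\<Z>\<close> propagates to a whole ball around it: a segment in the ball between
  two points of \<open>\<Z>\<close> spans a complex line that stays in the linear subspace, where the identity
  theorem in one variable applies.  Connectedness of \<open>\<Z>\<close> does the rest.
\<close>

lemma zero_locus_identity: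
  assumes "open \<Omega>" "connected (zero_locus \<Omega> J)" "line_holomorphic_on F \<Omega>" "0 \<in> \<Omega>"
    and "0 < \<epsilon>" "\<And>z. z \<in> zero_locus \<Omega> J \<Longrightarrow> norm z < \<epsilon> \<Longrightarrow> F z = 0"
    and "z \<in> zero_locus \<Omega> J"
  shows "F z = 0"
proof -
  let ?Z = "zero_locus \<Omega> J"
  define P where "P z \<longleftrightarrow> (\<exists>e>0. \<forall>y\<in>?Z \<inter> ball z e. F y = 0)" for z
  have "P z"
  proof (rule connected_induction_simple[OF assms(2), of 0 z P])
    show "0 \<in> ?Z" using assms(4) by (simp add: zero_locus_def)
    show "P 0" unfolding P_def using assms(5,6) by (intro exI[of _ \<epsilon>]) auto
    fix a assume "a \<in> ?Z"
    then have a: "a \<in> \<Omega>" by (simp add: zero_locus_def)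
    then obtain r where r: "r > 0" "ball a r \<subseteq> \<Omega>" using assms(1) open_contains_ball by blast
    let ?T = "?Z \<inter> ball a r"
    have "P y" if x: "x \<in> ?T" "P x" and y: "y \<in> ?T" for x y
    proof -
      obtain e where e: "e > 0" "\<And>u. u \<in> ?Z \<Longrightarrow> dist x u < e \<Longrightarrow> F u = 0"
        using x(2) unfolding P_def by auto
      have "F u = 0" if u: "u \<in> ?T" for u
      proof -
        let ?S = "{t. x + t *s (u - x) \<in> ball a r} \<inter> ball 0 (e / (norm (u - x) + 1))"
        have "open ?S" by (intro open_Int open_line_preimage) auto
        moreover have "0 \<in> ?S" using x e(1) by (simp add: add_nonneg_pos)
        ultimately obtain d where d: "d > 0" "ball 0 d \<subseteq> ?S" using open_contains_ball by metis
        show ?thesis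
        proof (rule line_identity[of "ball a r" F x u d])
          fix t :: complex assume t: "cmod t < d"
          then have t': "x + t *s (u - x) \<in> ball a r" "cmod t < e / (norm (u - x) + 1)"
            using d(2) by (auto simp: subset_eq)
          have "cmod t * (norm (u - x) + 1) < e"
            using t'(2) by (simp add: pos_less_divide_eq add_nonneg_pos)
          then have "cmod t * norm (u - x) < e" by (simp add: distrib_left) (smt (verit) norm_ge_zero)
          then have "dist x (x + t *s (u - x)) < e" 
            by (metis add_diff_cancel_left' dist_commute dist_norm norm_smult_vec)
          moreover have "x + t *s (u - x) \<in> ?Z"
            using x u t'(1) r(2) unfolding zero_locus_def by auto
          ultimately show "F (x + t *s (u - x)) = 0" using e(2) by blast
        qed (use x u d r line_holomorphic_subset[OF assms(3)] in auto)
      qed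
      moreover obtain e' where "e' > 0" "ball y e' \<subseteq> ball a r"
        using y open_contains_ball[of "ball a r"] by (meson Int_iff open_ball)
      ultimately show "P y" unfolding P_def by (intro exI[of _ e']) (auto simp: subset_eq)
    qed
    moreover have "openin (top_of_set ?Z) ?T" by (simp add: openin_open_Int)
    moreover have "a \<in> ?T" using \<open>a \<in> ?Z\<close> r by simp
    ultimately show "\<exists>T. openin (top_of_set ?Z) T \<and> a \<in> T \<and> (\<forall>x\<in>T. \<forall>y\<in>T. P x \<longrightarrow> P y)"
      by blast
  qed (use assms(7) in auto)
  then show ?thesis unfolding P_def using assms(7) by auto
qed

text \<open>
  With \<open>c\<close> the midpoint of \<open>p\<close> and \<open>q\<close>, the function \<open>t \<mapsto> f (c + t e) (c + cnj t e)\<close> is holomorphic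
  and, by the assumption on the diagonal, vanishes for real \<open>t\<close>.  It therefore vanishes as long
  as both arguments stay in \<open>B\<close>, and the multiple \<open>e = \<i> (p - q) / 2\<close> is chosen so that \<open>t = -\<i>\<close> gives \<open>f p q\<close>.
\<close>

lemma polarization:
  fixes f :: "complex^'n \<Rightarrow> complex^'n \<Rightarrow> complex"
  assumes B: "open B" "convex B"
    and diff: "\<And>p q e. p \<in> B \<Longrightarrow> q \<in> B \<Longrightarrow>
      (\<lambda>t. f (p + t *s e) (q + cnj t *s e)) field_differentiable at 0"
    and diag: "\<And>w. w \<in> B \<Longrightarrow> (\<forall>i\<in>J. w $ i = 0) \<Longrightarrow> f w w = 0"
    and p: "p \<in> B" "\<forall>i\<in>J. p $ i = 0" and q: "q \<in> B" "\<forall>i\<in>J. q $ i = 0"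
  shows "f p q = 0"
proof -
  define c where "c = (1/2) *s (p + q)"
  define e where "e = (\<i>/2) *s (p - q)"
  have cB: "c \<in> B"
  proof -
    have "(1/2) *\<^sub>R p + (1/2) *\<^sub>R q \<in> B" by (rule convexD[OF B(2) p(1) q(1)]) auto
    moreover have "c = (1/2) *\<^sub>R p + (1/2) *\<^sub>R q"
      by (simp add: c_def vec_eq_iff scaleR_conv_of_real[where 'a = complex])
    ultimately show ?thesis by simp
  qed
  have pq: "c + (-\<i>) *s e = p" "c + cnj (-\<i>) *s e = q"
    by (simp_all add: c_def e_def vec_eq_iff field_simps)
  define T where "T = {t. c + t *s e \<in> B} \<inter> cnj ` {t. c + t *s e \<in> B}"
  have cnjT: "t \<in> cnj ` {t. c + t *s e \<in> B} \<longleftrightarrow> c + cnj t *s e \<in> B" for t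
    by (metis (mono_tags, lifting) complex_cnj_cnj imageE image_eqI mem_Collect_eq)
  have "cnj ` {t. c + t *s e \<in> B} = cnj -` {t. c + t *s e \<in> B}"
    using cnjT by auto
  then have "open (cnj ` {t. c + t *s e \<in> B})"
    using open_vimage[OF open_line_preimage[OF B(1)] continuous_on_cnj[OF continuous_on_id]] by simp
  then have oT: "open T" unfolding T_def by (intro open_Int open_line_preimage B)
  have "convex (cnj ` {t. c + t *s e \<in> B})"
    by (intro convex_linear_image convex_line_preimage B bounded_linear.linear bounded_linear_cnj)
  then have cT: "connected T"
    unfolding T_def by (intro convex_connected convex_Int convex_line_preimage B)
  have hol: "(\<lambda>t. f (c + t *s e) (c + cnj t *s e)) holomorphic_on T"
    unfolding holomorphic_on_def
  proof
    fix t0 assume "t0 \<in> T"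
    then have "c + t0 *s e \<in> B" "c + cnj t0 *s e \<in> B" using cnjT unfolding T_def by auto
    from diff[OF this, of e] have "(\<lambda>t. f ((c + t0 *s e) + t *s e) ((c + cnj t0 *s e) + cnj t *s e)) field_differentiable at (t0 - t0)"
      by simp
    then have "((\<lambda>t. f ((c + t0 *s e) + t *s e) ((c + cnj t0 *s e) + cnj t *s e)) \<circ> (\<lambda>t. t - t0))
        field_differentiable at t0"
      by (intro field_differentiable_compose derivative_intros)
    moreover have "(\<lambda>t. f ((c + t0 *s e) + t *s e) ((c + cnj t0 *s e) + cnj t *s e)) \<circ> (\<lambda>t. t - t0)
        = (\<lambda>t. f (c + t *s e) (c + cnj t *s e))"
      by (auto simp: fun_eq_iff vec_eq_iff algebra_simps intro!: arg_cong2[where f=f])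
    ultimately show "(\<lambda>t. f (c + t *s e) (c + cnj t *s e)) field_differentiable at t0 within T"
      by (simp add: field_differentiable_at_within)
  qed
  have T0: "0 \<in> T" using cB cnjT[of 0] unfolding T_def by simp
  obtain \<delta> where \<delta>: "\<delta> > 0" "ball 0 \<delta> \<subseteq> T" using oT T0 open_contains_ball by blast
  let ?R = "T \<inter> \<real>"
  have "f (c + (-\<i>) *s e) (c + cnj (-\<i>) *s e) = 0"
  proof (rule analytic_continuation[OF hol oT cT, of ?R 0])
    show "0 islimpt ?R"
      unfolding islimpt_approachable
    proof (intro allI impI)
      fix r :: real assume "r > 0"
      let ?t = "complex_of_real (min r \<delta> / 2)"
      have "cmod ?t < min r \<delta>" using \<open>r > 0\<close> \<delta>(1) unfolding norm_of_real by auto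
      then have "?t \<in> ?R" "dist ?t 0 < r" using \<delta>(2) by (auto simp: subset_eq)
      moreover have "?t \<noteq> 0" using \<open>r > 0\<close> \<delta>(1) by auto
      ultimately show "\<exists>x'\<in>?R. x' \<noteq> 0 \<and> dist x' 0 < r" by blast
    qed
    fix t assume t: "t \<in> ?R"
    then have "cnj t = t" by (auto simp: Reals_cnj_iff)
    moreover have "\<forall>i\<in>J. (c + t *s e) $ i = 0" using p q by (simp add: c_def e_def)
    ultimately show "f (c + t *s e) (c + cnj t *s e) = 0"
      using diag t unfolding T_def by auto
  next
    show "- \<i> \<in> T" unfolding T_def using pq p(1) q(1) cnjT[of "-\<i>"] by simp
  qed (use T0 in auto)
  then show ?thesis unfolding pq .
qed

section \<open>Hilbert spaces of functions\<close>

locale hilbert =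
  fixes M :: "('a \<Rightarrow> complex^'r) hspace"
  assumes hilbert_space: "hilbert_space M"
begin

lemma subspace_car: "cfun.subspace (hcar M)"
  using hilbert_space unfolding hilbert_space_def by blast

lemma zero_mem [simp]: "0 \<in> hcar M"
  using subspace_car by (rule cfun.subspace_0)

lemma add_mem [simp]: "f \<in> hcar M \<Longrightarrow> g \<in> hcar M \<Longrightarrow> f + g \<in> hcar M"
  using subspace_car by (rule cfun.subspace_add)

lemma diff_mem [simp]: "f \<in> hcar M \<Longrightarrow> g \<in> hcar M \<Longrightarrow> f - g \<in> hcar M"
  using subspace_car by (rule cfun.subspace_diff)

lemma scale_mem [simp]: "f \<in> hcar M \<Longrightarrow> fscale c f \<in> hcar M"
  using subspace_car by (rule cfun.subspace_scale)

lemma sum_mem: "(\<And>i. i \<in> I \<Longrightarrow> f i \<in> hcar M) \<Longrightarrow> (\<Sum>i\<in>I. f i) \<in> hcar M"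
  using subspace_car by (rule cfun.subspace_sum)

lemma hip_add_left:
  "f \<in> hcar M \<Longrightarrow> g \<in> hcar M \<Longrightarrow> h \<in> hcar M \<Longrightarrow> hip M (f + g) h = hip M f h + hip M g h"
  using hilbert_space unfolding hilbert_space_def by blast

lemma hip_scale_left:
  "f \<in> hcar M \<Longrightarrow> h \<in> hcar M \<Longrightarrow> hip M (fscale c f) h = c * hip M f h"
  using hilbert_space unfolding hilbert_space_def by blast

lemma hip_cnj: "f \<in> hcar M \<Longrightarrow> h \<in> hcar M \<Longrightarrow> cnj (hip M f h) = hip M h f"
  using hilbert_space unfolding hilbert_space_def by metis

lemma hip_pos: "f \<in> hcar M \<Longrightarrow> f \<noteq> 0 \<Longrightarrow> 0 < Re (hip M f f)"
  using hilbert_space unfolding hilbert_space_def by blast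

lemma complete:
  assumes "\<And>n. X n \<in> hcar M"
    and "\<And>e. e > 0 \<Longrightarrow> \<exists>N. \<forall>m\<ge>N. \<forall>n\<ge>N. hnorm M (X m - X n) < e"
  obtains h where "h \<in> hcar M" "(\<lambda>n. hnorm M (X n - h)) \<longlonglongrightarrow> 0"
  using hilbert_space assms unfolding hilbert_space_def by metis

lemma hip_diff_left:
  assumes "f \<in> hcar M" "g \<in> hcar M" "h \<in> hcar M"
  shows "hip M (f - g) h = hip M f h - hip M g h"
  using hip_add_left[of "f - g" g h] assms by simp

lemma hip_zero_left [simp]: "h \<in> hcar M \<Longrightarrow> hip M 0 h = 0"
  using hip_diff_left[of h h h] by simp

lemma hip_add_right:
  assumes "f \<in> hcar M" "g \<in> hcar M" "h \<in> hcar M"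
  shows "hip M h (f + g) = hip M h f + hip M h g"
  using hip_add_left[OF assms] hip_cnj assms by (metis add_mem complex_cnj_add)

lemma hip_diff_right:
  assumes "f \<in> hcar M" "g \<in> hcar M" "h \<in> hcar M"
  shows "hip M h (f - g) = hip M h f - hip M h g"
  using hip_diff_left[OF assms] hip_cnj assms by (metis diff_mem complex_cnj_diff)

lemma hip_scale_right:
  assumes "f \<in> hcar M" "h \<in> hcar M"
  shows "hip M h (fscale c f) = cnj c * hip M h f"
  using hip_scale_left[OF assms, of c] hip_cnj assms by (metis scale_mem complex_cnj_mult)

lemma hip_zero_right [simp]: "h \<in> hcar M \<Longrightarrow> hip M h 0 = 0"
  using hip_diff_right[of h h h] by simp

lemma hip_sum_left:
  assumes "\<And>i. i \<in> I \<Longrightarrow> f i \<in> hcar M" "h \<in> hcar M"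
  shows "hip M (\<Sum>i\<in>I. f i) h = (\<Sum>i\<in>I. hip M (f i) h)"
  using assms by (induction I rule: infinite_finite_induct) (auto simp: hip_add_left sum_mem)

lemma hip_sum_right:
  assumes "\<And>i. i \<in> I \<Longrightarrow> f i \<in> hcar M" "h \<in> hcar M"
  shows "hip M h (\<Sum>i\<in>I. f i) = (\<Sum>i\<in>I. hip M h (f i))"
  using assms by (induction I rule: infinite_finite_induct) (auto simp: hip_add_right sum_mem)

lemma hip_combinations:
  assumes "\<And>a. x a \<in> hcar M" "\<And>b. y b \<in> hcar M"
  shows "hip M (\<Sum>a\<in>A. fscale (c a) (x a)) (\<Sum>b\<in>B. fscale (d b) (y b)) =
    (\<Sum>a\<in>A. \<Sum>b\<in>B. c a * cnj (d b) * hip M (x a) (y b))"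
  using assms by (subst sum.swap)
    (simp add: hip_sum_left hip_sum_right hip_scale_left hip_scale_right sum_mem sum_distrib_left mult_ac)

lemma hip_self: "f \<in> hcar M \<Longrightarrow> hip M f f = of_real ((hnorm M f)\<^sup>2)"
proof -
  assume f: "f \<in> hcar M"
  have "Im (hip M f f) = 0" using arg_cong[OF hip_cnj[OF f f], of Im] by simp
  moreover have "0 \<le> Re (hip M f f)" using hip_pos[OF f] f by (cases "f = 0") auto
  ultimately show ?thesis by (simp add: hnorm_def complex_eq_iff)
qed

lemma hnorm_sq: "f \<in> hcar M \<Longrightarrow> (hnorm M f)\<^sup>2 = Re (hip M f f)"
  using hip_self by simp

lemma hnorm_ge_0: "f \<in> hcar M \<Longrightarrow> 0 \<le> hnorm M f"
  using hip_pos[of f] unfolding hnorm_def by (cases "f = 0") auto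

lemma hnorm_zero [simp]: "hnorm M 0 = 0"
  by (simp add: hnorm_def)

lemma hnorm_eq_0: "f \<in> hcar M \<Longrightarrow> hnorm M f = 0 \<longleftrightarrow> f = 0"
  using hip_pos[of f] unfolding hnorm_def by force

lemma hnorm_scale: 
  assumes "f \<in> hcar M"
  shows "hnorm M (fscale c f) = cmod c * hnorm M f"
proof -
  have "hip M (fscale c f) (fscale c f) = of_real ((cmod c * hnorm M f)\<^sup>2)"
  proof -
    have "hip M (fscale c f) (fscale c f) = (c * cnj c) * hip M f f"
      using assms by (simp add: hip_scale_left hip_scale_right)
    also have "\<dots> = of_real ((cmod c)\<^sup>2) * of_real ((hnorm M f)\<^sup>2)"
      by (simp only: complex_norm_square hip_self[OF assms])
    finally show ?thesis by (simp add: power_mult_distrib)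
  qed
  then show ?thesis unfolding hnorm_def[of M "fscale c f"] using hnorm_ge_0[OF assms] by simp
qed

lemma fscale_minus_1: "fscale (-1) f = - f"
  by (simp add: fscale_def fun_eq_iff vec_eq_iff)

lemma hnorm_minus: "f \<in> hcar M \<Longrightarrow> hnorm M (- f) = hnorm M f"
  using hnorm_scale[of f "-1"] by (simp add: fscale_minus_1)

lemma hnorm_minus_commute: "f \<in> hcar M \<Longrightarrow> g \<in> hcar M \<Longrightarrow> hnorm M (f - g) = hnorm M (g - f)"
  using hnorm_minus[of "g - f"] by simp

lemma eq_if_hip_diff_0:
  assumes "f \<in> hcar M" "g \<in> hcar M" "hip M (f - g) (f - g) = 0"
  shows "f = g"
  using hip_pos[of "f - g"] assms by (metis diff_mem eq_iff_diff_eq_0 less_irrefl zero_complex.simps(1))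

lemma cauchy_schwarz:
  assumes f: "f \<in> hcar M" and g: "g \<in> hcar M"
  shows "cmod (hip M f g) \<le> hnorm M f * hnorm M g"
proof (cases "g = 0")
  case True
  then show ?thesis using f by simp
next
  case False
  define G where "G = (hnorm M g)\<^sup>2"
  have G: "G > 0" using hip_pos[OF g False] hnorm_sq[OF g] by (simp add: G_def)
  define a where "a = hip M f g"
  define u where "u = f - fscale (a / of_real G) g"
  have u: "u \<in> hcar M" using f g by (simp add: u_def)
  have gg: "hip M g g = of_real G" using hip_self[OF g] by (simp add: G_def)
  have gf: "hip M g f = cnj a" using hip_cnj[OF f g] by (simp add: a_def)
  have "hip M u u = of_real ((hnorm M f)\<^sup>2) - a * cnj a / of_real G"
    unfolding u_def using f g G
    by (simp add: hip_diff_left hip_diff_right hip_scale_left hip_scale_right hip_self[OF f] gg gf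
        flip: a_def)
  then have "hip M u u = of_real ((hnorm M f)\<^sup>2 - (cmod a)\<^sup>2 / G)"
    by (simp flip: complex_norm_square)
  then have "0 \<le> (hnorm M f)\<^sup>2 - (cmod a)\<^sup>2 / G"
    using hip_self[OF u] by (metis of_real_eq_iff zero_le_power2)
  then have "(cmod a)\<^sup>2 \<le> (hnorm M f * hnorm M g)\<^sup>2"
    using G by (simp add: field_simps G_def power_mult_distrib)
  then show ?thesis
    unfolding a_def using hnorm_ge_0 f g by (meson mult_nonneg_nonneg power2_le_imp_le)
qed

lemma hnorm_add_sq:
  assumes "f \<in> hcar M" "g \<in> hcar M"
  shows "(hnorm M (f + g))\<^sup>2 = (hnorm M f)\<^sup>2 + 2 * Re (hip M f g) + (hnorm M g)\<^sup>2"
proof -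
  have "Re (hip M g f) = Re (hip M f g)" using arg_cong[OF hip_cnj[OF assms], of Re] by simp
  then show ?thesis using assms by (simp add: hnorm_sq hip_add_left hip_add_right)
qed

lemma hnorm_diff_sq:
  assumes "f \<in> hcar M" "g \<in> hcar M"
  shows "(hnorm M (f - g))\<^sup>2 = (hnorm M f)\<^sup>2 - 2 * Re (hip M f g) + (hnorm M g)\<^sup>2"
proof -
  have "Re (hip M g f) = Re (hip M f g)" using arg_cong[OF hip_cnj[OF assms], of Re] by simp
  then show ?thesis using assms by (simp add: hnorm_sq hip_diff_left hip_diff_right)
qed

lemma hnorm_triangle:
  assumes "f \<in> hcar M" "g \<in> hcar M"
  shows "hnorm M (f + g) \<le> hnorm M f + hnorm M g"
proof (rule power2_le_imp_le)
  have "Re (hip M f g) \<le> hnorm M f * hnorm M g"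
    using cauchy_schwarz[OF assms] complex_Re_le_cmod order_trans by blast
  then show "(hnorm M (f + g))\<^sup>2 \<le> (hnorm M f + hnorm M g)\<^sup>2"
    using assms by (simp add: hnorm_add_sq power2_sum)
  show "0 \<le> hnorm M f + hnorm M g" using hnorm_ge_0 assms by simp
qed

lemma hnorm_triangle_diff:
  assumes "f \<in> hcar M" "g \<in> hcar M" "h \<in> hcar M"
  shows "hnorm M (f - h) \<le> hnorm M (f - g) + hnorm M (g - h)"
  using hnorm_triangle[of "f - g" "g - h"] assms by simp

lemma hnorm_triangle_minus:
  assumes "f \<in> hcar M" "g \<in> hcar M"
  shows "hnorm M f \<le> hnorm M (f - g) + hnorm M g"
  using hnorm_triangle[of "f - g" g] assms by simp

lemma tendsto_hip_left:
  assumes "\<forall>\<^sub>F t in F. X t \<in> hcar M" "h \<in> hcar M" "g \<in> hcar M" "((\<lambda>t. hnorm M (X t - h)) \<longlongrightarrow> 0) F"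
  shows "((\<lambda>t. hip M (X t) g) \<longlongrightarrow> hip M h g) F"
proof (rule LIM_zero_cancel, rule tendsto_norm_zero_cancel, rule tendsto_sandwich[OF _ _ tendsto_const])
  show "\<forall>\<^sub>F t in F. norm (hip M (X t) g - hip M h g) \<le> hnorm M (X t - h) * hnorm M g"
    using assms(1)
    by (rule eventually_mono) (use cauchy_schwarz assms(2,3) in \<open>simp flip: hip_diff_left\<close>)
  show "((\<lambda>t. hnorm M (X t - h) * hnorm M g) \<longlongrightarrow> 0) F"
    using tendsto_mult_right[OF assms(4), of "hnorm M g"] by simp
qed auto

lemma tendsto_hip_right:
  assumes "\<forall>\<^sub>F t in F. X t \<in> hcar M" "h \<in> hcar M" "g \<in> hcar M" "((\<lambda>t. hnorm M (X t - h)) \<longlongrightarrow> 0) F"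
  shows "((\<lambda>t. hip M g (X t)) \<longlongrightarrow> hip M g h) F"
proof -
  have "((\<lambda>t. cnj (hip M (X t) g)) \<longlongrightarrow> cnj (hip M h g)) F"
    by (intro tendsto_cnj tendsto_hip_left assms)
  moreover have "\<forall>\<^sub>F t in F. cnj (hip M (X t) g) = hip M g (X t)"
    using assms(1) by (rule eventually_mono) (simp add: hip_cnj assms(3))
  ultimately show ?thesis using hip_cnj[OF assms(2,3)] by (simp add: tendsto_cong)
qed

lemma tendsto_hnorm:
  assumes "\<And>n. X n \<in> hcar M" "h \<in> hcar M" "(\<lambda>n. hnorm M (X n - h)) \<longlonglongrightarrow> 0"
  shows "(\<lambda>n. hnorm M (X n)) \<longlonglongrightarrow> hnorm M h"
proof (rule LIM_zero_cancel, rule tendsto_rabs_zero_cancel, rule tendsto_sandwich[OF _ _ tendsto_const assms(3)])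
  have "\<bar>hnorm M (X n) - hnorm M h\<bar> \<le> hnorm M (X n - h)" for n
    using hnorm_triangle_minus[OF assms(1,2), of n] hnorm_triangle_minus[OF assms(2,1), of n]
      hnorm_minus_commute[OF assms(1,2), of n] by linarith
  then show "\<forall>\<^sub>F n in sequentially. \<bar>hnorm M (X n) - hnorm M h\<bar> \<le> hnorm M (X n - h)" by simp
qed auto

text \<open>
  The representing vector is the minimizer of \<open>\<parallel>g\<parallel>\<^sup>2 - 2 Re \<phi>(g)\<close>.  The parallelogram law makes minimizing
  sequences Cauchy, and the first variation at the limit is the claimed identity.
\<close>

lemma riesz:
  assumes add: "\<And>f g. f \<in> hcar M \<Longrightarrow> g \<in> hcar M \<Longrightarrow> \<phi> (f + g) = \<phi> f + \<phi> g"
    and scale: "\<And>c f. f \<in> hcar M \<Longrightarrow> \<phi> (fscale c f) = c * \<phi> f"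
    and bound: "\<And>f. f \<in> hcar M \<Longrightarrow> cmod (\<phi> f) \<le> C * hnorm M f"
  shows "\<exists>g\<in>hcar M. \<forall>h\<in>hcar M. \<phi> h = hip M h g"
proof -
  define Q where "Q g = (hnorm M g)\<^sup>2 - 2 * Re (\<phi> g)" for g
  have Qbd: "- C\<^sup>2 \<le> Q g" if "g \<in> hcar M" for g
  proof -
    have "Re (\<phi> g) \<le> C * hnorm M g" using bound[OF that] complex_Re_le_cmod order_trans by blast
    moreover have "0 \<le> (hnorm M g - C)\<^sup>2" by simp
    ultimately show ?thesis unfolding Q_def power2_diff by (simp add: algebra_simps)
  qed
  define I where "I = Inf (Q ` hcar M)"
  have bdd: "bdd_below (Q ` hcar M)" using Qbd by (intro bdd_belowI[of _ "- C\<^sup>2"]) auto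
  have IQ: "I \<le> Q g" if "g \<in> hcar M" for g
    unfolding I_def using bdd that by (intro cInf_lower) auto
  have "\<exists>g\<in>hcar M. Q g < I + 1 / real (Suc n)" for n
  proof -
    have "Inf (Q ` hcar M) < I + 1 / real (Suc n)" by (simp add: I_def)
    from cInf_lessD[OF _ this] show ?thesis using zero_mem by blast
  qed
  then obtain X where X: "\<And>n. X n \<in> hcar M" "\<And>n. Q (X n) < I + 1 / real (Suc n)" by metis
  \<comment> \<open>The midpoint of two almost minimizers is no better than the infimum; the parallelogram law turns this into a bound on their distance.\<close>
  have near: "(hnorm M (X m - X n))\<^sup>2 \<le> 2 / real (Suc m) + 2 / real (Suc n)" for m n
  proof -
    let ?h = "fscale (1/2) (X m + X n)"
    have "I \<le> Q ?h" using IQ X(1) by simp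
    also have "Q ?h = (hnorm M (X m + X n))\<^sup>2 / 4 - Re (\<phi> (X m)) - Re (\<phi> (X n))"
    proof -
      have "hnorm M ?h = hnorm M (X m + X n) / 2" "\<phi> ?h = (\<phi> (X m) + \<phi> (X n)) / 2"
        using X(1) by (simp_all add: hnorm_scale scale add)
      then show ?thesis by (simp only: Q_def) (simp add: power_divide add_divide_distrib)
    qed
    finally have "4 * I \<le> (hnorm M (X m + X n))\<^sup>2 - 4 * Re (\<phi> (X m)) - 4 * Re (\<phi> (X n))" by simp
    then show ?thesis
      using X(2)[of m] X(2)[of n] hnorm_add_sq[OF X(1) X(1), of m n] hnorm_diff_sq[OF X(1) X(1), of m n]
      by (simp add: Q_def)
  qed
  obtain g where g: "g \<in> hcar M" "(\<lambda>n. hnorm M (X n - g)) \<longlonglongrightarrow> 0"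
  proof (rule complete[of X])
    fix e :: real assume e: "e > 0"
    obtain N where N: "4 / e\<^sup>2 < real N" using reals_Archimedean2 by blast
    have "hnorm M (X m - X n) < e" if "m \<ge> N" "n \<ge> N" for m n
    proof (rule power2_less_imp_less)
      have N0: "real N > 0" using N e by (meson dual_order.strict_trans zero_less_divide_iff zero_less_numeral zero_less_power)
      have "(hnorm M (X m - X n))\<^sup>2 \<le> 2 / real (Suc m) + 2 / real (Suc n)" by (rule near)
      also have "\<dots> \<le> 2 / real N + 2 / real N"
        using that N0 by (intro add_mono divide_left_mono) auto
      also have "\<dots> < e\<^sup>2" using N N0 e by (simp add: field_simps)
      finally show "(hnorm M (X m - X n))\<^sup>2 < e\<^sup>2" .
    qed (use e in simp)
    then show "\<exists>N. \<forall>m\<ge>N. \<forall>n\<ge>N. hnorm M (X m - X n) < e" by blast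
  qed (use X in auto)
  have Re: "Re (hip M u g) = Re (\<phi> u)" if u: "u \<in> hcar M" for u
  proof -
    define A where "A = (hnorm M u)\<^sup>2"
    define B where "B = Re (hip M u g) - Re (\<phi> u)"
    have quad: "0 \<le> t\<^sup>2 * A + 2 * t * B" for t :: real
    proof (rule tendsto_le[OF _ _ tendsto_const])
      let ?f = "\<lambda>n. t\<^sup>2 * A + 2 * t * (Re (hip M u (X n)) - Re (\<phi> u)) + 1 / real (Suc n)"
      have "(\<lambda>n. t\<^sup>2 * A + 2 * t * (Re (hip M u (X n)) - Re (\<phi> u)) + inverse (real (Suc n)))
          \<longlonglongrightarrow> t\<^sup>2 * A + 2 * t * (Re (hip M u g) - Re (\<phi> u)) + 0"
        by (intro tendsto_intros tendsto_hip_right g u LIMSEQ_inverse_real_of_nat) (simp add: X)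
      then show "?f \<longlonglongrightarrow> t\<^sup>2 * A + 2 * t * B" by (simp add: B_def inverse_eq_divide)
      have "0 \<le> ?f n" for n
      proof -
        let ?h = "X n + fscale (of_real t) u"
        have "Re (hip M u (X n)) = Re (hip M (X n) u)"
          using arg_cong[OF hip_cnj[OF u X(1)], of Re n] by simp
        then have "Q ?h = Q (X n) + t\<^sup>2 * A + 2 * t * (Re (hip M u (X n)) - Re (\<phi> u))"
          using X(1) u by (simp add: Q_def hnorm_add_sq hnorm_scale add scale hip_scale_right A_def
              power_mult_distrib algebra_simps)
        moreover have "I \<le> Q ?h" using IQ X(1) u by simp
        ultimately show ?thesis using X(2)[of n] by linarith
      qed
      then show "\<forall>\<^sub>F n in sequentially. 0 \<le> ?f n" by simp
    qed auto
    have A: "A \<ge> 0" by (simp add: A_def)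
    \<comment> \<open>A quadratic in \<open>t\<close> that is nonnegative and vanishes at \<open>0\<close> has no linear term; this \<open>t\<close> exhibits it.\<close>
    have "0 \<le> (- B / (A + 1))\<^sup>2 * A + 2 * (- B / (A + 1)) * B" by (rule quad)
    also have "\<dots> = - (B\<^sup>2 * (A + 2)) / (A + 1)\<^sup>2"
      using A by (simp add: divide_simps power2_eq_square) (simp add: algebra_simps)
    finally have "B\<^sup>2 * (A + 2) \<le> 0" using A by (simp add: divide_le_0_iff)
    then have "B = 0" using A by (smt (verit) mult_pos_pos zero_less_power2)
    then show ?thesis by (simp add: B_def)
  qed
  have "\<phi> h = hip M h g" if h: "h \<in> hcar M" for h
  proof -
    \<comment> \<open>Real parts at \<open>\<i>h\<close> are imaginary parts at \<open>h\<close>, up to sign.\<close>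
    have "Re (hip M (fscale \<i> h) g) = Re (\<phi> (fscale \<i> h))" using Re h by simp
    then have "Im (hip M h g) = Im (\<phi> h)" using h g by (simp add: hip_scale_left scale)
    then show ?thesis using Re[OF h] by (simp add: complex_eq_iff)
  qed
  then show ?thesis using g(1) by blast
qed

lemma closed_subspace_hilbert:
  assumes "cfun.subspace N" "N \<subseteq> hcar M"
    and closed: "\<And>X h. (\<And>n::nat. X n \<in> N) \<Longrightarrow> h \<in> hcar M \<Longrightarrow> (\<lambda>n. hnorm M (X n - h)) \<longlonglongrightarrow> 0 \<Longrightarrow> h \<in> N"
  shows "hilbert_space (M\<lparr>hcar := N\<rparr>)"
proof -
  have n: "hnorm (M\<lparr>hcar := N\<rparr>) = hnorm M" by (simp add: hnorm_def fun_eq_iff)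
  have c: "\<exists>h\<in>N. (\<lambda>n. hnorm M (X n - h)) \<longlonglongrightarrow> 0"
    if "\<And>n. X n \<in> N" "\<And>e. e > 0 \<Longrightarrow> \<exists>N. \<forall>m\<ge>N. \<forall>n\<ge>N. hnorm M (X m - X n) < e" for X
    using complete[of X] closed[of X] that assms(2) by (metis in_mono)
  show ?thesis
    unfolding hilbert_space_def n
    using assms(1) hip_pos hip_add_left hip_scale_left hip_cnj assms(2) c
    by (auto simp: subset_iff)
qed

text \<open>
  The projection of \<open>h\<close> is the vector that represents \<open>n \<mapsto> \<langle>n, h\<rangle>\<close> in the Hilbert space \<open>N\<close>.
\<close>

lemma projection:
  assumes "hilbert_space (M\<lparr>hcar := N\<rparr>)" "N \<subseteq> hcar M" "h \<in> hcar M"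
  shows "\<exists>g\<in>N. \<forall>n\<in>N. hip M (h - g) n = 0"
proof -
  interpret N: hilbert "M\<lparr>hcar := N\<rparr>" by unfold_locales (rule assms(1))
  have hn: "hnorm (M\<lparr>hcar := N\<rparr>) = hnorm M" by (simp add: hnorm_def fun_eq_iff)
  have "\<exists>g\<in>hcar (M\<lparr>hcar := N\<rparr>). \<forall>n\<in>hcar (M\<lparr>hcar := N\<rparr>). hip M n h = hip (M\<lparr>hcar := N\<rparr>) n g"
    by (rule N.riesz[where C = "hnorm M h"])
      (use assms(2,3) cauchy_schwarz in \<open>auto simp: hn hip_add_left hip_scale_left subset_iff mult.commute\<close>)
  then obtain g where g: "g \<in> N" "\<And>n. n \<in> N \<Longrightarrow> hip M n h = hip M n g" by auto
  have "hip M (h - g) n = 0" if "n \<in> N" for n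
  proof -
    have "hip M n (h - g) = 0"
      using g that assms(2,3) by (auto simp: hip_diff_right subset_iff)
    then show ?thesis using hip_cnj[of n "h - g"] g that assms(2,3) by (auto simp: subset_iff)
  qed
  then show ?thesis using g(1) by blast
qed

lemma orthogonal_complement_hilbert:
  assumes "A \<subseteq> hcar M"
  shows "hilbert_space (M\<lparr>hcar := {h \<in> hcar M. \<forall>g\<in>A. hip M h g = 0}\<rparr>)"
proof (rule closed_subspace_hilbert)
  show "cfun.subspace {h \<in> hcar M. \<forall>g\<in>A. hip M h g = 0}"
    using assms by (auto simp: cfun.subspace_def hip_add_left hip_scale_left subset_iff)
  fix X h assume X: "\<And>n::nat. X n \<in> {h \<in> hcar M. \<forall>g\<in>A. hip M h g = 0}" and h: "h \<in> hcar M"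
    and lim: "(\<lambda>n. hnorm M (X n - h)) \<longlonglongrightarrow> 0"
  have "hip M h g = 0" if g: "g \<in> A" for g
  proof -
    have "(\<lambda>n. hip M (X n) g) \<longlonglongrightarrow> hip M h g"
      by (rule tendsto_hip_left[OF _ h _ lim]) (use X g assms in auto)
    moreover have "(\<lambda>n. hip M (X n) g) = (\<lambda>_. 0)" using X g by auto
    ultimately show ?thesis using LIMSEQ_unique tendsto_const by metis
  qed
  then show "h \<in> {h \<in> hcar M. \<forall>g\<in>A. hip M h g = 0}" using h by blast
qed auto

text \<open>
  A gliding hump argument.  If norms were unbounded, pick \<open>v\<^sub>n\<close> with \<open>\<parallel>v\<^sub>n\<parallel> > 4\<^sup>n\<close> and move from
  \<open>H\<^sub>n\<close> by a vector of norm \<open>3\<^sup>-\<^sup>n\<close> in the direction of \<open>v\<^sub>n\<close>, with the sign for which the pairing with \<open>v\<^sub>n\<close>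
  becomes at least \<open>3\<^sup>-\<^sup>n \<parallel>v\<^sub>n\<parallel>\<close>.  Later moves change this pairing by at most half of that, so at
  the limit the pairings grow like \<open>(4/3)\<^sup>n\<close>.
\<close>

lemma uniform_boundedness:
  assumes V: "V \<subseteq> hcar M" and ptw: "\<And>h. h \<in> hcar M \<Longrightarrow> \<exists>C. \<forall>v\<in>V. cmod (hip M v h) \<le> C"
  shows "\<exists>C. \<forall>v\<in>V. hnorm M v \<le> C"
proof (rule ccontr)
  assume "\<not> ?thesis"
  then have "\<forall>n. \<exists>v\<in>V. hnorm M v > 4 ^ n" by (meson linorder_not_le)
  then obtain v where v: "\<And>n. v n \<in> V" "\<And>n. hnorm M (v n) > 4 ^ n" by metis
  have vM: "v n \<in> hcar M" for n using v(1) V by blast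
  have vpos: "hnorm M (v n) > 0" for n using v(2)[of n] by (smt (verit) zero_less_power)
  define u where "u n = fscale (of_real (1 / 3 ^ n / hnorm M (v n))) (v n)" for n
  have uM: "u n \<in> hcar M" for n using vM by (simp add: u_def)
  have un: "hnorm M (u n) = 1 / 3 ^ n" for n
    unfolding u_def hnorm_scale[OF vM] norm_of_real using vpos[of n] by simp
  have vu: "hip M (v n) (u n) = of_real (hnorm M (v n) / 3 ^ n)" for n
    unfolding u_def hip_scale_right[OF vM vM] hip_self[OF vM]
    using vpos[of n] by (simp add: power2_eq_square)
  have ex: "\<exists>h'. (h' = h + u n \<or> h' = h - u n) \<and> cmod (hip M (v n) h') \<ge> hnorm M (v n) / 3 ^ n"
    if "h \<in> hcar M" for h n
  proof -
    define a where "a = hip M (v n) h"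
    define r where "r = hip M (v n) (u n)"
    have "2 * r = (a + r) - (a - r)" by simp
    then have "2 * cmod r \<le> cmod (a + r) + cmod (a - r)"
      by (metis norm_mult norm_numeral norm_triangle_ineq4)
    then have "cmod (a + r) \<ge> cmod r \<or> cmod (a - r) \<ge> cmod r" by linarith
    moreover have "cmod r = hnorm M (v n) / 3 ^ n"
      unfolding r_def vu norm_of_real using vpos[of n] by simp
    moreover have "hip M (v n) (h + u n) = a + r" "hip M (v n) (h - u n) = a - r"
      using that uM vM by (simp_all add: hip_add_right hip_diff_right a_def r_def)
    ultimately show ?thesis by metis
  qed
  define next_h where "next_h n h = (SOME h'. (h' = h + u n \<or> h' = h - u n) \<and>
      cmod (hip M (v n) h') \<ge> hnorm M (v n) / 3 ^ n)" for n h
  have nx: "(next_h n h = h + u n \<or> next_h n h = h - u n)"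
    "cmod (hip M (v n) (next_h n h)) \<ge> hnorm M (v n) / 3 ^ n" if "h \<in> hcar M" for h n
    using someI_ex[OF ex[OF that, of n]] unfolding next_h_def by blast+
  define H where "H = rec_nat 0 next_h"
  have HS: "H (Suc n) = next_h n (H n)" for n by (simp add: H_def)
  have HM: "H n \<in> hcar M" for n
  proof (induction n)
    case 0
    have "H 0 = 0" by (simp add: H_def)
    then show ?case using zero_mem by metis
  next
    case (Suc n)
    then show ?case using nx(1)[OF Suc, of n] uM by (metis HS add_mem diff_mem)
  qed
  have Hstep: "hnorm M (H (Suc n) - H n) = 1 / 3 ^ n" for n
    using nx(1)[OF HM, of n n] un uM hnorm_minus[OF uM] by (auto simp: HS)
  define \<delta> where "\<delta> m n = hnorm M (H m - H n)" for m n
  have Hdist: "\<delta> (n + k) n \<le> (3/2) * (1 / 3 ^ n - 1 / 3 ^ (n + k))" for n k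
  proof (induction k)
    case 0
    have "H n - H n = 0" by simp
    then have "\<delta> n n = 0" unfolding \<delta>_def by (simp only: hnorm_zero)
    then show ?case by simp
  next
    case (Suc k)
    have "\<delta> (n + Suc k) n \<le> \<delta> (Suc (n + k)) (n + k) + \<delta> (n + k) n"
      using hnorm_triangle_diff[OF HM HM HM] by (simp add: \<delta>_def)
    also have "\<dots> \<le> 1 / 3 ^ (n + k) + (3/2) * (1 / 3 ^ n - 1 / 3 ^ (n + k))"
      using Hstep[of "n + k"] Suc by (simp add: \<delta>_def)
    finally show ?case by (simp add: field_simps)
  qed
  have Hdist': "hnorm M (H m - H n) \<le> (3/2) / 3 ^ n" if "n \<le> m" for m n
  proof -
    have "\<delta> (n + (m - n)) n \<le> (3/2) * (1 / 3 ^ n)"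
      by (rule order_trans[OF Hdist]) simp
    then show ?thesis using that by (simp add: \<delta>_def)
  qed
  obtain h where h: "h \<in> hcar M" "(\<lambda>n. hnorm M (H n - h)) \<longlonglongrightarrow> 0"
  proof (rule complete[of H])
    fix e :: real assume e: "e > 0"
    have "(\<lambda>n. (3/2) * (1/3) ^ n) \<longlonglongrightarrow> (3/2) * (0::real)"
      by (intro tendsto_intros LIMSEQ_power_zero) simp
    then have "\<forall>\<^sub>F n in sequentially. (3/2) * (1/3) ^ n < e"
      using e by (intro order_tendstoD) simp_all
    then obtain N where N: "(3/2) * (1/3) ^ N < e" by (meson eventually_sequentially order_refl)
    have *: "hnorm M (H m - H n) < e" if "N \<le> n" "n \<le> m" for m n
    proof -
      have "hnorm M (H m - H n) \<le> (3/2) * (1/3) ^ n" using Hdist'[OF that(2)] by (simp add: power_one_over)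
      also have "\<dots> \<le> (3/2) * (1/3) ^ N" using that(1) by (intro mult_left_mono power_decreasing) auto
      finally show ?thesis using N by simp
    qed
    show "\<exists>N. \<forall>m\<ge>N. \<forall>n\<ge>N. hnorm M (H m - H n) < e"
      by (metis "*" HM hnorm_minus_commute linorder_linear)
  qed (use HM in auto)
  have hdist: "hnorm M (h - H n) \<le> (3/2) / 3 ^ n" for n
  proof (rule tendsto_le[OF _ tendsto_const])
    have "(\<lambda>m. hnorm M ((H m - H n) - (h - H n))) \<longlonglongrightarrow> 0" using h(2) by simp
    then show "(\<lambda>m. hnorm M (H m - H n)) \<longlonglongrightarrow> hnorm M (h - H n)"
      by (intro tendsto_hnorm) (use HM h in auto)
    show "\<forall>\<^sub>F m in sequentially. hnorm M (H m - H n) \<le> (3/2) / 3 ^ n"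
      using Hdist' by (intro eventually_sequentiallyI)
  qed simp
  obtain C where C: "\<And>w. w \<in> V \<Longrightarrow> cmod (hip M w h) \<le> C" using ptw[OF h(1)] by blast
  have "(4/3) ^ n / 2 \<le> C" for n
  proof -
    have "hip M (v n) h = hip M (v n) (H (Suc n)) + hip M (v n) (h - H (Suc n))"
      using vM HM h by (simp add: hip_diff_right)
    then have "cmod (hip M (v n) (H (Suc n))) \<le> cmod (hip M (v n) h) + cmod (hip M (v n) (h - H (Suc n)))"
      by (metis add_diff_cancel_right' norm_triangle_ineq4)
    moreover have "cmod (hip M (v n) (h - H (Suc n))) \<le> hnorm M (v n) * ((3/2) / 3 ^ Suc n)"
      using cauchy_schwarz[of "v n" "h - H (Suc n)"] hdist[of "Suc n"] vM HM h vpos[of n]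
      by (smt (verit) diff_mem mult_left_mono)
    moreover have "cmod (hip M (v n) (H (Suc n))) \<ge> hnorm M (v n) / 3 ^ n"
      using nx(2)[OF HM] by (simp add: HS)
    ultimately have le: "hnorm M (v n) / 3 ^ n / 2 \<le> C"
      using C[OF v(1)[of n]] by simp
    have "(4/3) ^ n \<le> hnorm M (v n) / 3 ^ n"
      using v(2)[of n] by (simp add: power_divide divide_right_mono)
    then have "(4/3) ^ n / 2 \<le> hnorm M (v n) / 3 ^ n / 2" by (intro divide_right_mono) simp_all
    then show ?thesis using le by (rule order_trans)
  qed
  moreover obtain n where "2 * C < (4/3) ^ n" using real_arch_pow[of "4/3" "2 * C"] by auto
  ultimately show False by (smt (verit) field_sum_of_halves)
qed

end

section \<open>Norm derivatives of weakly holomorphic curves\<close>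

context hilbert
begin

definition has_norm_derivative :: "(complex \<Rightarrow> 'a \<Rightarrow> complex^'r) \<Rightarrow> ('a \<Rightarrow> complex^'r) \<Rightarrow> bool" where
  "has_norm_derivative X x' \<longleftrightarrow> x' \<in> hcar M \<and>
     ((\<lambda>t. hnorm M (fscale (1 / t) (X t - X 0) - x')) \<longlongrightarrow> 0) (at 0)"

text \<open>
  For each \<open>h\<close>, the difference quotients of \<open>\<langle>X(t), h\<rangle>\<close> at \<open>s\<close> and \<open>t\<close> differ by at most
  \<open>K\<^sub>h (|s| + |t|)\<close>.  The uniform boundedness principle, applied to the differences of two such
  quotients of \<open>X\<close>, divided by \<open>|s| + |t|\<close>, makes the constant independent of \<open>h\<close>, which is a Cauchy condition in norm.
\<close>

lemma weakly_holomorphic_norm_differentiable: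
  assumes R: "R > 0" and mem: "\<And>t. t \<in> ball 0 R \<Longrightarrow> X t \<in> hcar M"
    and hol: "\<And>h. h \<in> hcar M \<Longrightarrow> (\<lambda>t. hip M (X t) h) holomorphic_on ball 0 R"
  shows "\<exists>x'. has_norm_derivative X x'"
proof -
  define r where "r = R / 2"
  have r: "r > 0" using R by (simp add: r_def)
  define q where "q t = fscale (1 / t) (X t - X 0)" for t
  have tR: "t \<in> ball 0 R" if "cmod t \<le> r" for t using that R by (simp add: r_def)
  have X0: "X 0 \<in> hcar M" using mem R by simp
  have qM: "q t \<in> hcar M" if "cmod t \<le> r" for t
    using mem[OF tR[OF that]] X0 by (simp add: q_def)
  have hipq: "hip M (q t) h = (hip M (X t) h - hip M (X 0) h) / t" if "cmod t \<le> r" "h \<in> hcar M" for t h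
    using mem[OF tR[OF that(1)]] X0 that(2) by (simp add: q_def hip_scale_left hip_diff_left)
  define V where "V = {v. \<exists>s t. 0 < cmod s \<and> cmod s \<le> r/2 \<and> 0 < cmod t \<and> cmod t \<le> r/2 \<and>
      v = fscale (of_real (1 / (cmod s + cmod t))) (q s - q t)}"
  have "\<exists>C. \<forall>v\<in>V. cmod (hip M v h) \<le> C" if h: "h \<in> hcar M" for h
  proof -
    define u where "u t = hip M (X t) h" for t
    have uh: "u holomorphic_on ball 0 R" using hol[OF h] by (simp add: u_def[abs_def])
    have "compact (u ` cball 0 r)"
      by (intro compact_continuous_image continuous_on_subset[OF holomorphic_on_imp_continuous_on[OF uh]])
        (use tR in auto)
    then obtain B where B: "\<forall>y\<in>u ` cball 0 r. cmod y \<le> B"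
      using compact_imp_bounded bounded_iff by metis
    define K where "K = 32 * (B + 1) / r^2"
    have est: "cmod ((u t - u 0) / t - deriv u 0) \<le> K * cmod t" if "0 < cmod t" "cmod t \<le> r/2" for t
      unfolding K_def
    proof (rule difference_quotient_estimate[OF _ r _ that])
      show "u holomorphic_on ball 0 r" by (rule holomorphic_on_subset[OF uh]) (use R in \<open>auto simp: r_def\<close>)
      show "\<And>t. t \<in> ball 0 r \<Longrightarrow> cmod (u t) \<le> B" using B by auto
    qed
    have "cmod (hip M v h) \<le> K" if vV: "v \<in> V" for v
    proof -
      obtain s t where st: "0 < cmod s" "cmod s \<le> r/2" "0 < cmod t" "cmod t \<le> r/2"
        and v: "v = fscale (of_real (1 / (cmod s + cmod t))) (q s - q t)"
        using vV unfolding V_def by blast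
      have st': "cmod s \<le> r" "cmod t \<le> r" using st r by linarith+
      have "hip M v h = of_real (1 / (cmod s + cmod t)) * (hip M (q s) h - hip M (q t) h)"
        unfolding v using qM st' h by (simp add: hip_scale_left hip_diff_left)
      then have "cmod (hip M v h) = 1 / (cmod s + cmod t) * cmod (hip M (q s) h - hip M (q t) h)"
        using st by (simp only: norm_mult norm_of_real abs_of_pos add_pos_pos zero_less_divide_1_iff)
      moreover have "cmod (hip M (q s) h - hip M (q t) h) \<le> K * (cmod s + cmod t)"
      proof -
        have "hip M (q s) h - hip M (q t) h =
            ((u s - u 0) / s - deriv u 0) - ((u t - u 0) / t - deriv u 0)"
          using hipq st' h by (simp add: u_def)
        then have "cmod (hip M (q s) h - hip M (q t) h) \<le>
            cmod ((u s - u 0) / s - deriv u 0) + cmod ((u t - u 0) / t - deriv u 0)"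
          by (metis norm_triangle_ineq4)
        then show ?thesis using est[OF st(1,2)] est[OF st(3,4)] by (simp add: distrib_left)
      qed
      ultimately show ?thesis using st by (simp add: pos_divide_le_eq add_pos_pos)
    qed
    then show ?thesis by blast
  qed
  moreover have "V \<subseteq> hcar M"
  proof
    fix v assume "v \<in> V"
    then obtain s t where "cmod s \<le> r/2" "cmod t \<le> r/2"
      and v: "v = fscale (of_real (1 / (cmod s + cmod t))) (q s - q t)"
      unfolding V_def by blast
    then have "cmod s \<le> r" "cmod t \<le> r" using r by linarith+
    then show "v \<in> hcar M" unfolding v by (intro scale_mem diff_mem qM)
  qed
  ultimately have "\<exists>C. \<forall>v\<in>V. hnorm M v \<le> C" by (intro uniform_boundedness)
  then obtain K where K: "\<And>v. v \<in> V \<Longrightarrow> hnorm M v \<le> K" by blast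
  have lip: "hnorm M (q s - q t) \<le> K * (cmod s + cmod t)"
    if "0 < cmod s" "cmod s \<le> r/2" "0 < cmod t" "cmod t \<le> r/2" for s t
  proof -
    have "cmod s \<le> r" "cmod t \<le> r" using that r by linarith+
    then have m: "q s - q t \<in> hcar M" using qM by simp
    have "fscale (of_real (1 / (cmod s + cmod t))) (q s - q t) \<in> V"
      unfolding V_def using that by blast
    from K[OF this] have "cmod (of_real (1 / (cmod s + cmod t))) * hnorm M (q s - q t) \<le> K"
      unfolding hnorm_scale[OF m] .
    then have "hnorm M (q s - q t) / (cmod s + cmod t) \<le> K"
      using that by (simp only: norm_of_real abs_of_pos add_pos_pos zero_less_divide_1_iff) simp
    then show ?thesis using that by (simp add: pos_divide_le_eq add_pos_pos)
  qed
  \<comment> \<open>The limit is taken along one null sequence; \<open>lip\<close> then extends it to the full filter.\<close>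
  define \<tau> where "\<tau> n = complex_of_real (r / 2 / Suc n)" for n
  have \<tau>c: "cmod (\<tau> n) = r / 2 * inverse (real (Suc n))" for n
    unfolding \<tau>_def norm_of_real using r by (simp add: field_simps)
  have \<tau>: "0 < cmod (\<tau> n)" "cmod (\<tau> n) \<le> r/2" for n
    unfolding \<tau>c using r by (auto simp: field_simps)
  have \<tau>lim: "(\<lambda>n. cmod (\<tau> n)) \<longlonglongrightarrow> 0"
    unfolding \<tau>c using tendsto_mult_left[OF LIMSEQ_inverse_real_of_nat, of "r/2"] by simp
  have \<tau>r: "cmod (\<tau> n) \<le> r" for n using \<tau>(2)[of n] r by linarith
  define K' where "K' = \<bar>K\<bar> + 1"
  have K': "K' > 0" "K \<le> K'" by (auto simp: K'_def)
  obtain x' where x': "x' \<in> hcar M" "(\<lambda>n. hnorm M (q (\<tau> n) - x')) \<longlonglongrightarrow> 0"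
  proof (rule complete[of "\<lambda>n. q (\<tau> n)"])
    fix e :: real assume e: "e > 0"
    have "\<forall>\<^sub>F n in sequentially. cmod (\<tau> n) < e / (2 * K')"
      using e K' by (intro order_tendstoD(2)[OF \<tau>lim]) simp
    then obtain N where N: "\<And>n. n \<ge> N \<Longrightarrow> cmod (\<tau> n) < e / (2 * K')"
      unfolding eventually_sequentially by blast
    have "hnorm M (q (\<tau> m) - q (\<tau> n)) < e" if "m \<ge> N" "n \<ge> N" for m n
    proof -
      have "hnorm M (q (\<tau> m) - q (\<tau> n)) \<le> K * (cmod (\<tau> m) + cmod (\<tau> n))"
        using lip \<tau> by blast
      also have "\<dots> \<le> K' * (cmod (\<tau> m) + cmod (\<tau> n))"
        using K' by (intro mult_right_mono) auto
      also have "\<dots> < K' * (e / (2 * K') + e / (2 * K'))"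
        using K' N that by (intro mult_strict_left_mono add_strict_mono) auto
      finally show ?thesis using K' by (simp add: field_simps)
    qed
    then show "\<exists>N. \<forall>m\<ge>N. \<forall>n\<ge>N. hnorm M (q (\<tau> m) - q (\<tau> n)) < e" by blast
  qed (use qM \<tau>r in auto)
  have bd: "hnorm M (q t - x') \<le> K * cmod t" if t: "0 < cmod t" "cmod t \<le> r/2" for t
  proof (rule tendsto_le[OF _ _ tendsto_const])
    have tr: "cmod t \<le> r" using t r by linarith
    have "(\<lambda>n. K * (cmod t + cmod (\<tau> n)) + hnorm M (q (\<tau> n) - x')) \<longlonglongrightarrow> K * (cmod t + 0) + 0"
      by (intro tendsto_intros \<tau>lim x')
    then show "(\<lambda>n. K * (cmod t + cmod (\<tau> n)) + hnorm M (q (\<tau> n) - x')) \<longlonglongrightarrow> K * cmod t" by simp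
    have "hnorm M (q t - x') \<le> K * (cmod t + cmod (\<tau> n)) + hnorm M (q (\<tau> n) - x')" for n
      using hnorm_triangle_diff[OF qM[OF tr] qM[OF \<tau>r] x'(1), of n] lip[OF t \<tau>, of n] by linarith
    then show "\<forall>\<^sub>F n in sequentially. hnorm M (q t - x') \<le>
        K * (cmod t + cmod (\<tau> n)) + hnorm M (q (\<tau> n) - x')" by simp
  qed simp
  have ev: "\<forall>\<^sub>F t in at 0. 0 < cmod t \<and> cmod t \<le> r/2"
    unfolding eventually_at using r by (intro exI[of _ "r/2"]) auto
  have "((\<lambda>t. hnorm M (q t - x')) \<longlongrightarrow> 0) (at 0)"
  proof (rule tendsto_sandwich[OF _ _ tendsto_const])
    show "\<forall>\<^sub>F t in at 0. 0 \<le> hnorm M (q t - x')"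
      using ev
    proof (rule eventually_mono)
      fix t assume "0 < cmod t \<and> cmod t \<le> r/2"
      then have "cmod t \<le> r" using r by linarith
      then show "0 \<le> hnorm M (q t - x')" using qM x' by (intro hnorm_ge_0 diff_mem) auto
    qed
    show "\<forall>\<^sub>F t in at 0. hnorm M (q t - x') \<le> K * cmod t"
      using ev by (rule eventually_mono) (use bd in blast)
    have "((\<lambda>t. K * cmod t) \<longlongrightarrow> K * cmod 0) (at (0::complex))" by (intro tendsto_intros)
    then show "((\<lambda>t. K * cmod t) \<longlongrightarrow> 0) (at (0::complex))" by simp
  qed
  then show ?thesis unfolding has_norm_derivative_def q_def using x' by blast
qed

lemma norm_derivative_hip:
  assumes "has_norm_derivative X x'" "\<forall>\<^sub>F t in at 0. X t \<in> hcar M" "X 0 \<in> hcar M" "h \<in> hcar M"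
  shows "((\<lambda>t. hip M (X t) h) has_field_derivative hip M x' h) (at 0)"
proof -
  have "((\<lambda>t. hip M (fscale (1 / t) (X t - X 0)) h) \<longlongrightarrow> hip M x' h) (at 0)"
  proof (rule tendsto_hip_left)
    show "\<forall>\<^sub>F t in at 0. fscale (1 / t) (X t - X 0) \<in> hcar M"
      using assms(2) by (rule eventually_mono) (simp add: assms(3))
  qed (use assms in \<open>auto simp: has_norm_derivative_def\<close>)
  moreover have "\<forall>\<^sub>F t in at 0. hip M (fscale (1 / t) (X t - X 0)) h = (hip M (X t) h - hip M (X 0) h) / t"
    using assms(2) by (rule eventually_mono) (simp add: assms(3,4) hip_scale_left hip_diff_left)
  ultimately have "((\<lambda>t. (hip M (X t) h - hip M (X 0) h) / t) \<longlongrightarrow> hip M x' h) (at 0)"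
    by (rule Lim_transform_eventually)
  then show ?thesis by (simp add: DERIV_def)
qed

lemma norm_derivative_unique:
  assumes "has_norm_derivative X x'" "has_norm_derivative X y'"
    "\<forall>\<^sub>F t in at 0. X t \<in> hcar M" "X 0 \<in> hcar M"
  shows "x' = y'"
proof -
  have m: "x' \<in> hcar M" "y' \<in> hcar M" using assms unfolding has_norm_derivative_def by auto
  then have "hip M x' (x' - y') = hip M y' (x' - y')"
    using norm_derivative_hip[OF assms(1,3,4)] norm_derivative_hip[OF assms(2,3,4)] DERIV_unique
    by (meson diff_mem)
  then have "hip M (x' - y') (x' - y') = 0" using m by (simp add: hip_diff_left)
  then show ?thesis using m by (intro eq_if_hip_diff_0)
qed

text \<open>
  The reparametrization \<open>\<sigma>\<close> is the identity for Wirtinger derivatives of Gramians and conjugation for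
  polarization.
\<close>

lemma hip_expansion:
  assumes x: "has_norm_derivative X x1" "\<forall>\<^sub>F t in at 0. X t \<in> hcar M" "X 0 \<in> hcar M"
    and y: "has_norm_derivative Y y1" "\<forall>\<^sub>F t in at 0. Y t \<in> hcar M" "Y 0 \<in> hcar M"
    and \<sigma>: "\<And>t. cmod (\<sigma> t) = cmod t"
  shows "((\<lambda>t. norm (hip M (X t) (Y (\<sigma> t)) - hip M (X 0) (Y 0)
      - (t * hip M x1 (Y 0) + cnj (\<sigma> t) * hip M (X 0) y1)) / norm t) \<longlongrightarrow> 0) (at 0)"
proof -
  define r where "r t = fscale (1 / t) (X t - X 0) - x1" for t
  define \<rho> where "\<rho> t = fscale (1 / t) (Y t - Y 0) - y1" for t
  have m: "x1 \<in> hcar M" "y1 \<in> hcar M" using x y unfolding has_norm_derivative_def by auto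
  have \<sigma>0: "filterlim \<sigma> (at 0) (at 0)"
  proof -
    have "((\<lambda>t. cmod (\<sigma> t)) \<longlongrightarrow> 0) (at 0)" unfolding \<sigma> by (rule tendsto_norm_zero) simp
    then have "(\<sigma> \<longlongrightarrow> 0) (at 0)" by (rule tendsto_norm_zero_cancel)
    moreover have "\<sigma> t \<noteq> 0" if "t \<noteq> 0" for t
      using \<sigma>[of t] that by (metis norm_eq_zero)
    then have "\<forall>\<^sub>F t in at 0. \<sigma> t \<noteq> 0"
      by (simp add: eventually_at_filter)
    ultimately show ?thesis by (simp add: filterlim_at)
  qed
  have rl: "((\<lambda>t. hnorm M (r t)) \<longlongrightarrow> 0) (at 0)"
    using x unfolding has_norm_derivative_def r_def by simp
  have "((\<lambda>t. hnorm M (\<rho> t)) \<longlongrightarrow> 0) (at 0)"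
    using y unfolding has_norm_derivative_def \<rho>_def by simp
  then have \<rho>l: "((\<lambda>t. hnorm M (\<rho> (\<sigma> t))) \<longlongrightarrow> 0) (at 0)"
    by (rule filterlim_compose[OF _ \<sigma>0])
  have evY: "\<forall>\<^sub>F t in at 0. Y (\<sigma> t) \<in> hcar M"
    using y(2) \<sigma>0 by (rule eventually_compose_filterlim)
  define E where "E t = hnorm M (X 0) * hnorm M (\<rho> (\<sigma> t)) + hnorm M (r t) * hnorm M (Y 0)
      + cmod t * ((hnorm M x1 + hnorm M (r t)) * (hnorm M y1 + hnorm M (\<rho> (\<sigma> t))))" for t
  have El: "(E \<longlongrightarrow> 0) (at 0)"
  proof -
    have "(E \<longlongrightarrow> hnorm M (X 0) * 0 + 0 * hnorm M (Y 0)
        + cmod 0 * ((hnorm M x1 + 0) * (hnorm M y1 + 0))) (at 0)"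
      unfolding E_def by (intro tendsto_intros rl \<rho>l)
    then show ?thesis by simp
  qed
  have ev: "\<forall>\<^sub>F t in at 0. norm (hip M (X t) (Y (\<sigma> t)) - hip M (X 0) (Y 0)
      - (t * hip M x1 (Y 0) + cnj (\<sigma> t) * hip M (X 0) y1)) / norm t \<le> E t"
    using x(2) evY eventually_at_ball'[OF zero_less_one, of 0 UNIV]
  proof eventually_elim
    case (elim t)
    then have t: "t \<noteq> 0" by simp
    then have s: "\<sigma> t \<noteq> 0" using \<sigma>[of t] by auto
    let ?s = "\<sigma> t"
    have rM: "r t \<in> hcar M" "\<rho> ?s \<in> hcar M" using elim x(3) y(3) m by (simp_all add: r_def \<rho>_def)
    have "fscale t (x1 + r t) = X t - X 0" using t by (simp add: r_def)
    then have X: "X t = X 0 + fscale t (x1 + r t)" by simp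
    have "fscale ?s (y1 + \<rho> ?s) = Y ?s - Y 0" using s by (simp add: \<rho>_def)
    then have Y: "Y ?s = Y 0 + fscale ?s (y1 + \<rho> ?s)" by simp
    let ?rem = "cnj ?s * hip M (X 0) (\<rho> ?s) + t * hip M (r t) (Y 0) + t * cnj ?s * hip M (x1 + r t) (y1 + \<rho> ?s)"
    have "hip M (X t) (Y ?s) = hip M (X 0) (Y 0) + cnj ?s * (hip M (X 0) y1 + hip M (X 0) (\<rho> ?s))
        + t * (hip M x1 (Y 0) + hip M (r t) (Y 0)) + t * cnj ?s * hip M (x1 + r t) (y1 + \<rho> ?s)"
      unfolding X Y using rM x(3) y(3) m
      by (simp add: hip_add_left hip_add_right hip_scale_left hip_scale_right algebra_simps)
    then have "hip M (X t) (Y ?s) - hip M (X 0) (Y 0) - (t * hip M x1 (Y 0) + cnj ?s * hip M (X 0) y1) = ?rem"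
      by (simp add: algebra_simps)
    moreover have "cmod ?rem \<le> cmod t * E t"
    proof -
      have "cmod ?rem \<le> cmod t * cmod (hip M (X 0) (\<rho> ?s)) + cmod t * cmod (hip M (r t) (Y 0))
          + cmod t * cmod t * cmod (hip M (x1 + r t) (y1 + \<rho> ?s))"
        by (intro norm_triangle_mono) (simp_all add: norm_mult \<sigma>)
      also have "\<dots> \<le> cmod t * (hnorm M (X 0) * hnorm M (\<rho> ?s)) + cmod t * (hnorm M (r t) * hnorm M (Y 0))
          + cmod t * cmod t * ((hnorm M x1 + hnorm M (r t)) * (hnorm M y1 + hnorm M (\<rho> ?s)))"
      proof (intro add_mono mult_left_mono cauchy_schwarz)
        have "cmod (hip M (x1 + r t) (y1 + \<rho> ?s)) \<le> hnorm M (x1 + r t) * hnorm M (y1 + \<rho> ?s)"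
          using rM m by (intro cauchy_schwarz) auto
        also have "\<dots> \<le> (hnorm M x1 + hnorm M (r t)) * (hnorm M y1 + hnorm M (\<rho> ?s))"
          using rM m by (intro mult_mono hnorm_triangle add_nonneg_nonneg hnorm_ge_0) auto
        finally show "cmod (hip M (x1 + r t) (y1 + \<rho> ?s)) \<le> \<dots>" .
      qed (use rM x(3) y(3) in auto)
      finally show ?thesis by (simp add: E_def algebra_simps)
    qed
    ultimately show ?case using t by (simp add: pos_divide_le_eq mult.commute)
  qed
  show ?thesis
    by (rule tendsto_sandwich[OF _ ev tendsto_const El]) simp
qed

lemma hip_has_derivative:
  assumes x: "has_norm_derivative X x1" "\<forall>\<^sub>F t in at 0. X t \<in> hcar M" "X 0 \<in> hcar M"
    and y: "has_norm_derivative Y y1" "\<forall>\<^sub>F t in at 0. Y t \<in> hcar M" "Y 0 \<in> hcar M"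
  shows "((\<lambda>t. hip M (X t) (Y t)) has_derivative (\<lambda>t. t * hip M x1 (Y 0) + cnj t * hip M (X 0) y1)) (at 0)"
  unfolding has_derivative_at
proof
  show "bounded_linear (\<lambda>t. t * hip M x1 (Y 0) + cnj t * hip M (X 0) y1)"
    by (intro bounded_linear_add bounded_linear_mult_const bounded_linear_cnj bounded_linear_ident)
  show "(\<lambda>h. norm (hip M (X (0 + h)) (Y (0 + h)) - hip M (X 0) (Y 0)
      - (h * hip M x1 (Y 0) + cnj h * hip M (X 0) y1)) / norm h) \<midarrow>0\<rightarrow> 0"
    using hip_expansion[OF x y, of "\<lambda>t. t"] by simp
qed

lemma hip_sesqui_field_derivative:
  assumes x: "has_norm_derivative X x1" "\<forall>\<^sub>F t in at 0. X t \<in> hcar M" "X 0 \<in> hcar M"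
    and y: "has_norm_derivative Y y1" "\<forall>\<^sub>F t in at 0. Y t \<in> hcar M" "Y 0 \<in> hcar M"
  shows "((\<lambda>t. hip M (X t) (Y (cnj t))) has_field_derivative hip M x1 (Y 0) + hip M (X 0) y1) (at 0)"
  unfolding has_field_derivative_def has_derivative_at
proof
  show "bounded_linear ((*) (hip M x1 (Y 0) + hip M (X 0) y1))"
    by (rule bounded_linear_mult_right)
  show "(\<lambda>h. norm (hip M (X (0 + h)) (Y (cnj (0 + h))) - hip M (X 0) (Y (cnj 0))
      - (hip M x1 (Y 0) + hip M (X 0) y1) * h) / norm h) \<midarrow>0\<rightarrow> 0"
    using hip_expansion[OF x y, of cnj] by (simp add: algebra_simps)
qed

end

section \<open>Unitaries between spaces with equal Gramians\<close>

text \<open>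
  Corresponding linear combinations of the families \<open>v\<close> and \<open>v'\<close>: the graph of the map
  \<open>v x \<mapsto> v' x\<close>, which is not yet known to be well defined.
\<close>

inductive paired :: "'x set \<Rightarrow> ('x \<Rightarrow> ('a \<Rightarrow> complex^'r)) \<Rightarrow> ('x \<Rightarrow> ('b \<Rightarrow> complex^'s)) \<Rightarrow>
    ('a \<Rightarrow> complex^'r) \<Rightarrow> ('b \<Rightarrow> complex^'s) \<Rightarrow> bool"
  for I v v' where
    zero: "paired I v v' 0 0"
  | step: "paired I v v' u u' \<Longrightarrow> x \<in> I \<Longrightarrow> paired I v v' (u + fscale c (v x)) (u' + fscale c (v' x))"

lemma paired_add: "paired I v v' u u' \<Longrightarrow> paired I v v' w w' \<Longrightarrow> paired I v v' (w + u) (w' + u')"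
  by (induction rule: paired.induct) (auto simp: add.assoc[symmetric] intro: paired.step)

lemma paired_scale: "paired I v v' u u' \<Longrightarrow> paired I v v' (fscale a u) (fscale a u')"
proof (induction rule: paired.induct)
  case (step u u' x c)
  then show ?case using paired.step[OF step(3,2), of "a * c"] by (simp add: cfun.scale_right_distrib del: plus_fun_apply)
qed (simp add: paired.zero del: zero_fun_apply)

lemma paired_diff: "paired I v v' w w' \<Longrightarrow> paired I v v' u u' \<Longrightarrow> paired I v v' (w - u) (w' - u')"
  using paired_add[OF paired_scale[of I v v' u u' "-1"]] by fastforce

locale gram_pair = N: hilbert N + N': hilbert N'
  for N :: "('a \<Rightarrow> complex^'r) hspace" and N' :: "('b \<Rightarrow> complex^'s) hspace" +
  fixes I :: "'x set" and v v'
  assumes v_mem: "x \<in> I \<Longrightarrow> v x \<in> hcar N" and v'_mem: "x \<in> I \<Longrightarrow> v' x \<in> hcar N'"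
    and gram: "x \<in> I \<Longrightarrow> y \<in> I \<Longrightarrow> hip N' (v' x) (v' y) = hip N (v x) (v y)"
    and total: "h \<in> hcar N \<Longrightarrow> (\<And>x. x \<in> I \<Longrightarrow> hip N h (v x) = 0) \<Longrightarrow> h = 0"
begin

lemma paired_mem: "paired I v v' u u' \<Longrightarrow> u \<in> hcar N \<and> u' \<in> hcar N'"
  by (induction rule: paired.induct)
    (auto simp: v_mem v'_mem simp del: plus_fun_apply zero_fun_apply)

lemma paired_hip_generator:
  "paired I v v' u u' \<Longrightarrow> x \<in> I \<Longrightarrow> hip N' u' (v' x) = hip N u (v x)"
  by (induction rule: paired.induct)
    (auto simp: v_mem v'_mem gram dest: paired_mem
      simp: N.hip_add_left N'.hip_add_left N.hip_scale_left N'.hip_scale_left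
      simp del: plus_fun_apply zero_fun_apply)

lemma paired_hip:
  assumes "paired I v v' u u'"
  shows "paired I v v' w w' \<Longrightarrow> hip N' u' w' = hip N u w"
  by (induction rule: paired.induct)
    (use assms in \<open>auto simp: v_mem v'_mem paired_hip_generator[OF assms] N.hip_add_right N'.hip_add_right
      N.hip_scale_right N'.hip_scale_right simp del: plus_fun_apply zero_fun_apply dest!: paired_mem\<close>)

lemma paired_norm: "paired I v v' u u' \<Longrightarrow> hnorm N' u' = hnorm N u"
  unfolding hnorm_def using paired_hip by metis

text \<open>
  The closure of the combinations is a Hilbert space, and what remains of \<open>h\<close> after projection to it
  is orthogonal to all generators.
\<close>

lemma paired_dense:
  assumes h: "h \<in> hcar N" and e: "e > 0"
  shows "\<exists>u u'. paired I v v' u u' \<and> hnorm N (h - u) < e"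
proof -
  define C where "C = {h \<in> hcar N. \<forall>e>0. \<exists>u u'. paired I v v' u u' \<and> hnorm N (h - u) < e}"
  have CN: "C \<subseteq> hcar N" by (auto simp: C_def)
  have vC: "v x \<in> C" if "x \<in> I" for x
  proof -
    have "paired I v v' (0 + fscale 1 (v x)) (0 + fscale 1 (v' x))"
      by (rule paired.step[OF paired.zero that])
    then have "paired I v v' (v x) (v' x)" by simp
    moreover have "hnorm N (v x - v x) = 0" by simp
    ultimately show ?thesis using v_mem[OF that] unfolding C_def by force
  qed
  have "cfun.subspace C"
  proof (rule cfun.subspaceI)
    have "hnorm N (0 - 0) = 0" by simp
    then show "0 \<in> C" unfolding C_def using paired.zero by force
  next
    fix f g assume f: "f \<in> C" and g: "g \<in> C"
    have "\<exists>u u'. paired I v v' u u' \<and> hnorm N (f + g - u) < e" if "e > 0" for e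
    proof -
      have e2: "e / 2 > 0" using that by simp
      obtain u u' w w' where *: "paired I v v' u u'" "hnorm N (f - u) < e / 2"
        "paired I v v' w w'" "hnorm N (g - w) < e / 2"
        using f g e2 unfolding C_def by blast
      have eq: "f + g - (u + w) = (f - u) + (g - w)" by simp
      have "hnorm N (f + g - (u + w)) < e"
        unfolding eq using N.hnorm_triangle[of "f - u" "g - w"] * f g paired_mem[OF *(1)] paired_mem[OF *(3)]
        by (simp add: C_def)
      then show ?thesis using paired_add[OF *(3,1)] by blast
    qed
    then show "f + g \<in> C" using f g by (auto simp: C_def)
  next
    fix c f assume f: "f \<in> C"
    have "\<exists>u u'. paired I v v' u u' \<and> hnorm N (fscale c f - u) < e" if "e > 0" for e
    proof -
      have e2: "e / (cmod c + 1) > 0" using that by (simp add: add_nonneg_pos)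
      obtain u u' where *: "paired I v v' u u'" "hnorm N (f - u) < e / (cmod c + 1)"
        using f e2 unfolding C_def by blast
      have "fscale c f - fscale c u = fscale c (f - u)" by (simp add: cfun.scale_right_diff_distrib)
      then have "hnorm N (fscale c f - fscale c u) = cmod c * hnorm N (f - u)"
        using N.hnorm_scale[of "f - u" c] f paired_mem[OF *(1)] by (simp add: C_def)
      also have "\<dots> \<le> (cmod c + 1) * hnorm N (f - u)"
        using N.hnorm_ge_0[of "f - u"] f paired_mem[OF *(1)] by (intro mult_right_mono) (auto simp: C_def)
      also have "\<dots> < e" using *(2) by (simp add: pos_less_divide_eq add_nonneg_pos mult.commute)
      finally show ?thesis using paired_scale[OF *(1)] by blast
    qed
    then show "fscale c f \<in> C" using f by (auto simp: C_def)
  qed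
  moreover have "h \<in> C" if X: "\<And>n::nat. X n \<in> C" and h: "h \<in> hcar N"
    and lim: "(\<lambda>n. hnorm N (X n - h)) \<longlonglongrightarrow> 0" for X h
  proof -
    have "\<exists>u u'. paired I v v' u u' \<and> hnorm N (h - u) < e" if "e > 0" for e
    proof -
      have "\<forall>\<^sub>F n in sequentially. hnorm N (X n - h) < e / 2"
        by (rule order_tendstoD(2)[OF lim]) (use that in simp)
      then obtain n where n: "hnorm N (X n - h) < e / 2" by (meson eventually_sequentially order_refl)
      have e2: "e / 2 > 0" using that by simp
      obtain u u' where *: "paired I v v' u u'" "hnorm N (X n - u) < e / 2"
        using X[of n] e2 unfolding C_def by blast
      have "hnorm N (h - u) \<le> hnorm N (h - X n) + hnorm N (X n - u)"
        using N.hnorm_triangle_diff[of h "X n" u] h X[of n] paired_mem[OF *(1)] by (simp add: C_def)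
      then show ?thesis using n * N.hnorm_minus_commute[of h "X n"] h X[of n] by (force simp: C_def)
    qed
    then show ?thesis using h by (simp add: C_def)
  qed
  ultimately have "hilbert_space (N\<lparr>hcar := C\<rparr>)" using N.closed_subspace_hilbert CN by blast
  from N.projection[OF this CN h] obtain g where g: "g \<in> C" "\<And>n. n \<in> C \<Longrightarrow> hip N (h - g) n = 0" by blast
  have "h - g = 0"
    by (rule total) (use g h CN vC in auto)
  then have "h \<in> C" using g(1) by simp
  then show ?thesis using e unfolding C_def by blast
qed

lemma transfer:
  assumes h: "h \<in> hcar N"
  shows "\<exists>h'\<in>hcar N'. hnorm N' h' = hnorm N h \<and> (\<forall>x\<in>I. hip N' h' (v' x) = hip N h (v x))"
proof -
  have "\<exists>u u'. paired I v v' u u' \<and> hnorm N (h - u) < inverse (real (Suc n))" for n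
    by (rule paired_dense[OF h]) simp
  then obtain U U' where U: "\<And>n. paired I v v' (U n) (U' n)"
    "\<And>n. hnorm N (h - U n) < inverse (real (Suc n))" by metis
  have mem: "U n \<in> hcar N" "U' n \<in> hcar N'" for n using paired_mem[OF U(1)] by auto
  have lim: "(\<lambda>n. hnorm N (U n - h)) \<longlonglongrightarrow> 0"
  proof (rule tendsto_sandwich[OF _ _ tendsto_const LIMSEQ_inverse_real_of_nat])
    show "\<forall>\<^sub>F n in sequentially. 0 \<le> hnorm N (U n - h)"
      using mem h by (simp add: N.hnorm_ge_0)
    show "\<forall>\<^sub>F n in sequentially. hnorm N (U n - h) \<le> inverse (real (Suc n))"
      using U(2) N.hnorm_minus_commute[OF mem(1) h] by (simp add: less_imp_le)
  qed
  obtain h' where h': "h' \<in> hcar N'" "(\<lambda>n. hnorm N' (U' n - h')) \<longlonglongrightarrow> 0"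
  proof (rule N'.complete[of U'])
    fix e :: real assume e: "e > 0"
    have "\<forall>\<^sub>F n in sequentially. hnorm N (U n - h) < e / 2"
      by (rule order_tendstoD(2)[OF lim]) (use e in simp)
    then obtain K where K: "\<And>n. n \<ge> K \<Longrightarrow> hnorm N (U n - h) < e / 2"
      unfolding eventually_sequentially by blast
    have "hnorm N' (U' m - U' n) < e" if "m \<ge> K" "n \<ge> K" for m n
    proof -
      have "hnorm N' (U' m - U' n) = hnorm N (U m - U n)"
        by (rule paired_norm[OF paired_diff[OF U(1) U(1)]])
      also have "\<dots> \<le> hnorm N (U m - h) + hnorm N (h - U n)"
        by (rule N.hnorm_triangle_diff[OF mem(1) h mem(1)])
      also have "\<dots> < e" using K[OF that(1)] K[OF that(2)] N.hnorm_minus_commute[OF mem(1) h, of n] by simp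
      finally show ?thesis .
    qed
    then show "\<exists>K. \<forall>m\<ge>K. \<forall>n\<ge>K. hnorm N' (U' m - U' n) < e" by blast
  qed (use mem in auto)
  have "hnorm N' h' = hnorm N h"
  proof (rule LIMSEQ_unique)
    show "(\<lambda>n. hnorm N' (U' n)) \<longlonglongrightarrow> hnorm N' h'" by (rule N'.tendsto_hnorm[OF mem(2) h'])
    show "(\<lambda>n. hnorm N' (U' n)) \<longlonglongrightarrow> hnorm N h"
      using N.tendsto_hnorm[OF mem(1) h lim] paired_norm[OF U(1)] by simp
  qed
  moreover have "hip N' h' (v' x) = hip N h (v x)" if x: "x \<in> I" for x
  proof (rule LIMSEQ_unique)
    show "(\<lambda>n. hip N' (U' n) (v' x)) \<longlonglongrightarrow> hip N' h' (v' x)"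
      by (rule N'.tendsto_hip_left[OF _ h'(1) v'_mem[OF x] h'(2)]) (simp add: mem)
    have "(\<lambda>n. hip N (U n) (v x)) \<longlonglongrightarrow> hip N h (v x)"
      by (rule N.tendsto_hip_left[OF _ h v_mem[OF x] lim]) (simp add: mem)
    then show "(\<lambda>n. hip N' (U' n) (v' x)) \<longlonglongrightarrow> hip N h (v x)"
      using paired_hip_generator[OF U(1) x] by simp
  qed
  ultimately show ?thesis using h'(1) by blast
qed

end

lemma isometry_hip:
  assumes "hilbert N" "hilbert N'"
    and mem: "\<And>h. h \<in> hcar N \<Longrightarrow> T h \<in> hcar N'"
    and add: "\<And>g h. g \<in> hcar N \<Longrightarrow> h \<in> hcar N \<Longrightarrow> T (g + h) = T g + T h"
    and scale: "\<And>c h. h \<in> hcar N \<Longrightarrow> T (fscale c h) = fscale c (T h)"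
    and norm: "\<And>h. h \<in> hcar N \<Longrightarrow> hnorm N' (T h) = hnorm N h"
    and g: "g \<in> hcar N" and h: "h \<in> hcar N"
  shows "hip N' (T g) (T h) = hip N g h"
proof -
  interpret N: hilbert N by fact
  interpret N': hilbert N' by fact
  \<comment> \<open>The real part of an inner product is determined by norms, the imaginary part by \<open>\<langle>\<i>g, h\<rangle>\<close>.\<close>
  have Re: "Re (hip N' (T g) (T h)) = Re (hip N g h)" if "g \<in> hcar N" "h \<in> hcar N" for g h
    using N.hnorm_add_sq[OF that] N'.hnorm_add_sq[OF mem[OF that(1)] mem[OF that(2)]] that
    by (simp add: norm flip: add)
  have "Re (hip N' (T (fscale \<i> g)) (T h)) = Re (hip N (fscale \<i> g) h)"
    using Re g h by simp
  then have "Im (hip N' (T g) (T h)) = Im (hip N g h)"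
    using g h mem by (simp add: scale N.hip_scale_left N'.hip_scale_left)
  then show ?thesis using Re[OF g h] by (simp add: complex_eq_iff)
qed

text \<open>
  The image of \<open>h\<close> is pinned down by its inner products with the total family \<open>v'\<close>; linearity and
  surjectivity follow from this uniqueness.  The last clause characterizes the unitary and is what
  is used to compare module actions.
\<close>

lemma gram_equal_unitary:
  fixes N :: "('a \<Rightarrow> complex^'r) hspace" and N' :: "('b \<Rightarrow> complex^'s) hspace"
  assumes "gram_pair N N' I v v'" "gram_pair N' N I v' v"
  shows "\<exists>T. bij_betw T (hcar N) (hcar N') \<and>
    (\<forall>g\<in>hcar N. \<forall>h\<in>hcar N. T (g + h) = T g + T h) \<and>
    (\<forall>c. \<forall>h\<in>hcar N. T (fscale c h) = fscale c (T h)) \<and>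
    (\<forall>g\<in>hcar N. \<forall>h\<in>hcar N. hip N' (T g) (T h) = hip N g h) \<and>
    (\<forall>h\<in>hcar N. \<forall>x\<in>I. hip N' (T h) (v' x) = hip N h (v x))"
proof -
  interpret P: gram_pair N N' I v v' by fact
  interpret P': gram_pair N' N I v' v by fact
  obtain T where T: "\<And>h. h \<in> hcar N \<Longrightarrow> T h \<in> hcar N'"
    "\<And>h. h \<in> hcar N \<Longrightarrow> hnorm N' (T h) = hnorm N h"
    "\<And>h x. h \<in> hcar N \<Longrightarrow> x \<in> I \<Longrightarrow> hip N' (T h) (v' x) = hip N h (v x)"
    using P.transfer by metis
  have uniq: "g = h" if "g \<in> hcar N'" "h \<in> hcar N'" "\<And>x. x \<in> I \<Longrightarrow> hip N' g (v' x) = hip N' h (v' x)" for g h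
    using P'.total[of "g - h"] that by (simp add: P.N'.hip_diff_left P.v'_mem)
  have add: "T (g + h) = T g + T h" if "g \<in> hcar N" "h \<in> hcar N" for g h
    by (rule uniq) (use that in \<open>simp_all add: T P.N.hip_add_left P.N'.hip_add_left P.v_mem P.v'_mem\<close>)
  have scale: "T (fscale c h) = fscale c (T h)" if "h \<in> hcar N" for c h
    by (rule uniq) (use that in \<open>simp_all add: T P.N.hip_scale_left P.N'.hip_scale_left P.v_mem P.v'_mem\<close>)
  have iso: "hip N' (T g) (T h) = hip N g h" if "g \<in> hcar N" "h \<in> hcar N" for g h
    by (rule isometry_hip[OF P.N.hilbert_axioms P.N'.hilbert_axioms T(1) add scale T(2) that])
  have "bij_betw T (hcar N) (hcar N')"
    unfolding bij_betw_def
  proof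
    show "inj_on T (hcar N)"
    proof (rule inj_onI)
      fix g h assume gh: "g \<in> hcar N" "h \<in> hcar N" "T g = T h"
      have "T (g + fscale (-1) h) = T g + fscale (-1) (T h)" using gh by (simp only: add scale P.N.scale_mem)
      then have "hnorm N (g + fscale (-1) h) = 0"
        using T(2)[of "g + fscale (-1) h"] gh by (simp add: P.N.fscale_minus_1 P.N'.fscale_minus_1)
      then have "g + fscale (-1) h = 0" using P.N.hnorm_eq_0 gh by simp
      then show "g = h" by (simp add: P.N.fscale_minus_1)
    qed
    show "T ` hcar N = hcar N'"
    proof
      show "hcar N' \<subseteq> T ` hcar N"
      proof
        fix h' assume h': "h' \<in> hcar N'"
        then obtain h where h: "h \<in> hcar N" "\<forall>x\<in>I. hip N h (v x) = hip N' h' (v' x)"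
          using P'.transfer by blast
        then have "T h = h'" by (intro uniq) (simp_all add: T h')
        then show "h' \<in> T ` hcar N" using h(1) by blast
      qed
    qed (use T(1) in blast)
  qed
  then show ?thesis using add scale iso T(3) by blast
qed

section \<open>Weakly holomorphic sections\<close>

lemma multi_deriv_step_apply:
  assumes "\<forall>i<l. \<alpha> i = 0"
  shows "multi_deriv D (\<alpha>(l := Suc (\<alpha> l))) x w = D l (multi_deriv D \<alpha> x) w"
  by (simp only: multi_deriv_step[OF assms])

lemma eventually_line:
  fixes w v :: "complex^'n"
  assumes "open S" "w \<in> S"
  shows "\<forall>\<^sub>F t in at 0. w + t *s v \<in> S"
proof -
  have "\<forall>\<^sub>F t in nhds 0. t \<in> {t. w + t *s v \<in> S}"
    by (rule eventually_nhds_in_open[OF open_line_preimage[OF assms(1)]]) (simp add: assms(2))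
  then have "\<forall>\<^sub>F t in nhds 0. w + t *s v \<in> S" by simp
  then show ?thesis by (simp add: eventually_at_filter eventually_mono)
qed

context hilbert
begin

text \<open>
  Weak holomorphy can be checked against the scalar functions at hand and passes to partial
  derivatives; by \<open>line_norm_derivative\<close> it is as good as norm holomorphy.
\<close>

definition weakly_holomorphic_on :: "(complex^'n \<Rightarrow> ('a \<Rightarrow> complex^'r)) \<Rightarrow> (complex^'n) set \<Rightarrow> bool" where
  "weakly_holomorphic_on x S \<longleftrightarrow>
    (\<forall>w\<in>S. x w \<in> hcar M) \<and> (\<forall>h\<in>hcar M. line_holomorphic_on (\<lambda>w. hip M (x w) h) S)"

lemma line_norm_derivative:
  fixes w v :: "complex^'n"
  assumes S: "open S" and x: "weakly_holomorphic_on x S" and w: "w \<in> S"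
  shows "\<exists>x'. has_norm_derivative (\<lambda>t. x (w + t *s v)) x'"
proof -
  obtain R where R: "R > 0" "ball 0 R \<subseteq> {t. w + t *s v \<in> S}"
    using open_line_preimage[OF S, of w v] w open_contains_ball by (metis (no_types, lifting) add.right_neutral mem_Collect_eq vector_smult_lzero)
  show ?thesis
  proof (rule weakly_holomorphic_norm_differentiable[OF R(1)])
    show "\<And>t. t \<in> ball 0 R \<Longrightarrow> x (w + t *s v) \<in> hcar M"
      using R(2) x unfolding weakly_holomorphic_on_def by blast
    fix h assume "h \<in> hcar M"
    then have "line_holomorphic_on (\<lambda>w. hip M (x w) h) S" using x unfolding weakly_holomorphic_on_def by blast
    from line_holomorphic_imp_holomorphic[OF this]
    show "(\<lambda>t. hip M (x (w + t *s v)) h) holomorphic_on ball 0 R" by (rule holomorphic_on_subset[OF _ R(2)])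
  qed
qed

lemma eventually_line_mem:
  fixes w v :: "complex^'n"
  assumes "open S" "weakly_holomorphic_on x S" "w \<in> S"
  shows "\<forall>\<^sub>F t in at 0. x (w + t *s v) \<in> hcar M" "x (w + 0 *s v) \<in> hcar M"
  using eventually_mono[OF eventually_line[OF assms(1,3)], where Q = "\<lambda>t. x (w + t *s v) \<in> hcar M"]
    assms unfolding weakly_holomorphic_on_def by auto

lemma hpartial_norm_derivative:
  assumes "open S" "weakly_holomorphic_on x S" "w \<in> S"
  shows "has_norm_derivative (\<lambda>t. x (w + t *s axis i 1)) (hpartial M i x w)"
proof -
  let ?X = "\<lambda>t. x (w + t *s axis i 1)"
  obtain x' where x': "has_norm_derivative ?X x'" using line_norm_derivative[OF assms] by blast
  have "hpartial M i x w = (THE g. has_norm_derivative ?X g)"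
    by (simp add: hpartial_def has_norm_derivative_def)
  also have "\<dots> = x'"
    using x' norm_derivative_unique[OF _ x' eventually_line_mem[OF assms]] by (rule the_equality)
  finally show ?thesis using x' by simp
qed

lemma hip_hpartial:
  assumes "open S" "weakly_holomorphic_on x S" "w \<in> S" "h \<in> hcar M"
  shows "hip M (hpartial M i x w) h = partial i (\<lambda>w. hip M (x w) h) w"
  using norm_derivative_hip[OF hpartial_norm_derivative[OF assms(1-3)] eventually_line_mem[OF assms(1-3)] assms(4)]
  by (rule partial_eqI[symmetric])

lemma weakly_holomorphic_hpartial:
  assumes "open S" "weakly_holomorphic_on x S"
  shows "weakly_holomorphic_on (hpartial M i x) S"
  unfolding weakly_holomorphic_on_def
proof (intro conjI ballI)
  fix w assume "w \<in> S"
  then show "hpartial M i x w \<in> hcar M"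
    using hpartial_norm_derivative[OF assms] unfolding has_norm_derivative_def by blast
next
  fix h assume h: "h \<in> hcar M"
  then have "line_holomorphic_on (\<lambda>w. hip M (x w) h) S"
    using assms(2) unfolding weakly_holomorphic_on_def by blast
  from line_holomorphic_partial[OF assms(1) this]
  show "line_holomorphic_on (\<lambda>w. hip M (hpartial M i x w) h) S"
    by (rule line_holomorphic_cong[OF assms(1), rotated]) (simp add: hip_hpartial[OF assms _ h])
qed

lemma weakly_holomorphic_multi_deriv:
  fixes S :: "'m::{finite,linorder} cvec set"
  assumes "open S" "weakly_holomorphic_on x S"
  shows "weakly_holomorphic_on (multi_deriv (hpartial M) \<alpha> x) S"
  by (induction \<alpha> rule: multi_index_induct)
    (simp_all add: assms multi_deriv_zero multi_deriv_step weakly_holomorphic_hpartial del: fun_upd_apply)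

lemma multi_deriv_mem:
  fixes S :: "'m::{finite,linorder} cvec set"
  assumes "open S" "weakly_holomorphic_on x S" "w \<in> S"
  shows "multi_deriv (hpartial M) \<alpha> x w \<in> hcar M"
  using weakly_holomorphic_multi_deriv[OF assms(1,2)] assms(3) unfolding weakly_holomorphic_on_def by blast

lemma hip_multi_deriv:
  fixes S :: "'m::{finite,linorder} cvec set"
  assumes "open S" "weakly_holomorphic_on x S" "w \<in> S" "h \<in> hcar M"
  shows "hip M (multi_deriv (hpartial M) \<alpha> x w) h = multi_deriv partial \<alpha> (\<lambda>w. hip M (x w) h) w"
proof -
  have "\<forall>w\<in>S. hip M (multi_deriv (hpartial M) \<alpha> x w) h = multi_deriv partial \<alpha> (\<lambda>w. hip M (x w) h) w"
  proof (induction \<alpha> rule: multi_index_induct)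
    case (step \<alpha> l)
    show ?case
    proof
      fix w assume w: "w \<in> S"
      have "hip M (hpartial M l (multi_deriv (hpartial M) \<alpha> x) w) h =
          partial l (\<lambda>w. hip M (multi_deriv (hpartial M) \<alpha> x w) h) w"
        by (rule hip_hpartial[OF assms(1) weakly_holomorphic_multi_deriv[OF assms(1,2)] w assms(4)])
      also have "\<dots> = partial l (multi_deriv partial \<alpha> (\<lambda>w. hip M (x w) h)) w"
        by (rule partial_cong[OF assms(1) _ w]) (use step(2) in blast)
      finally show "hip M (multi_deriv (hpartial M) (\<alpha>(l := Suc (\<alpha> l))) x w) h =
          multi_deriv partial (\<alpha>(l := Suc (\<alpha> l))) (\<lambda>w. hip M (x w) h) w"
        by (simp only: multi_deriv_step_apply[OF step(1)])
    qed
  qed (simp add: multi_deriv_zero)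
  then show ?thesis using assms(3) by blast
qed

lemma hip_sesquiholomorphic:
  fixes p q e :: "complex^'n"
  assumes "open S" "weakly_holomorphic_on x S" "weakly_holomorphic_on y S" "p \<in> S" "q \<in> S"
  shows "(\<lambda>t. hip M (x (p + t *s e)) (y (q + cnj t *s e))) field_differentiable at 0"
proof -
  obtain x' y' where *: "has_norm_derivative (\<lambda>t. x (p + t *s e)) x'" "has_norm_derivative (\<lambda>t. y (q + t *s e)) y'"
    using line_norm_derivative assms by metis
  show ?thesis
    using hip_sesqui_field_derivative[OF *(1) eventually_line_mem[OF assms(1,2,4)] *(2) eventually_line_mem[OF assms(1,3,5)]]
    unfolding field_differentiable_def by blast
qed

end

lemma has_vector_derivative_along_ray:
  fixes F :: "complex \<Rightarrow> complex"
  assumes "(F has_derivative (\<lambda>t. t * A + cnj t * B)) (at 0)"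
  shows "((\<lambda>t::real. F (c * of_real t)) has_vector_derivative (c * A + cnj c * B)) (at 0)"
proof -
  have "bounded_linear (\<lambda>t::real. c * of_real t)"
    by (intro bounded_linear_const_mult bounded_linear_of_real)
  then have "((\<lambda>t::real. c * of_real t) has_derivative (\<lambda>t. c * of_real t)) (at 0)"
    by (rule bounded_linear_imp_has_derivative)
  from has_derivative_compose[OF this, of F "\<lambda>t. t * A + cnj t * B"] assms
  show ?thesis
    unfolding has_vector_derivative_def by (simp add: scaleR_conv_of_real algebra_simps)
qed

text \<open>
  The \<open>\<real>\<close>-linear map \<open>t \<mapsto> t A + cnj t B\<close> sends \<open>1\<close> to \<open>A + B\<close> and \<open>\<i>\<close> to \<open>\<i>A - \<i>B\<close>.
\<close>

lemma wirtinger_eqI: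
  assumes "((\<lambda>t. f (w + t *s axis i 1)) has_derivative (\<lambda>t. t * A + cnj t * B)) (at 0)"
  shows "wirtinger i f w = A" "wirtinger_bar i f w = B"
proof -
  have x: "partial_x i f w = A + B"
    unfolding partial_x_def
    using has_vector_derivative_along_ray[OF assms, of 1] by (intro vector_derivative_at) simp
  have y: "partial_y i f w = \<i> * A - \<i> * B"
    unfolding partial_y_def
    using has_vector_derivative_along_ray[OF assms, of \<i>] by (intro vector_derivative_at) simp
  have "\<i> * (\<i> * z) = - z" for z by (simp flip: mult.assoc)
  then show "wirtinger i f w = A" "wirtinger_bar i f w = B"
    unfolding wirtinger_def wirtinger_bar_def x y by (simp_all add: algebra_simps)
qed

lemma vector_derivative_cong_at:
  fixes f g :: "real \<Rightarrow> 'b::real_normed_vector"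
  assumes "\<forall>\<^sub>F t in nhds x. f t = g t"
  shows "vector_derivative f (at x) = vector_derivative g (at x)"
proof -
  have "(f has_vector_derivative y) (at x) = (g has_vector_derivative y) (at x)" for y
    by (rule has_vector_derivative_cong_ev) (use assms in \<open>auto elim: eventually_mono eventually_nhds_x_imp_x\<close>)
  then show ?thesis unfolding vector_derivative_def by simp
qed

lemma eventually_real_line:
  fixes w v :: "complex^'n"
  assumes "open S" "w \<in> S"
  shows "\<forall>\<^sub>F t in nhds (0::real). w + (c * of_real t) *s v \<in> S"
proof -
  have "open ((\<lambda>t::real. w + (c * of_real t) *s v) -` S)"
    by (intro open_vimage assms continuous_intros)
  from eventually_nhds_in_open[OF this, of 0] show ?thesis using assms(2) by simp
qed

lemma wirtinger_cong:
  assumes "open S" "\<And>z. z \<in> S \<Longrightarrow> f z = g z" "w \<in> S"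
  shows "wirtinger i f w = wirtinger i g w" "wirtinger_bar i f w = wirtinger_bar i g w"
proof -
  have "\<forall>\<^sub>F t in nhds (0::real). f (w + (c * of_real t) *s axis i 1) = g (w + (c * of_real t) *s axis i 1)" for c
    using eventually_real_line[OF assms(1,3)] by (rule eventually_mono) (rule assms(2))
  from this[of 1] this[of \<i>]
  have "partial_x i f w = partial_x i g w" "partial_y i f w = partial_y i g w"
    unfolding partial_x_def partial_y_def by (auto intro!: vector_derivative_cong_at)
  then show "wirtinger i f w = wirtinger i g w" "wirtinger_bar i f w = wirtinger_bar i g w"
    unfolding wirtinger_def wirtinger_bar_def by simp_all
qed

context hilbert
begin

text \<open>
  The inner product is conjugate linear in its second argument, so the holomorphic derivative falls
  on \<open>x\<close> and the antiholomorphic one on \<open>y\<close>.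
\<close>

lemma wirtinger_hip:
  assumes "open S" "weakly_holomorphic_on x S" "weakly_holomorphic_on y S" "w \<in> S"
  shows "wirtinger i (\<lambda>w. hip M (x w) (y w)) w = hip M (hpartial M i x w) (y w)"
    and "wirtinger_bar i (\<lambda>w. hip M (x w) (y w)) w = hip M (x w) (hpartial M i y w)"
proof -
  have "((\<lambda>t. hip M (x (w + t *s axis i 1)) (y (w + t *s axis i 1))) has_derivative
      (\<lambda>t. t * hip M (hpartial M i x w) (y (w + 0 *s axis i 1)) + cnj t * hip M (x (w + 0 *s axis i 1)) (hpartial M i y w))) (at 0)"
    by (rule hip_has_derivative[OF hpartial_norm_derivative[OF assms(1,2,4)] eventually_line_mem[OF assms(1,2,4)]
          hpartial_norm_derivative[OF assms(1,3,4)] eventually_line_mem[OF assms(1,3,4)]])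
  then have *: "((\<lambda>t. hip M (x (w + t *s axis i 1)) (y (w + t *s axis i 1))) has_derivative
      (\<lambda>t. t * hip M (hpartial M i x w) (y w) + cnj t * hip M (x w) (hpartial M i y w))) (at 0)"
    by simp
  show "wirtinger i (\<lambda>w. hip M (x w) (y w)) w = hip M (hpartial M i x w) (y w)"
    "wirtinger_bar i (\<lambda>w. hip M (x w) (y w)) w = hip M (x w) (hpartial M i y w)"
    using wirtinger_eqI[of "\<lambda>w. hip M (x w) (y w)", OF *] by auto
qed

lemma multi_wirtinger_hip:
  fixes S :: "'m::{finite,linorder} cvec set"
  assumes S: "open S" and x: "weakly_holomorphic_on x S" and y: "weakly_holomorphic_on y S" and w: "w \<in> S"
  shows "multi_deriv wirtinger \<alpha> (multi_deriv wirtinger_bar \<beta> (\<lambda>w. hip M (x w) (y w))) w =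
    hip M (multi_deriv (hpartial M) \<alpha> x w) (multi_deriv (hpartial M) \<beta> y w)"
proof -
  note wh = weakly_holomorphic_multi_deriv[OF S]
  have bar: "\<forall>w\<in>S. multi_deriv wirtinger_bar \<beta> (\<lambda>w. hip M (x w) (y w)) w =
      hip M (x w) (multi_deriv (hpartial M) \<beta> y w)"
  proof (induction \<beta> rule: multi_index_induct)
    case (step \<beta> l)
    show ?case
    proof
      fix w assume w: "w \<in> S"
      have "wirtinger_bar l (multi_deriv wirtinger_bar \<beta> (\<lambda>w. hip M (x w) (y w))) w =
          wirtinger_bar l (\<lambda>w. hip M (x w) (multi_deriv (hpartial M) \<beta> y w)) w"
        by (rule wirtinger_cong(2)[OF S _ w]) (use step(2) in blast)
      also have "\<dots> = hip M (x w) (hpartial M l (multi_deriv (hpartial M) \<beta> y) w)"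
        by (rule wirtinger_hip(2)[OF S x wh[OF y] w])
      finally show "multi_deriv wirtinger_bar (\<beta>(l := Suc (\<beta> l))) (\<lambda>w. hip M (x w) (y w)) w =
          hip M (x w) (multi_deriv (hpartial M) (\<beta>(l := Suc (\<beta> l))) y w)"
        by (simp only: multi_deriv_step_apply[OF step(1)])
    qed
  qed (simp add: multi_deriv_zero)
  have "\<forall>w\<in>S. multi_deriv wirtinger \<alpha> (multi_deriv wirtinger_bar \<beta> (\<lambda>w. hip M (x w) (y w))) w =
    hip M (multi_deriv (hpartial M) \<alpha> x w) (multi_deriv (hpartial M) \<beta> y w)"
  proof (induction \<alpha> rule: multi_index_induct)
    case zero
    then show ?case using bar by (simp add: multi_deriv_zero)
  next
    case (step \<alpha> l)
    show ?case
    proof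
      fix w assume w: "w \<in> S"
      have "wirtinger l (multi_deriv wirtinger \<alpha> (multi_deriv wirtinger_bar \<beta> (\<lambda>w. hip M (x w) (y w)))) w =
          wirtinger l (\<lambda>w. hip M (multi_deriv (hpartial M) \<alpha> x w) (multi_deriv (hpartial M) \<beta> y w)) w"
        by (rule wirtinger_cong(1)[OF S _ w]) (use step(2) in blast)
      also have "\<dots> = hip M (hpartial M l (multi_deriv (hpartial M) \<alpha> x) w) (multi_deriv (hpartial M) \<beta> y w)"
        by (rule wirtinger_hip(1)[OF S wh[OF x] wh[OF y] w])
      finally show "multi_deriv wirtinger (\<alpha>(l := Suc (\<alpha> l)))
            (multi_deriv wirtinger_bar \<beta> (\<lambda>w. hip M (x w) (y w))) w =
          hip M (multi_deriv (hpartial M) (\<alpha>(l := Suc (\<alpha> l))) x w) (multi_deriv (hpartial M) \<beta> y w)"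
        by (simp only: multi_deriv_step_apply[OF step(1)])
    qed
  qed
  then show ?thesis using w by blast
qed

end

lemma coord_in_alg: "(\<lambda>z. z $ l) \<in> alg \<Omega>"
proof -
  have "sv_holomorphic_on (\<lambda>z. z $ l) UNIV"
    unfolding sv_holomorphic_on_def
    by (intro ballI exI[of _ "\<lambda>v. v $ l"]) (auto intro!: bounded_linear_imp_has_derivative bounded_linear_vec_nth)
  moreover have "uniform_limit (closure \<Omega>) (\<lambda>n::nat. \<lambda>z. z $ l) (\<lambda>z. z $ l) sequentially"
    by (rule uniform_limitI) simp
  ultimately show ?thesis
    unfolding alg_def by (intro CollectI exI[of _ "\<lambda>_ z. z $ l"]) (auto intro!: exI[of _ UNIV])
qed

lemma alg_line_holomorphic:
  assumes "f \<in> alg \<Omega>" "open \<Omega>"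
  shows "line_holomorphic_on f \<Omega>"
proof -
  obtain g where g: "\<And>n::nat. \<exists>W. open W \<and> closure \<Omega> \<subseteq> W \<and> sv_holomorphic_on (g n) W"
    "uniform_limit (closure \<Omega>) g f sequentially"
    using assms(1) unfolding alg_def by blast
  show ?thesis
  proof (rule line_holomorphic_uniform_limit[OF assms(2)])
    fix n
    show "line_holomorphic_on (g n) \<Omega>"
      using g(1)[of n] closure_subset sv_holomorphic_imp_line line_holomorphic_subset by (metis order_trans)
    show "uniform_limit \<Omega> g f sequentially"
      using g(2) closure_subset by (rule uniform_limit_on_subset)
  qed
qed

lemma multi_index_sum_less:
  fixes \<alpha> \<beta> :: "'m::finite \<Rightarrow> nat"
  assumes "\<beta> \<le> \<alpha>" "\<beta> \<noteq> \<alpha>"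
  shows "(\<Sum>i\<in>UNIV. \<beta> i) < (\<Sum>i\<in>UNIV. \<alpha> i)"
proof (rule sum_strict_mono_ex1)
  show "\<forall>x\<in>UNIV. \<beta> x \<le> \<alpha> x" using assms(1) by (simp add: le_fun_def)
  then show "\<exists>a\<in>UNIV. \<beta> a < \<alpha> a" using assms(2) by (metis UNIV_I ext order_le_less)
qed simp

section \<open>The bundle and the quotient of a Hilbert module\<close>

text \<open>
  The letters \<open>A\<close>, \<open>Zs\<close>, \<open>M0\<close>, \<open>Mq\<close> stand for the multi-indices of order below \<open>k\<close>, for \<open>\<Z>\<^sup>*\<close>, for the
  submodule and for the quotient.
\<close>

locale framed_module =
  fixes \<Omega> U :: "'m::{finite,linorder} cvec set"
    and M :: "('m cvec \<Rightarrow> 'r::finite cvec) hspace"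
    and s :: "'r \<Rightarrow> 'm cvec \<Rightarrow> ('m cvec \<Rightarrow> 'r cvec)"
    and J :: "'m set" and k :: nat
  assumes open_\<Omega>: "open \<Omega>" and zero_\<Omega>: "0 \<in> \<Omega>" and connected_Z: "connected (zero_locus \<Omega> J)"
    and module: "hilbert_module \<Omega> M"
    and open_U: "open U" and zero_U: "0 \<in> U" and U_sub: "U \<subseteq> vcnj ` \<Omega>"
    and frame: "normalized_frame \<Omega> J M U s"
begin

sublocale hilbert M
  by unfold_locales (use module in \<open>simp add: hilbert_module_def\<close>)

abbreviation A where "A \<equiv> multi_indices_below J k"
abbreviation Zs where "Zs \<equiv> zero_locus (vcnj ` \<Omega>) J"
abbreviation M0 where "M0 \<equiv> vanishing_submodule \<Omega> J k M"
abbreviation Mq where "Mq \<equiv> quotient_space \<Omega> J k M"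
abbreviation jet where "jet \<alpha> i \<equiv> multi_deriv (hpartial M) \<alpha> (s i)"

text \<open>
  Pairing a section with \<open>h\<close> involves the conjugate of \<open>h\<close> at the conjugate point, which is
  holomorphic on \<open>\<Omega>\<^sup>*\<close>.
\<close>

definition conj_coord :: "('m cvec \<Rightarrow> 'r cvec) \<Rightarrow> 'r \<Rightarrow> 'm cvec \<Rightarrow> complex" where
  "conj_coord h j w = cnj (h (vcnj w) $ j)"

lemma open_U': "open (vcnj ` \<Omega>)" by (rule open_vcnj_image[OF open_\<Omega>])

lemma vcnj_U: "w \<in> U \<Longrightarrow> vcnj w \<in> \<Omega>"
  using U_sub vcnj_image_iff by blast

lemma Zs_iff: "w \<in> Zs \<longleftrightarrow> vcnj w \<in> zero_locus \<Omega> J"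
  by (simp add: zero_locus_def vcnj_image_iff) (simp add: vcnj_def)

lemma module_line_holomorphic: "h \<in> hcar M \<Longrightarrow> line_holomorphic_on (\<lambda>z. h z $ j) \<Omega>"
  using module unfolding hilbert_module_def by (simp add: sv_holomorphic_imp_line)

lemma conj_coord_line_holomorphic: "h \<in> hcar M \<Longrightarrow> line_holomorphic_on (conj_coord h j) (vcnj ` \<Omega>)"
  using line_holomorphic_cnj[OF module_line_holomorphic, of h j] by (simp add: conj_coord_def[abs_def])

lemma conj_coord_line_holomorphic_U: "h \<in> hcar M \<Longrightarrow> line_holomorphic_on (conj_coord h j) U"
  using conj_coord_line_holomorphic U_sub line_holomorphic_subset by blast

lemma fmult_mem: "f \<in> alg \<Omega> \<Longrightarrow> h \<in> hcar M \<Longrightarrow> fmult f h \<in> hcar M"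
  using module unfolding hilbert_module_def by blast

lemma kernel_vec:
  assumes "z \<in> \<Omega>"
  shows "kernel_vec M z \<zeta> \<in> hcar M" "\<And>h. h \<in> hcar M \<Longrightarrow> hip M h (kernel_vec M z \<zeta>) = cinner (h z) \<zeta>"
proof -
  obtain C where C: "\<And>h. h \<in> hcar M \<Longrightarrow> norm (h z) \<le> C * hnorm M h"
    using module assms unfolding hilbert_module_def by meson
  have "\<exists>g\<in>hcar M. \<forall>h\<in>hcar M. cinner (h z) \<zeta> = hip M h g"
  proof (rule riesz)
    fix f assume f: "f \<in> hcar M"
    have "cmod (cinner (f z) \<zeta>) \<le> (\<Sum>i\<in>UNIV. norm (f z) * cmod (\<zeta> $ i))"
      unfolding cinner_def
      by (rule sum_norm_le) (unfold norm_mult complex_mod_cnj, rule mult_right_mono[OF Finite_Cartesian_Product.norm_nth_le norm_ge_zero])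
    also have "\<dots> = (\<Sum>i\<in>UNIV. cmod (\<zeta> $ i)) * norm (f z)"
      by (simp add: sum_distrib_left mult.commute)
    also have "\<dots> \<le> (\<Sum>i\<in>UNIV. cmod (\<zeta> $ i)) * (C * hnorm M f)"
      by (intro mult_left_mono C f sum_nonneg) simp
    finally show "cmod (cinner (f z) \<zeta>) \<le> ((\<Sum>i\<in>UNIV. cmod (\<zeta> $ i)) * C) * hnorm M f"
      by (simp add: mult.assoc)
  qed (simp_all add: cinner_def fscale_def distrib_right sum.distrib sum_distrib_left mult.assoc)
  then obtain g where g: "g \<in> hcar M" "\<And>h. h \<in> hcar M \<Longrightarrow> hip M h g = cinner (h z) \<zeta>" by metis
  have "kernel_vec M z \<zeta> = g"
    unfolding kernel_vec_def
  proof (rule the_equality)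
    fix g' assume g': "g' \<in> hcar M \<and> (\<forall>h\<in>hcar M. hip M h g' = cinner (h z) \<zeta>)"
    then have "hip M (g' - g) g' = hip M (g' - g) g" using g by simp
    then have "hip M (g' - g) (g' - g) = 0" using g g' by (simp add: hip_diff_right)
    then show "g' = g" using g g' by (intro eq_if_hip_diff_0) simp_all
  qed (use g in blast)
  then show "kernel_vec M z \<zeta> \<in> hcar M" "\<And>h. h \<in> hcar M \<Longrightarrow> hip M h (kernel_vec M z \<zeta>) = cinner (h z) \<zeta>"
    using g by auto
qed

lemma hip_kernel_vec:
  assumes "w \<in> U" "h \<in> hcar M"
  shows "hip M (kernel_vec M (vcnj w) (axis j 1)) h = conj_coord h j w"
proof -
  have "cinner x (axis j 1) = x $ j" for x :: "complex^'r"
    by (simp add: cinner_def axis_def if_distrib[of cnj] if_distrib[of "(*) _"] cong: if_cong)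
  then have "hip M h (kernel_vec M (vcnj w) (axis j 1)) = h (vcnj w) $ j"
    using kernel_vec(2)[OF vcnj_U[OF assms(1)] assms(2)] by simp
  then show ?thesis using hip_cnj[OF assms(2) kernel_vec(1)[OF vcnj_U[OF assms(1)]]] by (metis conj_coord_def)
qed

lemma frame_coefficients:
  "\<exists>a. (\<forall>i j. line_holomorphic_on (a i j) U) \<and>
    (\<forall>i. \<forall>w\<in>U. s i w = (\<Sum>j\<in>UNIV. fscale (a i j w) (kernel_vec M (vcnj w) (axis j 1))))"
proof -
  have "\<forall>i. \<exists>a. (\<forall>j. sv_holomorphic_on (a j) U) \<and>
      (\<forall>w\<in>U. s i w = (\<Sum>j\<in>UNIV. fscale (a j w) (kernel_vec M (vcnj w) (axis j 1))))"
    using frame unfolding normalized_frame_def holomorphic_frame_def holomorphic_section_def by blast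
  then have "\<exists>a. \<forall>i. (\<forall>j. sv_holomorphic_on (a i j) U) \<and>
      (\<forall>w\<in>U. s i w = (\<Sum>j\<in>UNIV. fscale (a i j w) (kernel_vec M (vcnj w) (axis j 1))))"
    by (rule choice)
  then obtain a where a: "\<forall>i. (\<forall>j. sv_holomorphic_on (a i j) U) \<and>
      (\<forall>w\<in>U. s i w = (\<Sum>j\<in>UNIV. fscale (a i j w) (kernel_vec M (vcnj w) (axis j 1))))"
    by (rule exE)
  then have "\<forall>i j. line_holomorphic_on (a i j) U" by (simp add: sv_holomorphic_imp_line)
  with a show ?thesis by (intro exI[of _ a]) simp
qed

text \<open>
  The matrix of the frame with respect to the frame \<open>K(\<cdot>, cnj w) \<sigma>\<^sub>j\<close> of kernel vectors.
\<close>

definition transition where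
  "transition = (SOME a. (\<forall>i j. line_holomorphic_on (a i j) U) \<and>
    (\<forall>i. \<forall>w\<in>U. s i w = (\<Sum>j\<in>UNIV. fscale (a i j w) (kernel_vec M (vcnj w) (axis j 1)))))"

lemma transition_line_holomorphic: "line_holomorphic_on (transition i j) U"
  and frame_expansion: "w \<in> U \<Longrightarrow> s i w = (\<Sum>j\<in>UNIV. fscale (transition i j w) (kernel_vec M (vcnj w) (axis j 1)))"
  using someI_ex[OF frame_coefficients] unfolding transition_def by blast+

lemma section_mem: "w \<in> U \<Longrightarrow> s i w \<in> hcar M"
  by (simp add: frame_expansion sum_mem kernel_vec(1) vcnj_U)

lemma hip_section:
  assumes "w \<in> U" "h \<in> hcar M"
  shows "hip M (s i w) h = (\<Sum>j\<in>UNIV. transition i j w * conj_coord h j w)"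
  unfolding frame_expansion[OF assms(1)]
  by (simp add: hip_sum_left hip_scale_left kernel_vec(1) vcnj_U assms hip_kernel_vec)

lemma section_weakly_holomorphic: "weakly_holomorphic_on (s i) U"
  unfolding weakly_holomorphic_on_def
proof (intro conjI ballI section_mem)
  fix h assume h: "h \<in> hcar M"
  have "line_holomorphic_on (\<lambda>w. \<Sum>j\<in>UNIV. transition i j w * conj_coord h j w) U"
    by (intro line_holomorphic_sum line_holomorphic_mult transition_line_holomorphic conj_coord_line_holomorphic_U h)
  then show "line_holomorphic_on (\<lambda>w. hip M (s i w) h) U"
    by (rule line_holomorphic_cong[OF open_U, rotated]) (simp add: hip_section h)
qed

lemma section_independent:
  assumes w: "w \<in> U" and c: "(\<Sum>i\<in>UNIV. fscale (c i) (s i w)) = 0"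
  shows "c i = 0"
proof -
  have inj: "inj (\<lambda>i. s i w)" and ind: "cfun.independent (range (\<lambda>i. s i w))"
    using frame w unfolding normalized_frame_def holomorphic_frame_def by auto
  let ?u = "\<lambda>x. c (inv (\<lambda>i. s i w) x)"
  have "(\<Sum>x\<in>range (\<lambda>i. s i w). fscale (?u x) x) = (\<Sum>i\<in>UNIV. fscale (c i) (s i w))"
    by (subst sum.reindex[OF inj]) (simp add: inv_f_f[OF inj])
  then have "?u (s i w) = 0"
    using cfun.independentD[OF ind, of "range (\<lambda>i. s i w)" ?u "s i w"] c by simp
  then show ?thesis by (simp add: inv_f_f[OF inj])
qed

text \<open>
  The rows of the transition matrix are independent because the sections are, so its kernel is zero.
\<close>

lemma transition_nonsingular:
  assumes w: "w \<in> U" and x: "\<And>i. (\<Sum>j\<in>UNIV. transition i j w * x j) = 0"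
  shows "x j = 0"
proof -
  define T :: "complex^'r^'r" where "T = (\<chi> i j. transition i j w)"
  have "\<forall>i. c i = 0" if "(\<Sum>i\<in>UNIV. c i *s row i T) = 0" for c
  proof -
    have c0: "(\<Sum>i\<in>UNIV. c i * transition i j w) = 0" for j
      using arg_cong[OF that, of "\<lambda>v. v $ j"] by (simp add: row_def T_def)
    have "(\<Sum>i\<in>UNIV. fscale (c i) (s i w)) =
        (\<Sum>j\<in>UNIV. \<Sum>i\<in>UNIV. fscale (c i * transition i j w) (kernel_vec M (vcnj w) (axis j 1)))"
      unfolding frame_expansion[OF w] by (subst sum.swap) (simp add: cfun.scale_sum_right)
    also have "\<dots> = (\<Sum>j\<in>UNIV. fscale (\<Sum>i\<in>UNIV. c i * transition i j w) (kernel_vec M (vcnj w) (axis j 1)))"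
      by (simp only: cfun.scale_sum_left)
    also have "\<dots> = 0" by (simp only: c0 cfun.scale_zero_left sum.neutral_const)
    finally show ?thesis using section_independent[OF w] by blast
  qed
  then obtain B where "T ** B = mat 1" using matrix_right_invertible_independent_rows by blast
  then have "B ** T = mat 1" by (simp add: matrix_left_right_inverse)
  then have "\<forall>y. T *v y = 0 \<longrightarrow> y = 0" using matrix_left_invertible_ker by blast
  moreover have "T *v (\<chi> j. x j) = 0"
    using x by (simp add: matrix_vector_mult_def T_def vec_eq_iff)
  ultimately have "(\<chi> j. x j) = 0" by blast
  then show ?thesis by (simp add: vec_eq_iff)
qed

lemma jet_mem: "w \<in> U \<Longrightarrow> jet \<alpha> i w \<in> hcar M"
  by (rule multi_deriv_mem[OF open_U section_weakly_holomorphic])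

lemma jet_weakly_holomorphic: "weakly_holomorphic_on (jet \<alpha> i) U"
  by (rule weakly_holomorphic_multi_deriv[OF open_U section_weakly_holomorphic])

lemma hip_jet:
  assumes "w \<in> U" "h \<in> hcar M"
  shows "hip M (jet \<alpha> i w) h = multi_deriv partial \<alpha> (\<lambda>w. hip M (s i w) h) w"
  by (rule hip_multi_deriv[OF open_U section_weakly_holomorphic assms])

lemma hip_section_line_holomorphic: "h \<in> hcar M \<Longrightarrow> line_holomorphic_on (\<lambda>w. hip M (s i w) h) U"
  using section_weakly_holomorphic unfolding weakly_holomorphic_on_def by blast

lemma hip_jet_sum:
  assumes "w \<in> U" "h \<in> hcar M"
  shows "hip M (jet \<alpha> i w) h = (\<Sum>j\<in>UNIV. multi_deriv partial \<alpha> (\<lambda>w. transition i j w * conj_coord h j w) w)"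
proof -
  have "hip M (jet \<alpha> i w) h = multi_deriv partial \<alpha> (\<lambda>w. \<Sum>j\<in>UNIV. transition i j w * conj_coord h j w) w"
    unfolding hip_jet[OF assms]
    by (rule multi_deriv_cong[OF open_U _ assms(1)]) (rule hip_section[OF _ assms(2)])
  also have "\<dots> = (\<Sum>j\<in>UNIV. multi_deriv partial \<alpha> (\<lambda>w. transition i j w * conj_coord h j w) w)"
    by (rule multi_deriv_sum[OF open_U _ assms(1)])
      (intro line_holomorphic_mult transition_line_holomorphic conj_coord_line_holomorphic_U assms)
  finally show ?thesis .
qed

lemma gramian_deriv_jets:
  assumes "w \<in> U"
  shows "gramian_deriv \<alpha> \<beta> (gramian M s) w $ i $ j = hip M (jet \<alpha> i w) (jet \<beta> j w)"
  using multi_wirtinger_hip[OF open_U section_weakly_holomorphic section_weakly_holomorphic assms]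
  by (simp add: gramian_deriv_def gramian_def)
lemma conj_coord_deriv:
  assumes "h \<in> hcar M" "w \<in> vcnj ` \<Omega>"
  shows "multi_deriv partial \<alpha> (conj_coord h j) w = cnj (multi_deriv partial \<alpha> (\<lambda>z. h z $ j) (vcnj w))"
  unfolding conj_coord_def[abs_def]
  by (rule multi_deriv_cnj[OF open_\<Omega> module_line_holomorphic[OF assms(1)] assms(2)])

lemma vanishing_iff:
  "h \<in> M0 \<longleftrightarrow> h \<in> hcar M \<and> (\<forall>\<alpha>\<in>A. \<forall>j. \<forall>w\<in>Zs. multi_deriv partial \<alpha> (conj_coord h j) w = 0)"
proof -
  have "(\<forall>z\<in>zero_locus \<Omega> J. multi_deriv partial \<alpha> (\<lambda>z. h z $ j) z = 0) \<longleftrightarrow>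
      (\<forall>w\<in>Zs. multi_deriv partial \<alpha> (conj_coord h j) w = 0)" if h: "h \<in> hcar M" for \<alpha> j
  proof -
    have *: "multi_deriv partial \<alpha> (conj_coord h j) w = 0 \<longleftrightarrow> multi_deriv partial \<alpha> (\<lambda>z. h z $ j) (vcnj w) = 0"
      if "w \<in> Zs" for w
      using that conj_coord_deriv[OF h, of w] by (simp add: zero_locus_def)
    show ?thesis
    proof
      assume "\<forall>z\<in>zero_locus \<Omega> J. multi_deriv partial \<alpha> (\<lambda>z. h z $ j) z = 0"
      then show "\<forall>w\<in>Zs. multi_deriv partial \<alpha> (conj_coord h j) w = 0" using * Zs_iff by blast
    next
      assume R: "\<forall>w\<in>Zs. multi_deriv partial \<alpha> (conj_coord h j) w = 0"
      show "\<forall>z\<in>zero_locus \<Omega> J. multi_deriv partial \<alpha> (\<lambda>z. h z $ j) z = 0"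
      proof
        fix z assume "z \<in> zero_locus \<Omega> J"
        then have "vcnj z \<in> Zs" by (simp only: Zs_iff vcnj_vcnj)
        then show "multi_deriv partial \<alpha> (\<lambda>z. h z $ j) z = 0" using * R by fastforce
      qed
    qed
  qed
  then show ?thesis unfolding vanishing_submodule_def by blast
qed

lemma vanishing_subset: "M0 \<subseteq> hcar M"
  by (auto simp: vanishing_submodule_def)

lemma leibniz_vanishing:
  assumes "open S" "line_holomorphic_on a S" "line_holomorphic_on g S" "w \<in> S" "\<alpha> \<in> A"
    and "\<And>\<beta>. \<beta> \<in> A \<Longrightarrow> multi_deriv partial \<beta> g w = 0"
  shows "multi_deriv partial \<alpha> (\<lambda>w. a w * g w) w = 0"
  using leibniz_leading[OF assms(1-4), of \<alpha>] assms(5,6) multi_indices_below_mono by force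

lemma jet_orthogonal_vanishing:
  assumes "w \<in> U \<inter> Zs" "\<alpha> \<in> A" "h \<in> M0"
  shows "hip M (jet \<alpha> i w) h = 0"
proof -
  have h: "h \<in> hcar M" "\<And>\<alpha> j. \<alpha> \<in> A \<Longrightarrow> multi_deriv partial \<alpha> (conj_coord h j) w = 0"
    using assms vanishing_iff by blast+
  then show ?thesis
    using hip_jet_sum[of w h \<alpha> i] assms
      leibniz_vanishing[OF open_U transition_line_holomorphic conj_coord_line_holomorphic_U[OF h(1)]]
    by (simp add: sum.neutral)
qed

lemma car_Mq: "hcar Mq = {h \<in> hcar M. \<forall>g\<in>M0. hip M h g = 0}"
  by (simp add: quotient_space_def)

lemma hip_Mq [simp]: "hip Mq = hip M"
  by (simp add: quotient_space_def)

lemma Mq_mem: "h \<in> hcar Mq \<Longrightarrow> h \<in> hcar M"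
  by (simp add: car_Mq)

lemma hilbert_Mq: "hilbert Mq"
  by unfold_locales (simp add: quotient_space_def orthogonal_complement_hilbert vanishing_subset)

lemma jet_in_Mq: "w \<in> U \<inter> Zs \<Longrightarrow> \<alpha> \<in> A \<Longrightarrow> jet \<alpha> i w \<in> hcar Mq"
  by (simp add: car_Mq jet_mem jet_orthogonal_vanishing)

text \<open>
  By induction on \<open>|\<alpha>|\<close>: once the lower derivatives vanish, \<open>leibniz_leading\<close> leaves the product of
  the transition matrix with the vector of the derivatives of order \<open>\<alpha>\<close>.
\<close>

lemma conj_coord_deriv_vanish:
  assumes w: "w \<in> U" and h: "h \<in> hcar M"
    and orth: "\<And>\<alpha> i. \<alpha> \<in> A \<Longrightarrow> hip M (jet \<alpha> i w) h = 0"
  shows "\<alpha> \<in> A \<Longrightarrow> multi_deriv partial \<alpha> (conj_coord h j) w = 0"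
proof (induction "\<Sum>i\<in>UNIV. \<alpha> i" arbitrary: \<alpha> j rule: less_induct)
  case less
  have lower: "multi_deriv partial \<beta> (conj_coord h j) w = 0" if "\<beta> \<le> \<alpha>" "\<beta> \<noteq> \<alpha>" for \<beta> j
    using less multi_index_sum_less[OF that] multi_indices_below_mono that(1) by blast
  have "(\<Sum>j\<in>UNIV. transition i j w * multi_deriv partial \<alpha> (conj_coord h j) w) = 0" for i
    using hip_jet_sum[OF w h, of \<alpha> i] orth[OF less.prems]
      leibniz_leading[OF open_U transition_line_holomorphic conj_coord_line_holomorphic_U[OF h] w lower]
    by simp
  then show ?case by (rule transition_nonsingular[OF w])
qed

text \<open>
  The jets near the origin determine the submodule, since the derivatives of \<open>h\<close> on \<open>\<Z>\<close> are
  governed by their values near \<open>0\<close>.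
\<close>

lemma vanishing_if_orthogonal:
  assumes h: "h \<in> hcar M" and \<epsilon>: "\<epsilon> > 0"
    and orth: "\<And>w \<alpha> i. w \<in> Zs \<Longrightarrow> norm w < \<epsilon> \<Longrightarrow> w \<in> U \<Longrightarrow> \<alpha> \<in> A \<Longrightarrow> hip M (jet \<alpha> i w) h = 0"
  shows "h \<in> M0"
proof -
  obtain \<delta> where \<delta>: "\<delta> > 0" "ball 0 \<delta> \<subseteq> U" using open_U zero_U open_contains_ball by blast
  have "multi_deriv partial \<alpha> (\<lambda>z. h z $ j) z = 0" if \<alpha>: "\<alpha> \<in> A" and z: "z \<in> zero_locus \<Omega> J" for \<alpha> j z
  proof (rule zero_locus_identity[OF open_\<Omega> connected_Z _ zero_\<Omega> _ _ z])
    show "line_holomorphic_on (multi_deriv partial \<alpha> (\<lambda>z. h z $ j)) \<Omega>"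
      by (rule line_holomorphic_multi_deriv[OF open_\<Omega> module_line_holomorphic[OF h]])
    show "0 < min \<epsilon> \<delta>" using \<epsilon> \<delta> by simp
    fix z assume z: "z \<in> zero_locus \<Omega> J" "norm z < min \<epsilon> \<delta>"
    then have w: "vcnj z \<in> Zs" "vcnj z \<in> U" "norm (vcnj z) < \<epsilon>"
      using \<delta>(2) by (auto simp: Zs_iff subset_iff)
    have "multi_deriv partial \<alpha> (conj_coord h j) (vcnj z) = 0"
      by (rule conj_coord_deriv_vanish[OF w(2) h orth[OF w(1,3,2)] \<alpha>])
    then show "multi_deriv partial \<alpha> (\<lambda>z. h z $ j) z = 0"
      using conj_coord_deriv[OF h, of "vcnj z" \<alpha> j] U_sub w(2) by auto
  qed
  then show ?thesis using h unfolding vanishing_submodule_def by blast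
qed

lemma total_in_Mq:
  assumes h: "h \<in> hcar Mq" and \<epsilon>: "\<epsilon> > 0"
    and orth: "\<And>w \<alpha> i. w \<in> Zs \<Longrightarrow> norm w < \<epsilon> \<Longrightarrow> w \<in> U \<Longrightarrow> \<alpha> \<in> A \<Longrightarrow> hip M (jet \<alpha> i w) h = 0"
  shows "h = 0"
proof -
  have "h \<in> M0" by (rule vanishing_if_orthogonal[OF Mq_mem[OF h] \<epsilon> orth])
  then have "hip M h h = 0" using h by (simp add: car_Mq)
  then show ?thesis using hip_pos Mq_mem[OF h] by (metis less_irrefl zero_complex.simps(1))
qed

lemma hproj_Mq:
  assumes "h \<in> hcar M"
  shows "hproj M (hcar Mq) h \<in> hcar Mq" "\<And>n. n \<in> hcar Mq \<Longrightarrow> hip M (h - hproj M (hcar Mq) h) n = 0"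
proof -
  interpret Q: hilbert Mq by (rule hilbert_Mq)
  have Q: "hilbert_space (M\<lparr>hcar := hcar Mq\<rparr>)"
    using Q.hilbert_space by (simp add: quotient_space_def)
  have sub: "hcar Mq \<subseteq> hcar M" using Mq_mem by blast
  obtain g where g: "g \<in> hcar Mq" "\<And>n. n \<in> hcar Mq \<Longrightarrow> hip M (h - g) n = 0"
    using projection[OF Q sub assms] by blast
  have "hproj M (hcar Mq) h = g"
    unfolding hproj_def
  proof (rule the_equality)
    fix g' assume g': "g' \<in> hcar Mq \<and> (\<forall>n\<in>hcar Mq. hip M (h - g') n = 0)"
    have "hip M h (g - g') = hip M g (g - g')" "hip M h (g - g') = hip M g' (g - g')"
      using g g' assms Mq_mem Q.diff_mem[of g g'] by (auto simp: hip_diff_left)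
    then have "hip M (g - g') (g - g') = 0" using g g' Mq_mem by (simp add: hip_diff_left)
    then show "g' = g" using eq_if_hip_diff_0[of g g'] g g' Mq_mem by simp
  qed (use g in blast)
  then show "hproj M (hcar Mq) h \<in> hcar Mq" "\<And>n. n \<in> hcar Mq \<Longrightarrow> hip M (h - hproj M (hcar Mq) h) n = 0"
    using g by auto
qed

lemma quotient_action_mem:
  "f \<in> alg \<Omega> \<Longrightarrow> h \<in> hcar Mq \<Longrightarrow> quotient_action \<Omega> J k M f h \<in> hcar Mq"
  unfolding quotient_action_def by (intro hproj_Mq fmult_mem Mq_mem)

lemma hip_quotient_action:
  assumes "f \<in> alg \<Omega>" "h \<in> hcar Mq" "n \<in> hcar Mq"
  shows "hip M (quotient_action \<Omega> J k M f h) n = hip M (fmult f h) n"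
proof -
  have f: "fmult f h \<in> hcar M" using assms fmult_mem Mq_mem by blast
  from hproj_Mq(2)[OF f assms(3)] show ?thesis
    unfolding quotient_action_def
    using hip_diff_left[OF f Mq_mem[OF hproj_Mq(1)[OF f]] Mq_mem[OF assms(3)]] by simp
qed

lemma symbol_line_holomorphic:
  assumes "f \<in> alg \<Omega>"
  shows "line_holomorphic_on (\<lambda>w. cnj (f (vcnj w))) (vcnj ` \<Omega>)"
  by (rule line_holomorphic_cnj[OF alg_line_holomorphic[OF assms open_\<Omega>]])

lemma conj_coord_fmult: "conj_coord (fmult f h) j w = cnj (f (vcnj w)) * conj_coord h j w"
  by (simp add: conj_coord_def fmult_def)

lemma hip_section_fmult:
  assumes "f \<in> alg \<Omega>" "w \<in> U" "h \<in> hcar M"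
  shows "hip M (s i w) (fmult f h) = cnj (f (vcnj w)) * hip M (s i w) h"
  by (simp add: hip_section assms fmult_mem conj_coord_fmult sum_distrib_left mult.left_commute)

lemma hip_jet_fmult:
  assumes "f \<in> alg \<Omega>" "w \<in> U" "h \<in> hcar M"
  shows "hip M (jet \<alpha> i w) (fmult f h) =
    multi_deriv partial \<alpha> (\<lambda>w. cnj (f (vcnj w)) * hip M (s i w) h) w"
  unfolding hip_jet[OF assms(2) fmult_mem[OF assms(1,3)]]
  by (rule multi_deriv_cong[OF open_U _ assms(2)]) (rule hip_section_fmult[OF assms(1) _ assms(3)])

lemma hip_jet_coord:
  assumes "w \<in> U" "h \<in> hcar M"
  shows "hip M (jet \<alpha> i w) (fmult (\<lambda>z. z $ l) h) =
    w $ l * hip M (jet \<alpha> i w) h + of_nat (\<alpha> l) * hip M (jet (\<alpha>(l := \<alpha> l - 1)) i w) h"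
proof -
  have "(\<lambda>w. cnj (vcnj w $ l) * hip M (s i w) h) = (\<lambda>w. w $ l * hip M (s i w) h)"
    by (simp add: vcnj_def)
  then show ?thesis
    unfolding hip_jet_fmult[OF coord_in_alg assms]
    using multi_deriv_coord_mult[OF open_U hip_section_line_holomorphic[OF assms(2)] assms(1)]
    by (simp add: hip_jet assms)
qed

lemma vanishing_fmult:
  assumes "f \<in> alg \<Omega>" "h \<in> M0"
  shows "fmult f h \<in> M0"
proof -
  have h: "h \<in> hcar M" using assms(2) vanishing_subset by blast
  have "multi_deriv partial \<alpha> (conj_coord (fmult f h) j) w = 0" if "\<alpha> \<in> A" "w \<in> Zs" for \<alpha> j w
  proof -
    have "conj_coord (fmult f h) j = (\<lambda>w. cnj (f (vcnj w)) * conj_coord h j w)"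
      by (simp add: conj_coord_fmult fun_eq_iff)
    moreover have "w \<in> vcnj ` \<Omega>" using that(2) by (simp add: zero_locus_def)
    ultimately show ?thesis
      using leibniz_vanishing[OF open_U' symbol_line_holomorphic[OF assms(1)] conj_coord_line_holomorphic[OF h]]
        that assms(2) vanishing_iff by simp
  qed
  then show ?thesis using vanishing_iff fmult_mem[OF assms(1) h] by blast
qed

text \<open>
  The submodule is its own double orthogonal complement, being cut out by jets, which lie in the
  quotient.
\<close>

lemma residual_vanishing:
  assumes "h \<in> hcar M"
  shows "h - hproj M (hcar Mq) h \<in> M0"
proof (rule vanishing_if_orthogonal[OF _ zero_less_one])
  have m: "hproj M (hcar Mq) h \<in> hcar M" by (rule Mq_mem[OF hproj_Mq(1)[OF assms]])
  show *: "h - hproj M (hcar Mq) h \<in> hcar M" using assms m by simp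
  fix w \<alpha> i assume "w \<in> Zs" "w \<in> U" "\<alpha> \<in> A"
  then have "jet \<alpha> i w \<in> hcar Mq" by (intro jet_in_Mq) auto
  then show "hip M (jet \<alpha> i w) (h - hproj M (hcar Mq) h) = 0"
    using hproj_Mq(2)[OF assms] hip_cnj[OF * Mq_mem] by (metis complex_cnj_zero)
qed

text \<open>
  Elements of the quotient are orthogonal to the submodule, which is invariant under the action.
\<close>

lemma hip_fmult_hproj:
  assumes "f \<in> alg \<Omega>" "h \<in> hcar M" "g \<in> hcar Mq"
  shows "hip M g (fmult f h) = hip M g (fmult f (hproj M (hcar Mq) h))"
proof -
  let ?P = "hproj M (hcar Mq) h"
  have P: "?P \<in> hcar M" by (rule Mq_mem[OF hproj_Mq(1)[OF assms(2)]])
  have "fmult f (h - ?P) \<in> M0" by (rule vanishing_fmult[OF assms(1) residual_vanishing[OF assms(2)]])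
  moreover have "fmult f (h - ?P) = fmult f h - fmult f ?P"
    by (simp add: fmult_def fun_eq_iff vector_ssub_ldistrib)
  ultimately have "hip M g (fmult f h - fmult f ?P) = 0" using assms(3) by (simp add: car_Mq)
  then show ?thesis using hip_diff_right[OF fmult_mem[OF assms(1,2)] fmult_mem[OF assms(1) P] Mq_mem[OF assms(3)]]
    by simp
qed

text \<open>
  The hypothesis says that \<open>w\<^sub>l g\<close> represents \<open>h \<mapsto> \<langle>z\<^sub>l h, g\<rangle>\<close>; it is then the value at \<open>g\<close> of the
  adjoint, which is defined by that property.
\<close>

lemma fibreI:
  assumes g: "g \<in> hcar M"
    and eig: "\<And>l h. h \<in> hcar M \<Longrightarrow> hip M g (fmult (\<lambda>z. z $ l) h) = w $ l * hip M g h"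
  shows "g \<in> fibre M w"
proof -
  have "mult_adjoint M l g = fscale (w $ l) g" for l
    unfolding mult_adjoint_def hadjoint_def
  proof (rule the_equality)
    have *: "hip M (fmult (\<lambda>z. z $ l) h) g = hip M h (fscale (w $ l) g)" if "h \<in> hcar M" for h
      using arg_cong[OF eig[OF that, of l], of cnj] hip_cnj g that fmult_mem[OF coord_in_alg that]
      by (simp add: hip_scale_right)
    then show "fscale (w $ l) g \<in> hcar M \<and> (\<forall>h\<in>hcar M. hip M (fmult (\<lambda>z. z $ l) h) g = hip M h (fscale (w $ l) g))"
      using g by simp
    fix g' assume g': "g' \<in> hcar M \<and> (\<forall>h\<in>hcar M. hip M (fmult (\<lambda>z. z $ l) h) g = hip M h g')"
    let ?d = "g' - fscale (w $ l) g"
    have "hip M ?d g' = hip M ?d (fscale (w $ l) g)" using g g' * by (metis diff_mem scale_mem)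
    then have "hip M ?d ?d = 0" using g g' by (simp add: hip_diff_right)
    then show "g' = fscale (w $ l) g"
      using g g' by (intro eq_if_hip_diff_0) simp_all
  qed
  then show ?thesis using g by (simp add: fibre_def)
qed

lemma frame_normalized:
  assumes "w \<in> U \<inter> Zs"
  shows "hip M (s i w) (s j 0) = (if i = j then 1 else 0)"
    and "\<alpha> \<in> multi_indices J \<Longrightarrow> \<alpha> \<noteq> (\<lambda>_. 0) \<Longrightarrow> hip M (jet \<alpha> i w) (s j 0) = 0"
  using frame assms unfolding normalized_frame_def by blast+

text \<open>
  Normalization makes the vectors \<open>s\<^sub>j(0)\<close> dual to the basis \<open>s\<^sub>i(w)\<close> of the fibre at each point of \<open>\<Z>\<^sup>*\<close>.
\<close>

lemma fibre_expansion:
  assumes w: "w \<in> U \<inter> Zs" and g: "g \<in> fibre M w"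
  shows "g = (\<Sum>i\<in>UNIV. fscale (hip M g (s i 0)) (s i w))"
proof -
  have inj: "inj (\<lambda>i. s i w)" and span: "cfun.span (range (\<lambda>i. s i w)) = fibre M w"
    using frame w unfolding normalized_frame_def holomorphic_frame_def by auto
  have wU: "w \<in> U" using w by blast
  obtain u where "g = (\<Sum>x\<in>range (\<lambda>i. s i w). fscale (u x) x)"
    using g unfolding span[symmetric] by (subst (asm) cfun.span_finite) auto
  also have "\<dots> = (\<Sum>i\<in>UNIV. fscale (u (s i w)) (s i w))" by (subst sum.reindex[OF inj]) simp
  finally have gu: "g = (\<Sum>i\<in>UNIV. fscale (u (s i w)) (s i w))" .
  have "hip M g (s j 0) = u (s j w)" for j
    unfolding gu using section_mem[OF zero_U, of j] section_mem[OF wU] frame_normalized(1)[OF w]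
    by (simp add: hip_sum_left hip_scale_left if_distrib[of "(*) _"] cong: if_cong)
  then show ?thesis using gu by simp
qed

lemma jet_zero: "jet (\<lambda>_. 0) i w = s i w"
  by (simp add: multi_deriv_zero)

lemma zero_in_UZs: "0 \<in> U \<inter> Zs"
  using zero_U U_sub by (auto simp: zero_locus_def)

end

section \<open>Unitary matrices\<close>

lemma unitary_matrix_iff:
  "unitary_matrix D \<longleftrightarrow>
    (\<forall>i j. (\<Sum>l\<in>UNIV. D $ i $ l * cnj (D $ j $ l)) = (if i = j then 1 else 0))"
proof -
  have "D ** adj_matrix D = mat 1 \<longleftrightarrow>
      (\<forall>i j. (\<Sum>l\<in>UNIV. D $ i $ l * cnj (D $ j $ l)) = (if i = j then 1 else 0))"
    by (simp add: vec_eq_iff matrix_matrix_mult_def adj_matrix_def mat_def)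
  then show ?thesis unfolding unitary_matrix_def using matrix_left_right_inverse by blast
qed

lemma unitary_matrix_columns:
  assumes "unitary_matrix D"
  shows "(\<Sum>l\<in>UNIV. cnj (D $ l $ i) * D $ l $ j) = (if i = j then 1 else 0)"
proof -
  have "(adj_matrix D ** D) $ i $ j = mat 1 $ i $ j" using assms by (simp add: unitary_matrix_def)
  then show ?thesis by (simp add: matrix_matrix_mult_def adj_matrix_def mat_def)
qed

lemma conjugation_component:
  "(D ** G ** adj_matrix D) $ i $ j = (\<Sum>a\<in>UNIV. \<Sum>b\<in>UNIV. D $ i $ a * cnj (D $ j $ b) * G $ a $ b)"
proof -
  have "(D ** G ** adj_matrix D) $ i $ j = (\<Sum>b\<in>UNIV. (\<Sum>a\<in>UNIV. D $ i $ a * G $ a $ b) * cnj (D $ j $ b))"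
    by (simp add: matrix_matrix_mult_def adj_matrix_def)
  also have "\<dots> = (\<Sum>b\<in>UNIV. \<Sum>a\<in>UNIV. D $ i $ a * cnj (D $ j $ b) * G $ a $ b)"
    by (simp add: sum_distrib_left sum_distrib_right mult_ac)
  finally show ?thesis by (subst sum.swap)
qed

section \<open>Two modules\<close>

locale framed_module_pair =
  L: framed_module \<Omega> U M s J k + R: framed_module \<Omega> U M' s' J k
  for \<Omega> U :: "'m::{finite,linorder} cvec set"
    and M M' :: "('m cvec \<Rightarrow> 'r::finite cvec) hspace"
    and s s' :: "'r \<Rightarrow> 'm cvec \<Rightarrow> ('m cvec \<Rightarrow> 'r cvec)"
    and J :: "'m set" and k :: nat
begin

text \<open>
  Joint eigenvectors go to joint eigenvectors, which settles order zero; normalization makes the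
  resulting matrix constant.  For higher order, the difference of the two sides is a joint eigenvector
  by induction, and it is orthogonal to the frame at the origin.
\<close>

lemma jets_intertwined:
  assumes k: "1 \<le> k"
    and T_bij: "bij_betw T (hcar L.Mq) (hcar R.Mq)"
    and T_iso: "\<And>g h. g \<in> hcar L.Mq \<Longrightarrow> h \<in> hcar L.Mq \<Longrightarrow> hip M' (T g) (T h) = hip M g h"
    and T_act: "\<And>f h. f \<in> alg \<Omega> \<Longrightarrow> h \<in> hcar L.Mq \<Longrightarrow>
      T (quotient_action \<Omega> J k M f h) = quotient_action \<Omega> J k M' f (T h)"
  shows "\<exists>D. unitary_matrix D \<and> (\<forall>\<alpha>\<in>L.A. \<forall>i. \<forall>w\<in>U \<inter> L.Zs.
    T (L.jet \<alpha> i w) = (\<Sum>j\<in>UNIV. fscale (D $ i $ j) (R.jet \<alpha> j w)))"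
proof -
  have Tmem: "T h \<in> hcar R.Mq" if "h \<in> hcar L.Mq" for h
    using T_bij that bij_betwE by blast
  have TM: "T h \<in> hcar M'" if "h \<in> hcar L.Mq" for h using R.Mq_mem[OF Tmem[OF that]] .
  interpret LQ: hilbert L.Mq by (rule L.hilbert_Mq)
  interpret RQ: hilbert R.Mq by (rule R.hilbert_Mq)
  have zeroA: "(\<lambda>_. 0) \<in> L.A" using k by (simp add: multi_indices_below_def multi_indices_def)
  note sLQ = L.jet_in_Mq[OF _ zeroA, unfolded L.jet_zero]
  note sRQ = R.jet_in_Mq[OF _ zeroA, unfolded R.jet_zero]
  note O = L.zero_in_UZs
  \<comment> \<open>Between vectors of the quotients, pairing with \<open>fmult f\<close> is pairing with the compressed action.\<close>
  have T_fmult: "hip M' (T g) (fmult f (T u)) = hip M g (fmult f u)"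
    if f: "f \<in> alg \<Omega>" and g: "g \<in> hcar L.Mq" and u: "u \<in> hcar L.Mq" for f g u
  proof -
    have "hip M' (fmult f (T u)) (T g) = hip M' (quotient_action \<Omega> J k M' f (T u)) (T g)"
      by (rule R.hip_quotient_action[OF f Tmem[OF u] Tmem[OF g], symmetric])
    also have "\<dots> = hip M' (T (quotient_action \<Omega> J k M f u)) (T g)" using T_act[OF f u] by simp
    also have "\<dots> = hip M (quotient_action \<Omega> J k M f u) g"
      by (rule T_iso[OF L.quotient_action_mem[OF f u] g])
    also have "\<dots> = hip M (fmult f u) g" by (rule L.hip_quotient_action[OF f u g])
    finally show ?thesis
      using L.hip_cnj[OF L.fmult_mem[OF f L.Mq_mem[OF u]] L.Mq_mem[OF g]]
        R.hip_cnj[OF R.fmult_mem[OF f TM[OF u]] TM[OF g]] by simp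
  qed
  have reduce: "\<exists>u\<in>hcar L.Mq. T u = hproj M' (hcar R.Mq) h" if "h \<in> hcar M'" for h
    using T_bij R.hproj_Mq(1)[OF that] unfolding bij_betw_def by (metis (no_types, lifting) imageE)
  have proj: "hip M' g (hproj M' (hcar R.Mq) h) = hip M' g h" if g: "g \<in> hcar R.Mq" and h: "h \<in> hcar M'" for g h
  proof -
    have "h - hproj M' (hcar R.Mq) h \<in> hcar M'" using h R.Mq_mem[OF R.hproj_Mq(1)[OF h]] by simp
    then have "hip M' g (h - hproj M' (hcar R.Mq) h) = 0"
      using R.hproj_Mq(2)[OF h g] R.hip_cnj R.Mq_mem[OF g] by (metis complex_cnj_zero)
    then show ?thesis using R.hip_diff_right[OF h R.Mq_mem[OF R.hproj_Mq(1)[OF h]] R.Mq_mem[OF g]] by simp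
  qed
  have T_jet_coord: "hip M' (T (L.jet \<alpha> i w)) (fmult (\<lambda>z. z $ l) h) =
      w $ l * hip M' (T (L.jet \<alpha> i w)) h
      + of_nat (\<alpha> l) * hip M' (T (L.jet (\<alpha>(l := \<alpha> l - 1)) i w)) h"
    if w: "w \<in> U \<inter> L.Zs" and \<alpha>: "\<alpha> \<in> L.A" and h: "h \<in> hcar M'" for \<alpha> i w l h
  proof -
    \<comment> \<open>Only the class of \<open>h\<close> modulo the submodule matters, and that class is in the image of \<open>T\<close>.\<close>
    obtain u where u: "u \<in> hcar L.Mq" "T u = hproj M' (hcar R.Mq) h" using reduce[OF h] by blast
    have \<alpha>': "\<alpha>(l := \<alpha> l - 1) \<in> L.A"
      by (rule multi_indices_below_mono[OF \<alpha>]) (simp add: le_fun_def)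
    note m = L.jet_in_Mq[OF w \<alpha>, of i] L.jet_in_Mq[OF w \<alpha>', of i]
    have TT: "hip M' (T g) h = hip M g u" if "g \<in> hcar L.Mq" for g
      using proj[OF Tmem[OF that] h] T_iso[OF that u(1)] u(2) by simp
    have "hip M' (T (L.jet \<alpha> i w)) (fmult (\<lambda>z. z $ l) h) = hip M' (T (L.jet \<alpha> i w)) (fmult (\<lambda>z. z $ l) (T u))"
      unfolding u(2) by (rule R.hip_fmult_hproj[OF coord_in_alg h Tmem[OF m(1)]])
    also have "\<dots> = hip M (L.jet \<alpha> i w) (fmult (\<lambda>z. z $ l) u)"
      by (rule T_fmult[OF coord_in_alg m(1) u(1)])
    also have "\<dots> = w $ l * hip M (L.jet \<alpha> i w) u + of_nat (\<alpha> l) * hip M (L.jet (\<alpha>(l := \<alpha> l - 1)) i w) u"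
      by (rule L.hip_jet_coord) (use w u L.Mq_mem in auto)
    finally show ?thesis using TT[OF m(1)] TT[OF m(2)] by simp
  qed
  define D :: "complex^'r^'r" where "D = (\<chi> i j. hip M' (T (s i 0)) (s' j 0))"
  define \<phi> where "\<phi> i j w = hip M' (T (s i w)) (s' j 0)" for i j w
  have T_section: "T (s i w) = (\<Sum>j\<in>UNIV. fscale (\<phi> i j w) (s' j w))" if w: "w \<in> U \<inter> L.Zs" for i w
  proof -
    have "T (s i w) \<in> fibre M' w"
      using T_jet_coord[OF w zeroA, of _ i] by (intro R.fibreI TM sLQ w) (simp add: L.jet_zero)
    from R.fibre_expansion[OF w this] show ?thesis by (simp add: \<phi>_def)
  qed
  \<comment> \<open>This is \<open>\<phi>(w) \<phi>(0)\<^sup>* = 1\<close>, obtained by pairing with the values at the origin, where both frames are dual.\<close>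
  have orth: "(\<Sum>j\<in>UNIV. \<phi> i j w * cnj (\<phi> l j 0)) = (if i = l then 1 else 0)" if w: "w \<in> U \<inter> L.Zs" for i l w
  proof -
    have m: "s' j w \<in> hcar M'" "s' j 0 \<in> hcar M'" for j
      using R.Mq_mem[OF sRQ[OF w]] R.Mq_mem[OF sRQ[OF O]] by auto
    have "hip M' (T (s i w)) (T (s l 0)) = hip M (s i w) (s l 0)"
      by (rule T_iso[OF sLQ[OF w] sLQ[OF O]])
    also have "\<dots> = (if i = l then 1 else 0)" by (rule L.frame_normalized(1)[OF w])
    also have "hip M' (T (s i w)) (T (s l 0)) =
        (\<Sum>a\<in>UNIV. \<Sum>b\<in>UNIV. \<phi> i a w * cnj (\<phi> l b 0) * hip M' (s' a w) (s' b 0))"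
      unfolding T_section[OF w] T_section[OF O] by (rule R.hip_combinations[OF m])
    also have "\<dots> = (\<Sum>b\<in>UNIV. \<phi> i b w * cnj (\<phi> l b 0))"
      by (simp add: R.frame_normalized(1)[OF w] if_distrib[of "(*) _"] cong: if_cong)
    finally show ?thesis .
  qed
  have D\<phi>: "D $ i $ j = \<phi> i j 0" for i j by (simp add: D_def \<phi>_def)
  have D: "unitary_matrix D"
    unfolding unitary_matrix_iff D\<phi> using orth[OF O] by blast
  \<comment> \<open>Multiply \<open>\<phi>(w) D\<^sup>* = 1\<close> by \<open>D\<close> on the right.\<close>
  have const: "\<phi> i j w = D $ i $ j" if w: "w \<in> U \<inter> L.Zs" for i j w
  proof -
    have "(\<Sum>l\<in>UNIV. (\<Sum>b\<in>UNIV. \<phi> i b w * cnj (D $ l $ b)) * D $ l $ j) =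
        (\<Sum>b\<in>UNIV. \<phi> i b w * (\<Sum>l\<in>UNIV. cnj (D $ l $ b) * D $ l $ j))"
      by (simp add: sum_distrib_left sum_distrib_right mult.assoc) (rule sum.swap)
    also have "\<dots> = \<phi> i j w"
      by (simp add: unitary_matrix_columns[OF D] if_distrib[of "(*) _"] cong: if_cong)
    also have "(\<Sum>l\<in>UNIV. (\<Sum>b\<in>UNIV. \<phi> i b w * cnj (D $ l $ b)) * D $ l $ j) = D $ i $ j"
      unfolding D\<phi> orth[OF w] by (simp add: if_distrib[of "\<lambda>x. x * _"] cong: if_cong)
    finally show ?thesis by simp
  qed
  have T_section': "T (s i w) = (\<Sum>j\<in>UNIV. fscale (D $ i $ j) (s' j w))" if w: "w \<in> U \<inter> L.Zs" for i w
    using T_section[OF w] const[OF w] by simp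
  have s'0: "s' j 0 = (\<Sum>i\<in>UNIV. fscale (cnj (D $ i $ j)) (T (s i 0)))" for j
  proof -
    have "(\<Sum>i\<in>UNIV. fscale (cnj (D $ i $ j)) (T (s i 0))) =
        (\<Sum>i\<in>UNIV. \<Sum>l\<in>UNIV. fscale (cnj (D $ i $ j) * D $ i $ l) (s' l 0))"
      unfolding T_section'[OF O] by (simp add: cfun.scale_sum_right)
    also have "\<dots> = (\<Sum>l\<in>UNIV. fscale (\<Sum>i\<in>UNIV. cnj (D $ i $ j) * D $ i $ l) (s' l 0))"
      by (subst sum.swap) (simp only: cfun.scale_sum_left)
    also have "\<dots> = (\<Sum>l\<in>UNIV. if j = l then s' l 0 else 0)"
      unfolding unitary_matrix_columns[OF D] by (rule sum.cong) (simp_all del: zero_fun_apply)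
    also have "\<dots> = s' j 0" by simp
    finally show ?thesis by simp
  qed
  have main: "T (L.jet \<alpha> i w) = (\<Sum>j\<in>UNIV. fscale (D $ i $ j) (R.jet \<alpha> j w))"
    if "\<alpha> \<in> L.A" and w: "w \<in> U \<inter> L.Zs" for \<alpha> i w
    using that(1)
  proof (induction "\<Sum>i\<in>UNIV. \<alpha> i" arbitrary: \<alpha> rule: less_induct)
    case less
    note \<alpha> = less.prems
    show ?case
    proof (cases "\<alpha> = (\<lambda>_. 0)")
      case True
      then show ?thesis using T_section'[OF w] by (simp only: L.jet_zero R.jet_zero)
    next
      case False
      let ?R = "\<lambda>\<alpha>. \<Sum>j\<in>UNIV. fscale (D $ i $ j) (R.jet \<alpha> j w)"
      have wU: "w \<in> U" using w by blast
      have RM: "?R \<beta> \<in> hcar M'" for \<beta>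
        by (intro R.sum_mem R.scale_mem R.jet_mem wU)
      have hipR: "hip M' (?R \<beta>) h = (\<Sum>j\<in>UNIV. D $ i $ j * hip M' (R.jet \<beta> j w) h)" if "h \<in> hcar M'" for h \<beta>
        using that R.jet_mem[OF wU] by (simp add: R.hip_sum_left R.hip_scale_left)
      let ?v = "T (L.jet \<alpha> i w) - ?R \<alpha>"
      note TJ = TM[OF L.jet_in_Mq[OF w \<alpha>]]
      have vM: "?v \<in> hcar M'" using TJ RM by simp
      have "?v \<in> fibre M' w"
      proof (rule R.fibreI[OF vM])
        fix l h assume h: "h \<in> hcar M'"
        let ?\<alpha>' = "\<alpha>(l := \<alpha> l - 1)"
        \<comment> \<open>For \<open>\<alpha> l = 0\<close> the index \<open>?\<alpha>'\<close> is \<open>\<alpha>\<close> itself and the induction hypothesis is void, but the factor is zero.\<close>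
        have IH: "of_nat (\<alpha> l) * hip M' (T (L.jet ?\<alpha>' i w)) h = of_nat (\<alpha> l) * hip M' (?R ?\<alpha>') h"
        proof (cases "\<alpha> l = 0")
          case False
          have le: "?\<alpha>' \<le> \<alpha>" "?\<alpha>' \<noteq> \<alpha>"
            using False by (auto simp: le_fun_def fun_eq_iff)
          show ?thesis
            using less.hyps[OF multi_index_sum_less[OF le] multi_indices_below_mono[OF \<alpha> le(1)]] by simp
        qed simp
        have "hip M' (?R \<alpha>) (fmult (\<lambda>z. z $ l) h) = w $ l * hip M' (?R \<alpha>) h + of_nat (\<alpha> l) * hip M' (?R ?\<alpha>') h"
          unfolding hipR[OF h] hipR[OF R.fmult_mem[OF coord_in_alg h]] R.hip_jet_coord[OF wU h]
          by (simp add: sum_distrib_left distrib_left sum.distrib mult.left_commute)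
        then show "hip M' ?v (fmult (\<lambda>z. z $ l) h) = w $ l * hip M' ?v h"
          using T_jet_coord[OF w \<alpha> h, of i l] IH
            R.hip_diff_left[OF TJ RM h] R.hip_diff_left[OF TJ RM R.fmult_mem[OF coord_in_alg h]]
          by (simp add: right_diff_distrib)
      qed
      then have vexp: "?v = (\<Sum>j\<in>UNIV. fscale (hip M' ?v (s' j 0)) (s' j w))"
        by (rule R.fibre_expansion[OF w])
      have "hip M' ?v (s' j 0) = 0" for j
      proof -
        have mi: "\<alpha> \<in> multi_indices J" using \<alpha> by (simp add: multi_indices_below_def)
        have Ts: "T (s i 0) \<in> hcar M'" for i by (rule TM[OF sLQ[OF O]])
        have s'm: "s' j 0 \<in> hcar M'" by (rule R.Mq_mem[OF sRQ[OF O]])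
        \<comment> \<open>Both terms of \<open>?v\<close> are orthogonal to the frame at the origin: the first one through \<open>T\<close>, the second one directly.\<close>
        have "hip M' (T (L.jet \<alpha> i w)) (s' j 0) = (\<Sum>l\<in>UNIV. D $ l $ j * hip M' (T (L.jet \<alpha> i w)) (T (s l 0)))"
          unfolding s'0[of j] using Ts TJ by (simp add: R.hip_sum_right R.hip_scale_right)
        also have "\<dots> = (\<Sum>l\<in>UNIV. D $ l $ j * hip M (L.jet \<alpha> i w) (s l 0))"
          using T_iso[OF L.jet_in_Mq[OF w \<alpha>] sLQ[OF O]] by simp
        also have "\<dots> = 0" using L.frame_normalized(2)[OF w mi False] by simp
        finally have "hip M' (T (L.jet \<alpha> i w)) (s' j 0) = 0" .
        moreover have "hip M' (?R \<alpha>) (s' j 0) = 0"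
          using hipR[OF s'm] R.frame_normalized(2)[OF w mi False] by simp
        ultimately show ?thesis using R.hip_diff_left[OF TJ RM s'm] by simp
      qed
      then have "?v = 0" using vexp by (simp only: cfun.scale_zero_left sum.neutral_const)
      then show ?thesis by simp
    qed
  qed
  show ?thesis using D main by blast
qed

lemma equivalent_imp_gramian:
  assumes k: "1 \<le> k"
    and eq: "unitarily_equivalent (alg \<Omega>) L.Mq (quotient_action \<Omega> J k M) R.Mq (quotient_action \<Omega> J k M')"
  shows "\<exists>D. unitary_matrix D \<and> (\<forall>\<alpha>\<in>L.A. \<forall>\<beta>\<in>L.A. \<forall>w\<in>L.Zs \<inter> U.
    gramian_deriv \<alpha> \<beta> (gramian M s) w = D ** gramian_deriv \<alpha> \<beta> (gramian M' s') w ** adj_matrix D)"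
proof -
  from eq obtain T where T: "bij_betw T (hcar L.Mq) (hcar R.Mq)"
    "\<forall>g\<in>hcar L.Mq. \<forall>h\<in>hcar L.Mq. hip M' (T g) (T h) = hip M g h"
    "\<forall>f\<in>alg \<Omega>. \<forall>h\<in>hcar L.Mq. T (quotient_action \<Omega> J k M f h) = quotient_action \<Omega> J k M' f (T h)"
    unfolding unitarily_equivalent_def L.hip_Mq R.hip_Mq by (elim exE conjE) (rule that)
  obtain D where D: "unitary_matrix D"
    "\<And>\<alpha> i w. \<alpha> \<in> L.A \<Longrightarrow> w \<in> U \<inter> L.Zs \<Longrightarrow>
      T (L.jet \<alpha> i w) = (\<Sum>j\<in>UNIV. fscale (D $ i $ j) (R.jet \<alpha> j w))"
    using jets_intertwined[OF k T(1) T(2)[rule_format] T(3)[rule_format]]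
    by blast
  have "gramian_deriv \<alpha> \<beta> (gramian M s) w = D ** gramian_deriv \<alpha> \<beta> (gramian M' s') w ** adj_matrix D"
    if \<alpha>: "\<alpha> \<in> L.A" and \<beta>: "\<beta> \<in> L.A" and w': "w \<in> L.Zs \<inter> U" for \<alpha> \<beta> w
  proof -
    have w: "w \<in> U \<inter> L.Zs" "w \<in> U" using w' by auto
    have "gramian_deriv \<alpha> \<beta> (gramian M s) w $ i $ j =
        (D ** gramian_deriv \<alpha> \<beta> (gramian M' s') w ** adj_matrix D) $ i $ j" for i j
    proof -
      have "hip M (L.jet \<alpha> i w) (L.jet \<beta> j w) = hip M' (T (L.jet \<alpha> i w)) (T (L.jet \<beta> j w))"
        using T(2)[rule_format, OF L.jet_in_Mq[OF w(1) \<alpha>] L.jet_in_Mq[OF w(1) \<beta>]] by simp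
      also have "\<dots> = (\<Sum>a\<in>UNIV. \<Sum>b\<in>UNIV. D $ i $ a * cnj (D $ j $ b) * hip M' (R.jet \<alpha> a w) (R.jet \<beta> b w))"
        unfolding D(2)[OF \<alpha> w(1)] D(2)[OF \<beta> w(1)]
        by (rule R.hip_combinations[OF R.jet_mem[OF w(2)] R.jet_mem[OF w(2)]])
      finally show ?thesis
        unfolding conjugation_component L.gramian_deriv_jets[OF w(2)] R.gramian_deriv_jets[OF w(2)] .
    qed
    then show ?thesis by (simp add: vec_eq_iff)
  qed
  then show ?thesis using D(1) by blast
qed

lemma gramian_imp_equivalent:
  assumes D: "unitary_matrix D"
    and gram: "\<And>\<alpha> \<beta> w. \<alpha> \<in> L.A \<Longrightarrow> \<beta> \<in> L.A \<Longrightarrow> w \<in> L.Zs \<inter> U \<Longrightarrow>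
      gramian_deriv \<alpha> \<beta> (gramian M s) w = D ** gramian_deriv \<alpha> \<beta> (gramian M' s') w ** adj_matrix D"
  shows "unitarily_equivalent (alg \<Omega>) L.Mq (quotient_action \<Omega> J k M) R.Mq (quotient_action \<Omega> J k M')"
proof -
  interpret LQ: hilbert L.Mq by (rule L.hilbert_Mq)
  interpret RQ: hilbert R.Mq by (rule R.hilbert_Mq)
  obtain \<epsilon> where \<epsilon>: "\<epsilon> > 0" "ball 0 \<epsilon> \<subseteq> U" using L.open_U L.zero_U open_contains_ball by blast
  define I where "I = {(w, \<alpha>, i :: 'r). w \<in> ball 0 \<epsilon> \<inter> L.Zs \<and> \<alpha> \<in> L.A}"
  define v where "v = (\<lambda>(w, \<alpha>, i). L.jet \<alpha> i w)"
  define v' where "v' = (\<lambda>(w, \<alpha>, i). \<Sum>j\<in>UNIV. fscale (D $ i $ j) (R.jet \<alpha> j w))"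
  have ballU: "w \<in> U" if "w \<in> ball 0 \<epsilon>" for w using that \<epsilon>(2) by blast
  have vQ: "v x \<in> hcar L.Mq" if "x \<in> I" for x
    using that ballU L.jet_in_Mq by (auto simp: I_def v_def)
  have v'Q: "v' x \<in> hcar R.Mq" if "x \<in> I" for x
  proof -
    obtain w \<alpha> i where x: "x = (w, \<alpha>, i)" by (cases x)
    then have "w \<in> U \<inter> R.Zs" "\<alpha> \<in> R.A" using that ballU by (auto simp: I_def)
    then have "(\<Sum>j\<in>UNIV. fscale (D $ i $ j) (R.jet \<alpha> j w)) \<in> hcar R.Mq"
      by (intro RQ.sum_mem RQ.scale_mem R.jet_in_Mq)
    then show ?thesis by (simp add: v'_def x)
  qed
  have hip_v': "hip M' (v' (w, \<alpha>, i)) h = (\<Sum>j\<in>UNIV. D $ i $ j * hip M' (R.jet \<alpha> j w) h)"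
    if "w \<in> U" "h \<in> hcar M'" for w \<alpha> i h
    using that R.jet_mem[OF that(1)] by (simp add: v'_def R.hip_sum_left R.hip_scale_left)
  have gram_eq: "hip M' (v' x) (v' y) = hip M (v x) (v y)" if "x \<in> I" "y \<in> I" for x y
  proof -
    obtain p \<alpha> i where x: "x = (p, \<alpha>, i)" by (cases x)
    obtain q \<beta> j where y: "y = (q, \<beta>, j)" by (cases y)
    have p: "p \<in> ball 0 \<epsilon>" "p \<in> L.Zs" and q: "q \<in> ball 0 \<epsilon>" "q \<in> L.Zs"
      and \<alpha>: "\<alpha> \<in> L.A" and \<beta>: "\<beta> \<in> L.A" using that by (auto simp: I_def x y)
    \<comment> \<open>The hypothesis on Gramians says that \<open>f\<close> vanishes on the diagonal.\<close>
    define f where "f w u = hip M (L.jet \<alpha> i w) (L.jet \<beta> j u)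
      - (\<Sum>a\<in>UNIV. \<Sum>b\<in>UNIV. D $ i $ a * cnj (D $ j $ b) * hip M' (R.jet \<alpha> a w) (R.jet \<beta> b u))" for w u
    have "f p q = 0"
    proof (rule polarization[where B = "ball 0 \<epsilon>" and J = J])
      fix w u e :: "'m cvec" assume wu: "w \<in> ball 0 \<epsilon>" "u \<in> ball 0 \<epsilon>"
      show "(\<lambda>t. f (w + t *s e) (u + cnj t *s e)) field_differentiable at 0"
        unfolding f_def
        by (intro field_differentiable_diff field_differentiable_mult field_differentiable_sum'
            field_differentiable_const ballU wu
            L.hip_sesquiholomorphic[OF L.open_U L.jet_weakly_holomorphic L.jet_weakly_holomorphic]
            R.hip_sesquiholomorphic[OF R.open_U R.jet_weakly_holomorphic R.jet_weakly_holomorphic])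
    next
      fix w :: "'m cvec" assume w: "w \<in> ball 0 \<epsilon>" "\<forall>i\<in>J. w $ i = 0"
      then have wU: "w \<in> U" using ballU by blast
      then have "w \<in> L.Zs \<inter> U" using w(2) L.U_sub by (auto simp: zero_locus_def)
      from arg_cong[OF gram[OF \<alpha> \<beta> this], of "\<lambda>G. G $ i $ j"]
      show "f w w = 0"
        unfolding conjugation_component L.gramian_deriv_jets[OF wU] R.gramian_deriv_jets[OF wU] f_def by simp
    qed (use p q in \<open>auto simp: zero_locus_def\<close>)
    have "hip M' (v' x) (v' y) = (\<Sum>a\<in>UNIV. \<Sum>b\<in>UNIV. D $ i $ a * cnj (D $ j $ b) * hip M' (R.jet \<alpha> a p) (R.jet \<beta> b q))"
      unfolding x y v'_def prod.case
      by (rule R.hip_combinations[OF R.jet_mem[OF ballU[OF p(1)]] R.jet_mem[OF ballU[OF q(1)]]])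
    also have "\<dots> = hip M (v x) (v y)" using \<open>f p q = 0\<close> by (simp add: f_def v_def x y)
    finally show ?thesis .
  qed
  have total: "h = 0" if h: "h \<in> hcar L.Mq" and orth: "\<And>x. x \<in> I \<Longrightarrow> hip M h (v x) = 0" for h
  proof (rule L.total_in_Mq[OF h \<epsilon>(1)])
    fix w \<alpha> i assume "w \<in> L.Zs" "norm w < \<epsilon>" "w \<in> U" "\<alpha> \<in> L.A"
    then have "(w, \<alpha>, i) \<in> I" by (simp add: I_def)
    then show "hip M (L.jet \<alpha> i w) h = 0"
      using orth[of "(w, \<alpha>, i)"] L.hip_cnj[OF L.Mq_mem[OF h] L.jet_mem[OF \<open>w \<in> U\<close>], of \<alpha> i]
      by (simp add: v_def)
  qed
  have total': "h = 0" if h: "h \<in> hcar R.Mq" and orth: "\<And>x. x \<in> I \<Longrightarrow> hip M' h (v' x) = 0" for h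
  proof (rule R.total_in_Mq[OF h \<epsilon>(1)])
    fix w \<alpha> i assume w: "w \<in> R.Zs" "norm w < \<epsilon>" "w \<in> U" and \<alpha>: "\<alpha> \<in> R.A"
    \<comment> \<open>Orthogonality to the combinations \<open>v'\<close> is inverted by the unitary matrix \<open>D\<close>.\<close>
    have zero: "(\<Sum>j\<in>UNIV. D $ l $ j * hip M' (R.jet \<alpha> j w) h) = 0" for l
    proof -
      have x: "(w, \<alpha>, l) \<in> I" using w \<alpha> by (simp add: I_def)
      show ?thesis
        using hip_v'[OF w(3) R.Mq_mem[OF h], of \<alpha> l] orth[OF x]
          R.hip_cnj[OF R.Mq_mem[OF h] R.Mq_mem[OF v'Q[OF x]]] by simp
    qed
    have "0 = (\<Sum>l\<in>UNIV. cnj (D $ l $ i) * (\<Sum>j\<in>UNIV. D $ l $ j * hip M' (R.jet \<alpha> j w) h))"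
      by (simp add: zero)
    also have "\<dots> = (\<Sum>j\<in>UNIV. (\<Sum>l\<in>UNIV. cnj (D $ l $ i) * D $ l $ j) * hip M' (R.jet \<alpha> j w) h)"
      by (simp add: sum_distrib_left sum_distrib_right mult.assoc) (rule sum.swap)
    also have "\<dots> = hip M' (R.jet \<alpha> i w) h"
      by (simp add: unitary_matrix_columns[OF D] if_distrib[of "\<lambda>x. x * _"] cong: if_cong)
    finally show "hip M' (R.jet \<alpha> i w) h = 0" by simp
  qed
  have "gram_pair L.Mq R.Mq I v v'"
    by unfold_locales (use vQ v'Q gram_eq total in auto)
  moreover have "gram_pair R.Mq L.Mq I v' v"
    by unfold_locales (use vQ v'Q gram_eq total' in auto)
  ultimately obtain T where T: "bij_betw T (hcar L.Mq) (hcar R.Mq)"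
    "\<forall>g\<in>hcar L.Mq. \<forall>h\<in>hcar L.Mq. T (g + h) = T g + T h"
    "\<forall>c. \<forall>h\<in>hcar L.Mq. T (fscale c h) = fscale c (T h)"
    "\<forall>g\<in>hcar L.Mq. \<forall>h\<in>hcar L.Mq. hip R.Mq (T g) (T h) = hip L.Mq g h"
    and Tv: "\<And>h x. h \<in> hcar L.Mq \<Longrightarrow> x \<in> I \<Longrightarrow> hip M' (T h) (v' x) = hip M h (v x)"
    using gram_equal_unitary[of L.Mq R.Mq I v v'] by auto
  have Tmem: "T h \<in> hcar R.Mq" if "h \<in> hcar L.Mq" for h
    using T(1) that bij_betwE by blast
  have Tv': "hip M' (v' x) (T h) = hip M (v x) h" if "h \<in> hcar L.Mq" "x \<in> I" for h x
    using Tv[OF that] L.hip_cnj[OF L.Mq_mem[OF that(1)] L.Mq_mem[OF vQ[OF that(2)]]]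
      R.hip_cnj[OF R.Mq_mem[OF Tmem[OF that(1)]] R.Mq_mem[OF v'Q[OF that(2)]]] by metis
  have "T (quotient_action \<Omega> J k M f h) = quotient_action \<Omega> J k M' f (T h)"
    if f: "f \<in> alg \<Omega>" and h: "h \<in> hcar L.Mq" for f h
  proof -
    let ?l = "T (quotient_action \<Omega> J k M f h)" and ?r = "quotient_action \<Omega> J k M' f (T h)"
    have lQ: "?l \<in> hcar R.Mq" by (rule Tmem[OF L.quotient_action_mem[OF f h]])
    have rQ: "?r \<in> hcar R.Mq" by (rule R.quotient_action_mem[OF f Tmem[OF h]])
    have hM: "h \<in> hcar M" "T h \<in> hcar M'" using L.Mq_mem[OF h] R.Mq_mem[OF Tmem[OF h]] by auto
    have "hip M' ?l (v' x) = hip M' ?r (v' x)" if x: "x \<in> I" for x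
    proof -
      obtain w \<alpha> i where x': "x = (w, \<alpha>, i)" by (cases x)
      have w: "w \<in> U" and \<alpha>: "\<alpha> \<in> L.A" using x ballU by (auto simp: I_def x')
      let ?f = "\<lambda>w. cnj (f (vcnj w))"
      \<comment> \<open>\<open>?g\<close> and \<open>?g'\<close> have the same derivatives of order below \<open>k\<close> at \<open>w\<close>, hence so do their products with \<open>?f\<close>; these products pair the sections with \<open>fmult f h\<close> and \<open>fmult f (T h)\<close>.\<close>
      let ?g = "\<lambda>w. hip M (s i w) h"
      let ?g' = "\<lambda>w. \<Sum>j\<in>UNIV. D $ i $ j * hip M' (s' j w) (T h)"
      have fU: "line_holomorphic_on ?f U"
        using L.symbol_line_holomorphic[OF f] L.U_sub line_holomorphic_subset by blast
      have gU: "line_holomorphic_on ?g U" by (rule L.hip_section_line_holomorphic[OF hM(1)])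
      have g'j: "line_holomorphic_on (\<lambda>w. D $ i $ j * hip M' (s' j w) (T h)) U" for j
        by (intro line_holomorphic_mult line_holomorphic_const R.hip_section_line_holomorphic hM)
      then have g'U: "line_holomorphic_on ?g' U" by (rule line_holomorphic_sum)
      have eU: "line_holomorphic_on (\<lambda>w. ?g w - ?g' w) U"
        by (intro line_holomorphic_diff gU g'U)
      have g'deriv: "multi_deriv partial \<beta> ?g' w = hip M' (v' (w, \<beta>, i)) (T h)" for \<beta>
        unfolding hip_v'[OF w hM(2)]
        by (simp add: multi_deriv_sum[OF R.open_U g'j w] R.hip_jet[OF w hM(2)]
            multi_deriv_cmult[OF R.open_U R.hip_section_line_holomorphic[OF hM(2)] w])
      have "multi_deriv partial \<beta> (\<lambda>w. ?g w - ?g' w) w = 0" if "\<beta> \<in> L.A" for \<beta>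
      proof -
        have xI: "(w, \<beta>, i) \<in> I" using x that by (simp add: I_def x')
        show ?thesis
          using Tv'[OF h xI] L.hip_jet[OF w hM(1), of \<beta> i]
          unfolding multi_deriv_diff[OF L.open_U gU g'U w] g'deriv by (simp add: v_def)
      qed
      then have e0: "multi_deriv partial \<alpha> (\<lambda>w. ?f w * (?g w - ?g' w)) w = 0"
        by (rule L.leibniz_vanishing[OF L.open_U fU eU w \<alpha>])
      have fg': "(\<lambda>w. ?f w * ?g' w) = (\<lambda>w. \<Sum>j\<in>UNIV. D $ i $ j * (?f w * hip M' (s' j w) (T h)))"
        by (simp add: sum_distrib_left mult_ac)
      have "multi_deriv partial \<alpha> (\<lambda>w. ?f w * ?g w) w = multi_deriv partial \<alpha> (\<lambda>w. ?f w * ?g' w) w"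
        using e0 multi_deriv_diff[OF L.open_U line_holomorphic_mult[OF fU gU] line_holomorphic_mult[OF fU g'U] w]
        unfolding right_diff_distrib by simp
      also have "\<dots> = (\<Sum>j\<in>UNIV. D $ i $ j * multi_deriv partial \<alpha> (\<lambda>w. ?f w * hip M' (s' j w) (T h)) w)"
        unfolding fg'
        using multi_deriv_sum[OF R.open_U line_holomorphic_mult[OF line_holomorphic_const
              line_holomorphic_mult[OF fU R.hip_section_line_holomorphic[OF hM(2)]]] w]
          multi_deriv_cmult[OF R.open_U line_holomorphic_mult[OF fU R.hip_section_line_holomorphic[OF hM(2)]] w]
        by simp
      also have "\<dots> = hip M' (v' x) (fmult f (T h))"
        unfolding x' hip_v'[OF w R.fmult_mem[OF f hM(2)]] R.hip_jet_fmult[OF f w hM(2)] ..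
      finally have key: "hip M (v x) (fmult f h) = hip M' (v' x) (fmult f (T h))"
        using L.hip_jet_fmult[OF f w hM(1), of \<alpha> i] by (simp add: v_def x')
      have "hip M' ?l (v' x) = hip M (quotient_action \<Omega> J k M f h) (v x)"
        by (rule Tv[OF L.quotient_action_mem[OF f h] x])
      also have "\<dots> = hip M (fmult f h) (v x)" by (rule L.hip_quotient_action[OF f h vQ[OF x]])
      also have "\<dots> = hip M' (fmult f (T h)) (v' x)"
        using key L.hip_cnj[OF L.Mq_mem[OF vQ[OF x]] L.fmult_mem[OF f hM(1)]]
          R.hip_cnj[OF R.Mq_mem[OF v'Q[OF x]] R.fmult_mem[OF f hM(2)]] by metis
      also have "\<dots> = hip M' ?r (v' x)"
        by (rule R.hip_quotient_action[OF f Tmem[OF h] v'Q[OF x], symmetric])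
      finally show ?thesis .
    qed
    then have "?l - ?r = 0"
      using lQ rQ v'Q R.Mq_mem by (intro total') (auto simp: R.hip_diff_left)
    then show ?thesis by simp
  qed
  then show ?thesis unfolding unitarily_equivalent_def using T by blast
qed

end

theorem theorem5p10:
  fixes \<Omega> U :: "'m::{finite,linorder} cvec set"
    and M M' :: "('m cvec \<Rightarrow> 'r::finite cvec) hspace"
    and s s' :: "'r \<Rightarrow> 'm cvec \<Rightarrow> ('m cvec \<Rightarrow> 'r cvec)"
    and J :: "'m set" and d k :: nat
  assumes "open \<Omega>" "connected \<Omega>" "bounded \<Omega>" "0 \<in> \<Omega>"
    and "1 \<le> d" "d \<le> CARD('m)" "J = first_coords d" "connected (zero_locus \<Omega> J)"
    and "1 \<le> k"
    and "hilbert_module \<Omega> M" "cowen_douglas \<Omega> M"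
    and "hilbert_module \<Omega> M'" "cowen_douglas \<Omega> M'"
    and "open U" "0 \<in> U" "U \<subseteq> vcnj ` \<Omega>"
    and "connected U" "connected (U \<inter> zero_locus (vcnj ` \<Omega>) J)"
    and "normalized_frame \<Omega> J M U s"
    and "normalized_frame \<Omega> J M' U s'"
  shows "unitarily_equivalent (alg \<Omega>)
           (quotient_space \<Omega> J k M) (quotient_action \<Omega> J k M)
           (quotient_space \<Omega> J k M') (quotient_action \<Omega> J k M')
         \<longleftrightarrow>
         (\<exists>D. unitary_matrix D \<and>
            (\<forall>\<alpha>\<in>multi_indices_below J k. \<forall>\<beta>\<in>multi_indices_below J k.
             \<forall>w\<in>zero_locus (vcnj ` \<Omega>) J \<inter> U.
               gramian_deriv \<alpha> \<beta> (gramian M s) w =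
                 D ** gramian_deriv \<alpha> \<beta> (gramian M' s') w ** adj_matrix D))"
proof -
  interpret framed_module_pair \<Omega> U M M' s s' J k
    by unfold_locales (use assms in auto)
  show ?thesis
    using equivalent_imp_gramian[OF \<open>1 \<le> k\<close>] gramian_imp_equivalent by blast
qed

end
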